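(* Let $n\geq2$ and let $\{\Omega(t)\}_t$ be a family of open, bounded convex sets of $\mathbb{R}^n$ with $\Omega(0)=B_1$, whose boundaries are represented radially as $\partial\Omega(t)=\{r(\xi,t)\xi:\xi\in\partial B_1\}$ with \[ r(\xi,t)=1+tV(\xi)+\frac{t^2}{2}A(\xi)+o(t^2), \] where $o(t^2)$ is uniform in $\xi$ and $V,A$ are sufficiently smooth functions on $\partial B_1$. Then \[ W_{n-1}(\Omega(t))=\omega_n+\frac{t}{n}\int_{\partial B_1}V\,d\mathcal{H}^{n-1}_\xi+\frac{t^2}{2n(n-1)}\int_{\partial B_1}\Big[(n-1)A+2(n-3)S_2(D^2V)-(n^2-6n+7)|\nabla_\xi V|^2\Big]\,d\mathcal{H}^{n-1}_\xi+o(t^2). \]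
   Context: $B_1$ is the unit ball of $\mathbb{R}^n$ and $\omega_n=|B_1|$. $W_{n-1}(\Omega)$ is the $(n-1)$-th quermassintegral, defined through the Steiner formula $|\Omega+\rho B_1|=\sum_{i=0}^n\binom{n}{i}W_i(\Omega)\rho^i$; for $C^2$ convex sets $W_{n-1}(\Omega)=\frac1n\int_{\partial\Omega}\sigma_{n-2}\,d\mathcal{H}^{n-1}$, where $\sigma_j$ is the normalized $j$-th elementary symmetric function of the principal curvatures. $\nabla_\xi$ is the tangential gradient on the unit sphere $\partial B_1$, $D^2V$ is the (covariant) Hessian of $V$ on $\partial B_1$, and $S_2(D^2V)$ is the second elementary symmetric polynomial of its eigenvalues. *)

theory Defs
  imports "HOL-Analysis.Analysis" "HOL-Library.Landau_Symbols"
begin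

definition mink_sum :: "'a::real_vector set \<Rightarrow> 'a set \<Rightarrow> 'a set" where
  "mink_sum A B = {x + y | x y. x \<in> A \<and> y \<in> B}"

text \<open>Quermassintegrals via the Steiner formula
  |Omega + rho B_1| = sum_i (n choose i) W_i rho^i, n = DIM('a).\<close>
definition quermass :: "'a::euclidean_space set \<Rightarrow> nat \<Rightarrow> real" where
  "quermass \<Omega> i =
     (SOME W :: nat \<Rightarrow> real. \<forall>\<rho>>0.
        measure lebesgue (mink_sum \<Omega> (cball 0 \<rho>)) =
        (\<Sum>j\<le>DIM('a). real (DIM('a) choose j) * W j * \<rho> ^ j)) i"

definition hext :: "('a::real_normed_vector \<Rightarrow> real) \<Rightarrow> 'a \<Rightarrow> real" where
  "hext V x = V (x /\<^sub>R norm x)"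

definition egrad :: "('a::euclidean_space \<Rightarrow> real) \<Rightarrow> 'a \<Rightarrow> 'a" where
  "egrad f x = (\<Sum>b\<in>Basis. frechet_derivative f (at x) b *\<^sub>R b)"

definition tproj :: "'a::real_inner \<Rightarrow> 'a \<Rightarrow> 'a" where
  "tproj \<xi> v = v - (v \<bullet> \<xi>) *\<^sub>R \<xi>"

definition sph_grad :: "('a::euclidean_space \<Rightarrow> real) \<Rightarrow> 'a \<Rightarrow> 'a" where
  "sph_grad V \<xi> = tproj \<xi> (egrad (hext V) \<xi>)"

text \<open>Covariant Hessian on the sphere, as a linear map of the tangent space
  (extended by 0 in the normal direction): for the 0-homogeneous extension the
  normal derivative vanishes, so D^2 V = P (Euclidean Hessian) P.\<close>
definition sph_hess :: "('a::euclidean_space \<Rightarrow> real) \<Rightarrow> 'a \<Rightarrow> 'a \<Rightarrow> 'a" where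
  "sph_hess V \<xi> = tproj \<xi> \<circ> frechet_derivative (egrad (hext V)) (at \<xi>) \<circ> tproj \<xi>"

definition ltrace :: "('a::euclidean_space \<Rightarrow> 'a) \<Rightarrow> real" where
  "ltrace f = (\<Sum>b\<in>Basis. f b \<bullet> b)"

text \<open>Second elementary symmetric polynomial of the eigenvalues.\<close>
definition S2 :: "('a::euclidean_space \<Rightarrow> 'a) \<Rightarrow> real" where
  "S2 M = ((ltrace M)\<^sup>2 - ltrace (M \<circ> M)) / 2"

text \<open>Integral over the unit sphere w.r.t. H^{n-1}, via the cone identity
  int_{S} f dH = n * int_{B_1} f(x/|x|) dx.\<close>
definition sph_integral :: "('a::euclidean_space \<Rightarrow> real) \<Rightarrow> real" where
  "sph_integral f = real DIM('a) * integral (ball 0 1) (\<lambda>x. f (x /\<^sub>R norm x))"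

definition C2_sphere :: "('a::euclidean_space \<Rightarrow> real) \<Rightarrow> bool" where
  "C2_sphere V \<longleftrightarrow>
     (\<forall>x. x \<noteq> 0 \<longrightarrow> hext V differentiable (at x) \<and> egrad (hext V) differentiable (at x)) \<and>
     (\<forall>u. continuous_on (- {0}) (\<lambda>x. frechet_derivative (egrad (hext V)) (at x) u))"

end

theory Submission
  imports Defs "HOL-Probability.Probability" "HOL-Computational_Algebra.Polynomial"
begin

text \<open>
  Steiner polynomial. Adding a segment of length s to a compact convex set changes the volume by
  an affine function of s, so the volume of K + s Z is a polynomial in s for every zonotope Z. The
  ball is a limit of zonotopes, because the expectation of the absolute value of u . X, for a
  standard Gaussian vector X, is a multiple of the norm of u. As all volumes are O(s^n), the
  polynomials have degree at most n and the limit is again a polynomial.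

  Mean width. The radial function of B + eK is 1 + e h + O(e^2) with h the support function of K.
  The first-order term of the volume of B + eK is therefore the integral of h, and W_(n-1) is the
  integral of h over the sphere divided by n.

  Expansion. Maximising r(xi, t) (xi . u) over xi gives
  h(u) = 1 + tV + t^2/2 (A + |grad V|^2) + o(t^2), uniformly in u.

  Integral identity. It remains to see that the integral of 2 S_2(D^2 V) is (n - 2) times the
  integral of |grad V|^2. The function S_2 of the derivative of a compactly supported C^1 vector
  field integrates to 0; this is applied to a radial cutoff times the gradient of the
  0-homogeneous extension of V.
\<close>

section \<open>The Steiner polynomial\<close>

text \<open>The quermassintegrals are picked by \<open>SOME\<close>, so nothing is known about them
  until some polynomial is shown to fit; hence Steiner's formula comes first, for general convex
  bodies. Zonotopes keep this elementary: one more segment is a one-dimensional matter along each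
  line parallel to it, and no mixed volumes are needed. The identity |B + eK| = e^n |K + B/e|
  reverses the Steiner polynomial, which makes W_(n-1) a first-order coefficient at the ball instead
  of a coefficient at infinity. Surface measure never appears: every sphere integral is an integral
  over the unit ball of a function of x/|x|, undefined in substance only at the origin. V is merely
  C^2, so the minors of the derivative of its gradient field cannot be differentiated again;
  difference quotients take the place of third derivatives. The gradient field is also singular at
  0, which forces a cutoff, and the derivative of the cutoff leaves a term that a second, radial
  vector field removes. The stated second-order integrand is not pointwise that of the support
  function. The two agree only after integration over the sphere.\<close>

definition sweep :: "'a::euclidean_space \<Rightarrow> real \<Rightarrow> 'a set \<Rightarrow> 'a set" where
  "sweep v s L = (\<lambda>(x, c). x + c *\<^sub>R v) ` (L \<times> {-s..s})"

text \<open>For nonnegative s this is the Minkowski sum of L with s times the zonotope spanned by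
  the segments from -v to v; \<open>sweeps vs 1 {0}\<close> is the zonotope itself. Since each
  \<open>sweep\<close> is a linear image of a product, compactness and convexity are
  inherited.\<close>

abbreviation sweeps :: "'a::euclidean_space list \<Rightarrow> real \<Rightarrow> 'a set \<Rightarrow> 'a set" where
  "sweeps vs s L \<equiv> foldr (\<lambda>v. sweep v s) vs L"

lemma compact_sweep: "compact L \<Longrightarrow> compact (sweep v s L)"
  unfolding sweep_def
  by (intro compact_continuous_image compact_Times continuous_intros)
     (auto simp: case_prod_unfold intro!: continuous_intros)

lemma convex_sweep: "convex L \<Longrightarrow> convex (sweep v s L)"
proof -
  assume "convex L"
  moreover have "linear (\<lambda>(x, c). x + c *\<^sub>R v)"
    by (rule linearI) (auto simp: algebra_simps)
  ultimately show ?thesis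
    unfolding sweep_def by (intro convex_linear_image convex_Times) auto
qed

lemma sweep_commute: "sweep v s (sweep w t L) = sweep w t (sweep v s L)"
proof -
  have "sweep v s (sweep w t L) \<subseteq> sweep w t (sweep v s L)" for v w :: 'a and s t L
  proof
    fix y assume "y \<in> sweep v s (sweep w t L)"
    then obtain x c d where "x \<in> L" "c \<in> {-s..s}" "d \<in> {-t..t}" "y = x + d *\<^sub>R w + c *\<^sub>R v"
      by (auto simp: sweep_def)
    then have "y = (x + c *\<^sub>R v) + d *\<^sub>R w" "x + c *\<^sub>R v \<in> sweep v s L"
      by (auto simp: sweep_def)
    then show "y \<in> sweep w t (sweep v s L)"
      using \<open>d \<in> {-t..t}\<close> by (force simp: sweep_def)
  qed
  then show ?thesis by blast
qed

text \<open>The volume formula for one sweep concerns the outermost segment, whereas the induction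
  over the list changes the innermost body. Commuting the sweeps brings the two together.\<close>

lemma sweep_sweeps: "sweep v s (sweeps vs t L) = sweeps vs t (sweep v s L)"
  by (induction vs) (simp_all add: sweep_commute)

lemma compact_sweeps: "compact L \<Longrightarrow> compact (sweeps vs s L)"
  by (induction vs) (simp_all add: compact_sweep)

lemma convex_sweeps: "convex L \<Longrightarrow> convex (sweeps vs s L)"
  by (induction vs) (simp_all add: convex_sweep)

text \<open>Cauchy's functional equation on the half-line. Additivity and nonnegativity give
  monotonicity; with k the floor of m s, both m G(s) and m s G(1) lie between k G(1) and (k + 1)
  G(1). Their distance is at most G(1) for every m, so G(s) and s G(1) coincide.\<close>

lemma additive_mono_imp_linear:
  fixes G :: "real \<Rightarrow> real"
  assumes add: "\<And>s t. 0 \<le> s \<Longrightarrow> 0 \<le> t \<Longrightarrow> G (s + t) = G s + G t"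
    and pos: "\<And>s. 0 \<le> s \<Longrightarrow> 0 \<le> G s" and s: "0 \<le> s"
  shows "G s = s * G 1"
proof -
  have mult: "G (real m * t) = real m * G t" if "0 \<le> t" for m t
  proof (induction m)
    case 0
    show ?case using add[of 0 0] by simp
  next
    case (Suc m)
    have "G (real (Suc m) * t) = G (real m * t + t)" by (simp add: algebra_simps)
    also have "\<dots> = G (real m * t) + G t" using that by (intro add) auto
    finally show ?case using Suc by (simp add: algebra_simps)
  qed
  have mono: "G a \<le> G b" if "0 \<le> a" "a \<le> b" for a b
    using add[of a "b - a"] pos[of "b - a"] that by simp
  have bound: "real m * \<bar>G s - s * G 1\<bar> \<le> G 1" for m
  proof -
    define k where "k = nat \<lfloor>real m * s\<rfloor>"
    have k: "real k \<le> real m * s" "real m * s \<le> real k + 1"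
      using s by (auto simp: k_def of_nat_floor)
    have "G (real k) \<le> G (real m * s)" using k by (intro mono) auto
    moreover have "G (real m * s) \<le> G (real (Suc k))" using k s by (intro mono) auto
    moreover have "G (real m * s) = real m * G s" using s by (rule mult)
    moreover have "G (real k) = real k * G 1" "G (real (Suc k)) = (real k + 1) * G 1"
      using mult[of 1 k] mult[of 1 "Suc k"] by auto
    moreover have "real k * G 1 \<le> real m * s * G 1" "real m * s * G 1 \<le> (real k + 1) * G 1"
      using k pos[of 1] by (auto intro: mult_right_mono)
    moreover have "real m * \<bar>G s - s * G 1\<bar> = \<bar>real m * G s - real m * s * G 1\<bar>"
      by (metis abs_mult abs_of_nat mult.assoc right_diff_distrib)
    ultimately show ?thesis by (simp add: algebra_simps abs_le_iff)
  qed
  have "\<bar>G s - s * G 1\<bar> = 0"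
  proof (rule ccontr)
    assume "\<bar>G s - s * G 1\<bar> \<noteq> 0"
    then have p: "\<bar>G s - s * G 1\<bar> > 0" by simp
    then obtain m where "G 1 < real m * \<bar>G s - s * G 1\<bar>"
      using reals_Archimedean3 by blast
    with bound[of m] show False by simp
  qed
  then show ?thesis by simp
qed

text \<open>For the one-sided sweep \<open>T\<close>, the part gained between s and s + t is a
  translate of the part gained between 0 and t. The gain in volume is therefore additive and
  nonnegative, hence linear. The symmetric sweep of parameter s is a translate of
  \<open>T (2 * s)\<close>.\<close>

lemma measure_sweep_affine:
  fixes L :: "'a::euclidean_space set"
  assumes L: "compact L" "convex L" and s: "0 \<le> s"
  shows "measure lebesgue (sweep v s L) =
    measure lebesgue L + s * (measure lebesgue (sweep v 1 L) - measure lebesgue L)"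
proof -
  define T where "T s = (\<lambda>(x, c). x + c *\<^sub>R v) ` (L \<times> {0..s})" for s :: real
  have compT: "compact (T s)" for s
    unfolding T_def using L(1)
    by (intro compact_continuous_image compact_Times continuous_intros)
       (auto simp: case_prod_unfold intro!: continuous_intros)
  have lm: "T s \<in> lmeasurable" for s using compT by (rule lmeasurable_compact)
  have LT: "L \<subseteq> T s" if "0 \<le> s" for s using that by (force simp: T_def image_iff)
  have TT: "T s \<subseteq> T t" if "s \<le> t" for s t using that by (force simp: T_def)
  have T0: "T 0 = L" by (force simp: T_def image_iff)
  \<comment> \<open>On each line parallel to v, both differences are half-open segments beyond the far end of L.\<close>
  have key: "T (s + t) - T s = (+) (s *\<^sub>R v) ` (T t - L)" if "0 \<le> s" "0 \<le> t" for s t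
  proof (intro equalityI subsetI)
    fix y assume y: "y \<in> T (s + t) - T s"
    then obtain l c where l: "l \<in> L" "0 \<le> c" "c \<le> s + t" "y = l + c *\<^sub>R v"
      by (auto simp: T_def)
    have "c > s"
    proof (rule ccontr)
      assume "\<not> c > s"
      then have "(l, c) \<in> L \<times> {0..s}" using l by auto
      then have "y \<in> T s" unfolding T_def using l by force
      with y show False by simp
    qed
    then have "y - s *\<^sub>R v = l + (c - s) *\<^sub>R v" "(l, c - s) \<in> L \<times> {0..t}"
      using l by (auto simp: algebra_simps)
    then have "y - s *\<^sub>R v \<in> T t" unfolding T_def by force
    moreover have "y - s *\<^sub>R v \<notin> L"
    proof
      assume "y - s *\<^sub>R v \<in> L"
      then have "(y - s *\<^sub>R v, s) \<in> L \<times> {0..s}" using that by auto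
      then have "y \<in> T s" unfolding T_def by force
      with y show False by simp
    qed
    ultimately show "y \<in> (+) (s *\<^sub>R v) ` (T t - L)"
      by (intro image_eqI[of _ _ "y - s *\<^sub>R v"]) auto
  next
    fix y assume "y \<in> (+) (s *\<^sub>R v) ` (T t - L)"
    then obtain x where x: "x \<in> T t" "x \<notin> L" "y = s *\<^sub>R v + x" by auto
    then obtain l c where l: "l \<in> L" "0 \<le> c" "c \<le> t" "x = l + c *\<^sub>R v" by (auto simp: T_def)
    have "y = l + (s + c) *\<^sub>R v" "(l, s + c) \<in> L \<times> {0..s+t}"
      using x l that by (auto simp: algebra_simps)
    then have "y \<in> T (s + t)" unfolding T_def by force
    moreover have "y \<notin> T s"
    proof
      assume "y \<in> T s"
      then obtain l' c' where l': "l' \<in> L" "0 \<le> c'" "c' \<le> s" "y = l' + c' *\<^sub>R v"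
        by (auto simp: T_def)
      then have xl': "x = l' - (s - c') *\<^sub>R v" using x by (simp add: algebra_simps)
      define d where "d = s - c'"
      have d: "0 \<le> d" "x = l' - d *\<^sub>R v" using l' xl' by (auto simp: d_def)
      show False
      proof (cases "c + d = 0")
        case True
        then have "c = 0" using d l by linarith
        then show False using l x by simp
      next
        case False
        then have cd: "c + d > 0" using d l by linarith
        \<comment> \<open>On the line through x parallel to v, the point l lies at distance
          parameter c behind x and l' at parameter d ahead of it, so x is a convex combination of
          two points of L.\<close>
        have "x = (d / (c + d)) *\<^sub>R l + (c / (c + d)) *\<^sub>R l'"
        proof -
          have ll: "l = x - c *\<^sub>R v" "l' = x + d *\<^sub>R v" using l(4) d(2) by (auto simp: algebra_simps)
          have "(d / (c + d)) *\<^sub>R l + (c / (c + d)) *\<^sub>R l' =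
             ((d / (c + d)) + (c / (c + d))) *\<^sub>R x + ((c / (c + d)) * d - (d / (c + d)) * c) *\<^sub>R v"
            unfolding ll by (simp add: algebra_simps)
          also have "(d / (c + d)) + (c / (c + d)) = 1" using cd by (simp add: add_divide_distrib[symmetric])
          finally show ?thesis by simp
        qed
        moreover have "d / (c + d) + c / (c + d) = 1"
          using cd by (simp add: add_divide_distrib[symmetric])
        ultimately have "x \<in> L"
          using convexD[OF L(2), of l l' "d / (c + d)" "c / (c + d)"] l l' d cd by auto
        then show False using x by simp
      qed
    qed
    ultimately show "y \<in> T (s + t) - T s" by simp
  qed
  define G where "G s = measure lebesgue (T s) - measure lebesgue L" for s
  have diff: "measure lebesgue (T t - T s) = measure lebesgue (T t) - measure lebesgue (T s)" if "s \<le> t" for s t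
    using lm TT[OF that] by (intro measurable_measure_Diff) (auto dest: fmeasurableD)
  have "G (s + t) = G s + G t" if "0 \<le> s" "0 \<le> t" for s t
  proof -
    have "measure lebesgue (T (s + t)) - measure lebesgue (T s) = measure lebesgue (T t - T 0)"
      using diff[of s "s + t"] key[OF that] that T0 by (simp add: measure_translation)
    then show ?thesis using diff[of 0 t] that T0 by (simp add: G_def)
  qed
  moreover have "0 \<le> G s" if "0 \<le> s" for s
    unfolding G_def using measure_mono_fmeasurable[OF LT[OF that] _ lm] lmeasurable_compact[OF L(1)]
    by (auto dest: fmeasurableD)
  ultimately have lin: "G s = s * G 1" if "0 \<le> s" for s
    using additive_mono_imp_linear[of G s] that by blast
  have sw: "measure lebesgue (sweep v s L) = measure lebesgue (T (2 * s))" for s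
  proof -
    have "T (2 * s) = (+) (s *\<^sub>R v) ` sweep v s L"
    proof (intro equalityI subsetI)
      fix y assume "y \<in> T (2 * s)"
      then obtain l c where "l \<in> L" "0 \<le> c" "c \<le> 2 * s" "y = l + c *\<^sub>R v" by (auto simp: T_def)
      then have "y = s *\<^sub>R v + (l + (c - s) *\<^sub>R v)" "(l, c - s) \<in> L \<times> {-s..s}"
        by (auto simp: algebra_simps)
      then show "y \<in> (+) (s *\<^sub>R v) ` sweep v s L" unfolding sweep_def by force
    next
      fix y assume "y \<in> (+) (s *\<^sub>R v) ` sweep v s L"
      then obtain l c where "l \<in> L" "-s \<le> c" "c \<le> s" "y = s *\<^sub>R v + (l + c *\<^sub>R v)"
        by (auto simp: sweep_def)
      then have "y = l + (c + s) *\<^sub>R v" "(l, c + s) \<in> L \<times> {0..2 * s}"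
        by (auto simp: algebra_simps)
      then show "y \<in> T (2 * s)" unfolding T_def by force
    qed
    then show ?thesis by (simp add: measure_translation)
  qed
  have "G (2 * s) = s * G 2" using lin[of "2 * s"] lin[of 2] s by simp
  then show ?thesis using sw[of s] sw[of 1] by (simp add: G_def)
qed

text \<open>With p the polynomial for K and q the one for K swept once by v, the affine formula
  yields p + s (q - p). Each vector may raise the degree by one, so no bound by the dimension comes
  out here; growth supplies it later.\<close>

lemma measure_sweeps_poly:
  fixes K :: "'a::euclidean_space set"
  assumes "compact K" "convex K"
  shows "\<exists>p. \<forall>s\<ge>0. measure lebesgue (sweeps vs s K) = poly p s"
  using assms
proof (induction vs arbitrary: K)
  case Nil
  show ?case by (rule exI[of _ "[:measure lebesgue K:]"]) simp
next
  case (Cons v vs)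
  obtain p where p: "\<And>s. s \<ge> 0 \<Longrightarrow> measure lebesgue (sweeps vs s K) = poly p s"
    using Cons by blast
  obtain q where q: "\<And>s. s \<ge> 0 \<Longrightarrow> measure lebesgue (sweeps vs s (sweep v 1 K)) = poly q s"
    using Cons.IH[of "sweep v 1 K"] Cons.prems compact_sweep convex_sweep by blast
  have "measure lebesgue (sweeps (v # vs) s K) = poly (p + [:0, 1:] * (q - p)) s" if "s \<ge> 0" for s
    using measure_sweep_affine[of "sweeps vs s K" s v] that Cons.prems
    by (simp add: compact_sweeps convex_sweeps p q sweep_sweeps)
  then show ?case by blast
qed

section \<open>Zonotopes and their support functions\<close>

lemma mem_sweeps_iff:
  "y \<in> sweeps vs s K \<longleftrightarrow> (\<exists>x\<in>K. \<exists>z\<in>sweeps vs 1 {0}. y = x + s *\<^sub>R z)" if "0 \<le> s"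
proof (induction vs arbitrary: y)
  case Nil
  then show ?case by simp
next
  case (Cons v vs)
  show ?case
  proof
    assume "y \<in> sweeps (v # vs) s K"
    then obtain w c where w: "w \<in> sweeps vs s K" "-s \<le> c" "c \<le> s" "y = w + c *\<^sub>R v"
      by (auto simp: sweep_def)
    then obtain x z where xz: "x \<in> K" "z \<in> sweeps vs 1 {0}" "w = x + s *\<^sub>R z"
      using Cons by blast
    have "\<exists>d\<in>{-1..1}. c = s * d"
    proof (cases "s = 0")
      case True
      then show ?thesis using w by (intro bexI[of _ 0]) auto
    next
      case False
      then have "s > 0" using that by simp
      then show ?thesis using w by (intro bexI[of _ "c / s"]) (auto simp: field_simps)
    qed
    then obtain d where d: "d \<in> {-1..1}" "c = s * d" by blast
    have "z + d *\<^sub>R v \<in> sweeps (v # vs) 1 {0}"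
      using d xz by (auto simp: sweep_def)
    moreover have "y = x + s *\<^sub>R (z + d *\<^sub>R v)"
      using w xz d by (simp add: algebra_simps)
    ultimately show "\<exists>x\<in>K. \<exists>z\<in>sweeps (v # vs) 1 {0}. y = x + s *\<^sub>R z" using xz by blast
  next
    assume "\<exists>x\<in>K. \<exists>z\<in>sweeps (v # vs) 1 {0}. y = x + s *\<^sub>R z"
    then obtain x z d where z: "x \<in> K" "z \<in> sweeps vs 1 {0}" "-1 \<le> d" "d \<le> 1"
       "y = x + s *\<^sub>R (z + d *\<^sub>R v)" by (auto simp: sweep_def)
    then have "x + s *\<^sub>R z \<in> sweeps vs s K" using Cons by blast
    moreover have "y = (x + s *\<^sub>R z) + (s * d) *\<^sub>R v" using z by (simp add: algebra_simps)
    moreover have "s * d \<in> {-s..s}"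
      using mult_left_mono[OF z(3) that] mult_left_mono[OF z(4) that] by auto
    ultimately show "y \<in> sweeps (v # vs) s K" by (force simp: sweep_def)
  qed
qed

text \<open>Together with \<open>inner_sweeps_attained\<close> this computes the support function of
  the zonotope: it is the sum of the |v . u|, attained by taking from each segment the endpoint with
  the sign of v . u.\<close>

lemma inner_sweeps_le:
  "z \<in> sweeps vs 1 {0} \<Longrightarrow> z \<bullet> u \<le> (\<Sum>v\<leftarrow>vs. \<bar>v \<bullet> u\<bar>)"
proof (induction vs arbitrary: z)
  case Nil
  then show ?case by simp
next
  case (Cons v vs)
  then obtain w c where w: "w \<in> sweeps vs 1 {0}" "-1 \<le> c" "c \<le> 1" "z = w + c *\<^sub>R v"
    unfolding foldr.simps o_apply sweep_def[of v] by auto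
  have "c * (v \<bullet> u) \<le> \<bar>c\<bar> * \<bar>v \<bullet> u\<bar>" by (metis abs_ge_self abs_mult)
  also have "\<dots> \<le> 1 * \<bar>v \<bullet> u\<bar>" using w by (intro mult_right_mono) auto
  finally show ?case using Cons.IH[OF w(1)] w by (simp add: inner_left_distrib)
qed

lemma inner_sweeps_attained:
  "\<exists>z\<in>sweeps vs 1 {0}. z \<bullet> u = (\<Sum>v\<leftarrow>vs. \<bar>v \<bullet> u\<bar>)"
proof (induction vs)
  case Nil
  then show ?case by simp
next
  case (Cons v vs)
  then obtain w where w: "w \<in> sweeps vs 1 {0}" "w \<bullet> u = (\<Sum>v\<leftarrow>vs. \<bar>v \<bullet> u\<bar>)" by blast
  define c where "c = (if v \<bullet> u \<ge> 0 then 1 else -1 :: real)"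
  have "(w, c) \<in> sweeps vs 1 {0} \<times> {-1..1}" using w by (auto simp: c_def)
  then have "w + c *\<^sub>R v \<in> sweeps (v # vs) 1 {0}" by (force simp: sweep_def)
  moreover have "(w + c *\<^sub>R v) \<bullet> u = (\<Sum>v\<leftarrow>v # vs. \<bar>v \<bullet> u\<bar>)"
    using w by (auto simp: c_def inner_left_distrib)
  ultimately show ?case by blast
qed

section \<open>Approximation of the ball by zonotopes\<close>

lemma gaussian_vector:
  obtains M and X :: "('a::euclidean_space \<Rightarrow> real) \<Rightarrow> 'a"
  where "prob_space M" "integrable M X"
    "\<And>u. (\<integral>\<omega>. \<bar>X \<omega> \<bullet> u\<bar> \<partial>M) = sqrt (2 / pi) * norm u"
proof -
  define N where "N = density lborel (\<lambda>x. ennreal (std_normal_density x))"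
  define M where "M = (\<Pi>\<^sub>M b\<in>(Basis :: 'a set). N)"
  define X :: "('a \<Rightarrow> real) \<Rightarrow> 'a" where "X \<omega> = (\<Sum>b\<in>Basis. \<omega> b *\<^sub>R b)" for \<omega>
  interpret N: prob_space N unfolding N_def by (rule prob_space_normal_density) simp
  have setsN [measurable_cong]: "sets N = sets borel" by (simp add: N_def)
  interpret P: product_prob_space "\<lambda>_. N" Basis ..
  interpret M: prob_space M unfolding M_def by (rule prob_space_PiM) (rule N.prob_space_axioms)
  have comp_meas [measurable]: "(\<lambda>\<omega>. \<omega> b) \<in> borel_measurable M" if "b \<in> Basis" for b :: 'a
    unfolding M_def using that measurable_component_singleton[of b Basis "\<lambda>_. N"]
    by (simp add: measurable_cong_sets[OF refl setsN])
  have distr_comp: "distr M borel (\<lambda>\<omega>. \<omega> b) = N" if "b \<in> Basis" for b :: 'a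
    using distr_PiM_component[of Basis "\<lambda>_. N" b] that N.prob_space_axioms
    by (simp add: M_def distr_cong[OF refl setsN refl])
  have normal: "distributed M lborel (\<lambda>\<omega>. \<omega> b) std_normal_density" if "b \<in> Basis" for b :: 'a
    using comp_meas[OF that] distr_comp[OF that]
    by (auto simp: distributed_def N_def cong: distr_cong)
  have indep: "M.indep_vars (\<lambda>_. borel) (\<lambda>b \<omega>. \<omega> b) (Basis :: 'a set)"
  proof (subst M.indep_vars_iff_distr_eq_PiM')
    have eqP: "sets (\<Pi>\<^sub>M b\<in>(Basis::'a set). (borel::real measure)) = sets M"
      unfolding M_def by (intro sets_PiM_cong) (auto simp: setsN)
    have "distr M (\<Pi>\<^sub>M b\<in>(Basis::'a set). borel) (\<lambda>\<omega>. \<lambda>b\<in>Basis. \<omega> b) = distr M M (\<lambda>\<omega>. \<omega>)"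
      by (intro distr_cong eqP refl) (auto simp: M_def space_PiM)
    also have "\<dots> = M" by simp
    also have "\<dots> = (\<Pi>\<^sub>M b\<in>Basis. distr M borel (\<lambda>\<omega>. \<omega> b))"
      unfolding M_def[of] by (intro PiM_cong refl) (simp add: distr_comp[unfolded M_def])
    finally show "distr M (\<Pi>\<^sub>M b\<in>(Basis::'a set). borel) (\<lambda>\<omega>. \<lambda>b\<in>Basis. \<omega> b)
      = (\<Pi>\<^sub>M b\<in>Basis. distr M borel (\<lambda>\<omega>. \<omega> b))" .
  qed (use comp_meas in auto)
  \<comment> \<open>Coordinates with u . b = 0 are dropped because the sum rule for independent
    normal variables asks for positive standard deviations. The summand 0 matches the shape of
    \<open>normal_density_affine\<close>.\<close>
  have inner_X: "X \<omega> \<bullet> u = (\<Sum>b\<in>{b\<in>Basis. u \<bullet> b \<noteq> 0}. 0 + (u \<bullet> b) * \<omega> b)" for u \<omega>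
  proof -
    have "X \<omega> \<bullet> u = (\<Sum>b\<in>Basis. (u \<bullet> b) * \<omega> b)"
      by (simp add: X_def inner_sum_left inner_commute[of u] mult.commute)
    also have "\<dots> = (\<Sum>b\<in>{b\<in>Basis. u \<bullet> b \<noteq> 0}. (u \<bullet> b) * \<omega> b)"
      by (rule sum.mono_neutral_right) auto
    finally show ?thesis by simp
  qed
  \<comment> \<open>Rotation invariance in the form needed: the law of X . u depends on u only
    through its norm, and so does the mean of |X . u|.\<close>
  have normal_inner: "distributed M lborel (\<lambda>\<omega>. X \<omega> \<bullet> u) (normal_density 0 (norm u))" if "u \<noteq> 0" for u
  proof -
    define I where "I = {b\<in>Basis. u \<bullet> b \<noteq> 0}"
    have I: "finite I" "I \<noteq> {}" "I \<subseteq> Basis"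
      using that euclidean_eq_iff[of u 0] by (auto simp: I_def)
    have "M.indep_vars (\<lambda>_. borel) (\<lambda>b \<omega>. \<omega> b) I"
      using indep I(3) by (rule M.indep_vars_subset)
    then have ind: "M.indep_vars (\<lambda>_. borel) (\<lambda>b \<omega>. 0 + (u \<bullet> b) * \<omega> b) I"
      by (rule M.indep_vars_compose2) simp
    have "distributed M lborel (\<lambda>\<omega>. \<Sum>b\<in>I. 0 + (u \<bullet> b) * \<omega> b)
       (normal_density (\<Sum>b\<in>I. 0) (sqrt (\<Sum>b\<in>I. \<bar>u \<bullet> b\<bar>\<^sup>2)))"
    proof (rule M.sum_indep_normal[OF I(1,2) ind])
      fix b assume "b \<in> I"
      then have b: "b \<in> Basis" "u \<bullet> b \<noteq> 0" by (auto simp: I_def)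
      then show "0 < \<bar>u \<bullet> b\<bar>" by simp
      show "distributed M lborel (\<lambda>x. 0 + (u \<bullet> b) * x b) (\<lambda>x. ennreal (normal_density 0 \<bar>u \<bullet> b\<bar> x))"
        using M.normal_density_affine[OF normal[OF b(1)], of "u \<bullet> b" 0] b by simp
    qed
    moreover have "sqrt (\<Sum>b\<in>I. \<bar>u \<bullet> b\<bar>\<^sup>2) = norm u"
    proof -
      have "(\<Sum>b\<in>I. \<bar>u \<bullet> b\<bar>\<^sup>2) = (\<Sum>b\<in>Basis. (u \<bullet> b) * (u \<bullet> b))"
        unfolding I_def by (rule sum.mono_neutral_cong_left) (auto simp: power2_eq_square)
      then show ?thesis by (simp add: norm_eq_sqrt_inner euclidean_inner[of u u])
    qed
    ultimately show ?thesis by (simp add: inner_X I_def)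
  qed
  have int1: "integrable M (\<lambda>\<omega>. \<bar>X \<omega> \<bullet> u\<bar>) \<and> (\<integral>\<omega>. \<bar>X \<omega> \<bullet> u\<bar> \<partial>M) = sqrt (2 / pi) * norm u" for u
  proof (cases "u = 0")
    case False
    note n = normal_inner[OF False]
    have "has_bochner_integral lborel (\<lambda>x. normal_density 0 (norm u) x * \<bar>x\<bar>) (norm u * sqrt (2 / pi))"
      using normal_moment_abs_odd[of "norm u" 0 0] False by simp
    then show ?thesis
      using distributed_integral[OF n, of abs] distributed_integrable[OF n, of abs]
      by (auto simp: has_bochner_integral_iff)
  qed simp
  have Xm: "X \<in> borel_measurable M"
    unfolding X_def by measurable
  have "integrable M (\<lambda>\<omega>. \<Sum>b\<in>Basis. \<bar>X \<omega> \<bullet> b\<bar>)" using int1 by auto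
  then have "integrable M X"
    by (rule Bochner_Integration.integrable_bound) (use Xm norm_le_l1 in \<open>auto intro!: AE_I2 order.trans[OF norm_le_l1]\<close>)
  then show ?thesis using that[of M X] int1 M.prob_space_axioms by blast
qed

text \<open>The Gaussian expectation is discretised. A simple function F close to X in L^1 turns the
  expectation into a finite sum of |v . u|, and the error is at most norm u times the L^1 distance
  of X and F. The bound is thus uniform over all directions.\<close>

lemma ex_sum_abs_inner_approx_norm:
  assumes "\<epsilon> > 0"
  shows "\<exists>vs :: 'a::euclidean_space list. \<forall>u. \<bar>(\<Sum>v\<leftarrow>vs. \<bar>v \<bullet> u\<bar>) - norm u\<bar> \<le> \<epsilon> * norm u"
proof -
  obtain M and X :: "('a \<Rightarrow> real) \<Rightarrow> 'a"
    where M: "prob_space M" and X: "integrable M X"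
      and gauss: "\<And>u. (\<integral>\<omega>. \<bar>X \<omega> \<bullet> u\<bar> \<partial>M) = sqrt (2 / pi) * norm u"
    by (rule gaussian_vector) blast
  interpret prob_space M by fact
  define c where "c = sqrt (2 / pi)"
  have c: "c > 0" by (simp add: c_def)
  have [measurable]: "X \<in> borel_measurable M" using X by auto
  obtain F where F: "\<And>i. simple_function M (F i)"
      "\<And>x. x \<in> space M \<Longrightarrow> (\<lambda>i. F i x) \<longlonglongrightarrow> X x"
      "\<And>i x. x \<in> space M \<Longrightarrow> norm (F i x) \<le> 2 * norm (X x)"
    using borel_measurable_implies_sequence_metric[of X M 0] X unfolding norm_conv_dist
    by (metis borel_measurable_integrable)
  have [measurable]: "F i \<in> borel_measurable M" for i using F(1) by (rule borel_measurable_simple_function)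
  have "(\<lambda>i. \<integral>x. norm (X x - F i x) \<partial>M) \<longlonglongrightarrow> (\<integral>x. 0 \<partial>M)"
  proof (rule integral_dominated_convergence[where w = "\<lambda>x. 3 * norm (X x)"])
    show "AE x in M. (\<lambda>i. norm (X x - F i x)) \<longlonglongrightarrow> 0"
    proof (rule AE_I2)
      fix x assume "x \<in> space M"
      then have "(\<lambda>i. norm (X x - F i x)) \<longlonglongrightarrow> norm (X x - X x)"
        by (intro tendsto_intros F)
      then show "(\<lambda>i. norm (X x - F i x)) \<longlonglongrightarrow> 0" by simp
    qed
    show "AE x in M. norm (norm (X x - F i x)) \<le> 3 * norm (X x)" for i
    proof (rule AE_I2)
      fix x assume "x \<in> space M"
      then show "norm (norm (X x - F i x)) \<le> 3 * norm (X x)"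
        using F(3)[of x i] norm_triangle_ineq4[of "X x" "F i x"] by simp
    qed
  qed (use X in auto)
  then have "\<forall>\<^sub>F i in sequentially. (\<integral>x. norm (X x - F i x) \<partial>M) < \<epsilon> * c"
    using assms c by (intro order_tendstoD(2)) auto
  then obtain i where i: "(\<integral>x. norm (X x - F i x) \<partial>M) < \<epsilon> * c"
    unfolding eventually_sequentially by blast
  have FI: "integrable M (F i)"
    by (rule Bochner_Integration.integrable_bound[of M "\<lambda>x. 2 * norm (X x)"]) (use X F(3) in auto)
  obtain ys where ys: "set ys = F i ` space M" "distinct ys"
    using finite_distinct_list[of "F i ` space M"] simple_functionD(1)[OF F(1)] by blast
  define p where "p y = prob {x \<in> space M. F i x = y}" for y
  \<comment> \<open>Each value y of F is weighted by its probability; the division by c = sqrt (2 /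
    pi) makes the limiting expectation exactly norm u.\<close>
  define vs where "vs = map (\<lambda>y. (p y / c) *\<^sub>R y) ys"
  have sumvs: "(\<Sum>v\<leftarrow>vs. \<bar>v \<bullet> u\<bar>) = (\<integral>x. \<bar>F i x \<bullet> u\<bar> \<partial>M) / c" for u
  proof -
    have sets: "{x \<in> space M. F i x = y} \<in> sets M" for y by measurable
    have "(\<integral>x. \<bar>F i x \<bullet> u\<bar> \<partial>M) = (\<integral>x. (\<Sum>y\<in>set ys. indicator {x \<in> space M. F i x = y} x *\<^sub>R \<bar>y \<bullet> u\<bar>) \<partial>M)"
    proof (rule Bochner_Integration.integral_cong[OF refl])
      fix x assume x: "x \<in> space M"
      have "(\<Sum>y\<in>set ys. indicator {x \<in> space M. F i x = y} x *\<^sub>R \<bar>y \<bullet> u\<bar>) =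
        (\<Sum>y\<in>set ys. if y = F i x then \<bar>y \<bullet> u\<bar> else 0)"
        by (rule sum.cong) (auto simp: indicator_def x)
      then show "\<bar>F i x \<bullet> u\<bar> = (\<Sum>y\<in>set ys. indicator {x \<in> space M. F i x = y} x *\<^sub>R \<bar>y \<bullet> u\<bar>)"
        using x ys(1) simple_functionD(1)[OF F(1)[of i]] by simp
    qed
    also have "\<dots> = (\<Sum>y\<in>set ys. p y * \<bar>y \<bullet> u\<bar>)"
      using sets by (subst Bochner_Integration.integral_sum) (auto simp: p_def emeasure_eq_measure)
    also have "\<dots> = c * (\<Sum>v\<leftarrow>vs. \<bar>v \<bullet> u\<bar>)"
      using c by (simp add: vs_def sum_list_distinct_conv_sum_set[OF ys(2)] o_def abs_mult p_def
          sum_distrib_left)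
    finally show ?thesis using c by simp
  qed
  have "\<bar>(\<Sum>v\<leftarrow>vs. \<bar>v \<bullet> u\<bar>) - norm u\<bar> \<le> \<epsilon> * norm u" for u
  proof -
    have Fu: "integrable M (\<lambda>x. \<bar>F i x \<bullet> u\<bar>)" and Xu: "integrable M (\<lambda>x. \<bar>X x \<bullet> u\<bar>)"
      using FI X by auto
    have "\<bar>(\<integral>x. \<bar>F i x \<bullet> u\<bar> \<partial>M) - c * norm u\<bar> = \<bar>\<integral>x. \<bar>F i x \<bullet> u\<bar> - \<bar>X x \<bullet> u\<bar> \<partial>M\<bar>"
      using Fu Xu by (simp add: gauss c_def)
    also have "\<dots> \<le> (\<integral>x. \<bar>\<bar>F i x \<bullet> u\<bar> - \<bar>X x \<bullet> u\<bar>\<bar> \<partial>M)"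
      using integral_norm_bound[of M "\<lambda>x. \<bar>F i x \<bullet> u\<bar> - \<bar>X x \<bullet> u\<bar>"] by simp
    also have "\<dots> \<le> (\<integral>x. norm (X x - F i x) * norm u \<partial>M)"
    proof (rule integral_mono)
      fix x
      have "\<bar>\<bar>F i x \<bullet> u\<bar> - \<bar>X x \<bullet> u\<bar>\<bar> \<le> \<bar>(X x - F i x) \<bullet> u\<bar>"
        by (simp add: inner_diff_left)
      also have "\<dots> \<le> norm (X x - F i x) * norm u" by (rule Cauchy_Schwarz_ineq2)
      finally show "\<bar>\<bar>F i x \<bullet> u\<bar> - \<bar>X x \<bullet> u\<bar>\<bar> \<le> norm (X x - F i x) * norm u" .
    qed (use Fu Xu FI X in auto)
    also have "\<dots> \<le> \<epsilon> * c * norm u"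
      using i by (simp add: mult_right_mono)
    finally have "\<bar>(\<integral>x. \<bar>F i x \<bullet> u\<bar> \<partial>M) - c * norm u\<bar> / c \<le> \<epsilon> * norm u"
      using c by (simp add: field_simps)
    moreover have "\<bar>(\<integral>x. \<bar>F i x \<bullet> u\<bar> \<partial>M) - c * norm u\<bar> / c = \<bar>((\<integral>x. \<bar>F i x \<bullet> u\<bar> \<partial>M) - c * norm u) / c\<bar>"
      using c by simp
    moreover have "((\<integral>x. \<bar>F i x \<bullet> u\<bar> \<partial>M) - c * norm u) / c = (\<Sum>v\<leftarrow>vs. \<bar>v \<bullet> u\<bar>) - norm u"
      using c by (simp add: sumvs diff_divide_distrib)
    ultimately show ?thesis by simp
  qed
  then show ?thesis by blast
qed

text \<open>Inclusions are read off from support functions. For the outer one a point z of the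
  zonotope is tested against the direction z itself; for the inner one a point outside is separated
  by a hyperplane, whose normal contradicts the lower bound for the support function.\<close>

lemma ex_zonotope_approx_cball:
  assumes "0 < \<epsilon>"
  shows "\<exists>vs :: 'a::euclidean_space list.
    cball 0 (1 - \<epsilon>) \<subseteq> sweeps vs 1 {0} \<and> sweeps vs 1 {0} \<subseteq> cball 0 (1 + \<epsilon>)"
proof -
  obtain vs :: "'a list" where vs: "\<And>u. \<bar>(\<Sum>v\<leftarrow>vs. \<bar>v \<bullet> u\<bar>) - norm u\<bar> \<le> \<epsilon> * norm u"
    using ex_sum_abs_inner_approx_norm[OF assms] by blast
  have "norm z \<le> 1 + \<epsilon>" if "z \<in> sweeps vs 1 {0}" for z
  proof (cases "z = 0")
    case False
    have "norm z * norm z \<le> (\<Sum>v\<leftarrow>vs. \<bar>v \<bullet> z\<bar>)"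
      using inner_sweeps_le[OF that, of z] by (simp add: power2_norm_eq_inner[symmetric] power2_eq_square)
    also have "\<dots> \<le> (1 + \<epsilon>) * norm z" using vs[of z] by (simp add: algebra_simps abs_le_iff)
    finally show ?thesis using False by simp
  qed (use assms in auto)
  moreover have "z \<in> sweeps vs 1 {0}" if z: "norm z \<le> 1 - \<epsilon>" for z
  proof (rule ccontr)
    assume "z \<notin> sweeps vs 1 {0}"
    moreover have "convex (sweeps vs 1 {0})" "closed (sweeps vs 1 {0})"
      by (simp add: convex_sweeps, intro compact_imp_closed compact_sweeps, simp)
    ultimately obtain a b where ab: "a \<bullet> z < b" "\<And>x. x \<in> sweeps vs 1 {0} \<Longrightarrow> a \<bullet> x > b"
      using separating_hyperplane_closed_point by metis
    obtain y where y: "y \<in> sweeps vs 1 {0}" "y \<bullet> (-a) = (\<Sum>v\<leftarrow>vs. \<bar>v \<bullet> (-a)\<bar>)"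
      using inner_sweeps_attained by blast
    have "(1 - \<epsilon>) * norm a \<le> y \<bullet> (-a)"
      using vs[of "-a"] y by (simp add: algebra_simps abs_le_iff)
    also have "\<dots> < z \<bullet> (-a)" using ab(1) ab(2)[OF y(1)] by (simp add: inner_commute)
    also have "\<dots> \<le> norm z * norm a" using norm_cauchy_schwarz[of z "-a"] by simp
    also have "\<dots> \<le> (1 - \<epsilon>) * norm a" using z by (intro mult_right_mono) auto
    finally show False by simp
  qed
  ultimately show ?thesis by (intro exI[of _ vs]) (simp add: subset_eq)
qed

section \<open>Degree bounds and pointwise limits of polynomials\<close>

lemma degree_le_of_growth:
  fixes p :: "real poly"
  assumes "\<And>s. s \<ge> 1 \<Longrightarrow> \<bar>poly p s\<bar> \<le> C * s ^ n"
  shows "degree p \<le> n"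
proof (rule ccontr)
  assume "\<not> degree p \<le> n"
  then have d: "degree p > n" by simp
  \<comment> \<open>The reflected polynomial at 1/s equals p(s) / s^(degree p), and its value at 0
    is the leading coefficient of p. If the degree exceeded n, the growth bound would force that
    coefficient to vanish.\<close>
  have "(\<lambda>k. poly (reflect_poly p) (1 / real (Suc k))) \<longlonglongrightarrow> poly (reflect_poly p) 0"
    by (intro tendsto_intros LIMSEQ_Suc[OF lim_1_over_n])
  moreover have "(\<lambda>k. poly (reflect_poly p) (1 / real (Suc k))) \<longlonglongrightarrow> 0"
  proof (rule Lim_null_comparison)
    show "\<forall>\<^sub>F k in sequentially. norm (poly (reflect_poly p) (1 / real (Suc k))) \<le> C * (1 / real (Suc k))"
    proof (rule always_eventually, rule allI)
      fix k
      define s where "s = real (Suc k)"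
      have s: "s \<ge> 1" by (simp add: s_def)
      have C: "C \<ge> 0" using assms[of 1] by simp
      have "\<bar>poly (reflect_poly p) (1 / s)\<bar> = \<bar>poly p s\<bar> / s ^ degree p"
        using s by (subst poly_reflect_poly_nz) (auto simp: abs_mult power_divide divide_simps)
      also have "\<dots> \<le> C * s ^ n / s ^ degree p"
        using assms[OF s] s by (intro divide_right_mono) auto
      also have "\<dots> = C / s ^ (degree p - n)"
        using s d by (simp add: power_diff field_simps)
      also have "\<dots> \<le> C / s"
        using self_le_power[OF s, of "degree p - n"] s d C by (intro divide_left_mono) auto
      finally show "norm (poly (reflect_poly p) (1 / real (Suc k))) \<le> C * (1 / real (Suc k))"
        by (simp add: s_def)
    qed
    show "(\<lambda>k. C * (1 / real (Suc k))) \<longlonglongrightarrow> 0"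
      by (intro tendsto_mult_right_zero LIMSEQ_Suc[OF lim_1_over_n])
  qed
  ultimately have "poly (reflect_poly p) 0 = 0" by (rule LIMSEQ_unique)
  then have "p = 0" by (simp add: poly_0_coeff_0)
  with d show False by simp
qed

text \<open>Lagrange interpolation expresses each polynomial of degree at most n through its values
  at n + 1 fixed nodes, so convergence at the nodes identifies the limit everywhere. The nodes 1,
  ..., n + 1 are positive because convergence is assumed only there.\<close>

lemma tendsto_poly_closed:
  fixes p :: "nat \<Rightarrow> real poly" and F :: "real \<Rightarrow> real"
  assumes deg: "\<And>k. degree (p k) \<le> n"
    and lim: "\<And>s. s > 0 \<Longrightarrow> (\<lambda>k. poly (p k) s) \<longlonglongrightarrow> F s"
  shows "\<exists>q. degree q \<le> n \<and> (\<forall>s>0. F s = poly q s)"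
proof -
  define A where "A = real ` {1..Suc n}"
  have A: "finite A" "card A = Suc n" "\<And>a. a \<in> A \<Longrightarrow> a > 0"
    by (auto simp: A_def card_image)
  define L where "L a = (\<Prod>b\<in>A - {a}. smult (1 / (a - b)) [:-b, 1:])" for a :: real
  have degL: "degree (L a) \<le> n" if "a \<in> A" for a
  proof -
    have "degree (L a) \<le> (\<Sum>b\<in>A - {a}. degree (smult (1 / (a - b)) [:-b, 1:]))"
      unfolding L_def using degree_prod_sum_le[of "A - {a}" "\<lambda>b. smult (1 / (a - b)) [:-b, 1:]"] A(1)
    by (simp only: o_def finite_Diff)
    also have "\<dots> \<le> (\<Sum>b\<in>A - {a}. 1)"
      by (intro sum_mono) (simp add: degree_smult_le)
    also have "\<dots> = n" using A that by simp
    finally show ?thesis .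
  qed
  have polyL: "poly (L a) b = (if b = a then 1 else 0)" if "a \<in> A" "b \<in> A" for a b
  proof (cases "b = a")
    case True
    have "poly (smult (1 / (a - c)) [:-c, 1:]) a = 1" if "c \<in> A - {a}" for c
      using that by (simp add: diff_divide_distrib[symmetric])
    then show ?thesis using True by (simp add: L_def poly_prod del: poly_smult)
  next
    case False
    then have "b \<in> A - {a}" using that by simp
    then show ?thesis using False A(1) by (auto simp: L_def poly_prod)
  qed
  have interp: "q = (\<Sum>a\<in>A. smult (poly q a) (L a))" if "degree q \<le> n" for q
  proof (rule poly_eqI_degree[of A])
    fix x assume "x \<in> A"
    then show "poly q x = poly (\<Sum>a\<in>A. smult (poly q a) (L a)) x"
      using A(1) by (simp add: poly_sum polyL if_distrib cong: if_cong)
  next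
    show "card A > degree q" using that A by simp
    have "degree (\<Sum>a\<in>A. smult (poly q a) (L a)) \<le> n"
      using degL degree_smult_le order_trans by (intro degree_sum_le A(1)) blast
    then show "card A > degree (\<Sum>a\<in>A. smult (poly q a) (L a))" using A by simp
  qed
  define q where "q = (\<Sum>a\<in>A. smult (F a) (L a))"
  have "degree q \<le> n"
    unfolding q_def using degL degree_smult_le order_trans by (intro degree_sum_le A(1)) blast
  moreover have "F s = poly q s" if "s > 0" for s
  proof -
    have "(\<lambda>k. poly (\<Sum>a\<in>A. smult (poly (p k) a) (L a)) s) \<longlonglongrightarrow> poly q s"
      unfolding q_def poly_sum poly_smult by (intro tendsto_intros lim A(3))
    then have "(\<lambda>k. poly (p k) s) \<longlonglongrightarrow> poly q s"
      using interp[OF deg] by simp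
    then show ?thesis using lim[OF that] LIMSEQ_unique by blast
  qed
  ultimately show ?thesis by blast
qed

section \<open>Parallel bodies K + sB and Steiner's formula\<close>

lemma compact_mink_sum: "compact S \<Longrightarrow> compact T \<Longrightarrow> compact (mink_sum S T)"
  for S :: "'a::euclidean_space set"
  unfolding mink_sum_def by (rule compact_sums)

lemma mink_sum_mono: "T \<subseteq> T' \<Longrightarrow> mink_sum S T \<subseteq> mink_sum S T'"
  by (auto simp: mink_sum_def)

text \<open>The contraction with ratio l towards a point k of K maps K into itself and balls of
  radius s to balls of radius l s. This controls how fast the volume of a parallel body can change
  with the radius, by a factor independent of K.\<close>

lemma measure_mink_sum_cball_scale:
  fixes K :: "'a::euclidean_space set"
  assumes K: "compact K" "convex K" and l: "0 \<le> l" "l \<le> 1" and s: "0 \<le> s"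
  shows "l ^ DIM('a) * measure lebesgue (mink_sum K (cball 0 s)) \<le> measure lebesgue (mink_sum K (cball 0 (l * s)))"
proof (cases "K = {}")
  case True
  then show ?thesis by (simp add: mink_sum_def)
next
  case False
  then obtain k where k: "k \<in> K" by blast
  have lm: "mink_sum K (cball 0 t) \<in> lmeasurable" for t
    using K by (intro lmeasurable_compact compact_mink_sum) auto
  have sub: "(\<lambda>x. l *\<^sub>R x + (1 - l) *\<^sub>R k) ` mink_sum K (cball 0 s) \<subseteq> mink_sum K (cball 0 (l * s))"
  proof
    fix y assume "y \<in> (\<lambda>x. l *\<^sub>R x + (1 - l) *\<^sub>R k) ` mink_sum K (cball 0 s)"
    then obtain x b where x: "x \<in> K" "norm b \<le> s" "y = l *\<^sub>R (x + b) + (1 - l) *\<^sub>R k"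
      by (auto simp: mink_sum_def)
    then have "y = (l *\<^sub>R x + (1 - l) *\<^sub>R k) + l *\<^sub>R b" by (simp add: algebra_simps)
    moreover have "l *\<^sub>R x + (1 - l) *\<^sub>R k \<in> K" using K x k l by (intro convexD) auto
    moreover have "l *\<^sub>R b \<in> cball 0 (l * s)" using x l by (simp add: mult_left_mono)
    ultimately show "y \<in> mink_sum K (cball 0 (l * s))" unfolding mink_sum_def by blast
  qed
  have "compact ((\<lambda>x. l *\<^sub>R x + (1 - l) *\<^sub>R k) ` mink_sum K (cball 0 s))"
    using K by (intro compact_continuous_image continuous_intros compact_mink_sum) auto
  then have "measure lebesgue ((\<lambda>x. l *\<^sub>R x + (1 - l) *\<^sub>R k) ` mink_sum K (cball 0 s))
     \<le> measure lebesgue (mink_sum K (cball 0 (l * s)))"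
    by (intro measure_mono_fmeasurable sub lm) (auto dest!: lmeasurable_compact fmeasurableD)
  then show ?thesis using l by (simp add: measure_lebesgue_affine)
qed

text \<open>In this form an inclusion between the zonotope and a ball carries over to the swept body
  and a parallel body of K.\<close>

lemma sweeps_conv_mink_sum:
  "0 \<le> s \<Longrightarrow> sweeps vs s K = mink_sum K ((*\<^sub>R) s ` sweeps vs 1 {0})"
  unfolding mink_sum_def set_eq_iff mem_sweeps_iff[of s] by blast

text \<open>Let F(s) be the volume of K + sB and p_k the polynomial of the k-th zonotope. The
  inclusions and the contraction estimate squeeze p_k(s) between (1 - e_k)^n F(s) and (1 + e_k)^n
  F(s); so p_k tends to F pointwise, and a growth bound for F bounds all degrees at once.\<close>

proposition steiner_polynomial:
  fixes K :: "'a::euclidean_space set"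
  assumes K: "compact K" "convex K"
  shows "\<exists>q. degree q \<le> DIM('a) \<and> (\<forall>s>0. measure lebesgue (mink_sum K (cball 0 s)) = poly q s)"
proof -
  define F where "F s = measure lebesgue (mink_sum K (cball 0 s))" for s
  have lm: "mink_sum K (cball 0 t) \<in> lmeasurable" for t
    using K by (intro lmeasurable_compact compact_mink_sum) auto
  \<comment> \<open>The shift by two keeps \<open>e k\<close> below 1, so that 1 -
    \<open>e k\<close> is a positive contraction ratio.\<close>
  define e where "e k = 1 / real (Suc (Suc k))" for k
  have e: "0 < e k" "e k < 1" for k by (auto simp: e_def)
  have e0: "e \<longlonglongrightarrow> 0" unfolding e_def by (intro LIMSEQ_Suc lim_1_over_n)
  have "\<exists>vs :: 'a list. cball 0 (1 - e k) \<subseteq> sweeps vs 1 {0} \<and> sweeps vs 1 {0} \<subseteq> cball 0 (1 + e k)" for k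
    by (rule ex_zonotope_approx_cball) (rule e)
  then obtain vs :: "nat \<Rightarrow> 'a list"
    where vs: "\<And>k. cball 0 (1 - e k) \<subseteq> sweeps (vs k) 1 {0}" "\<And>k. sweeps (vs k) 1 {0} \<subseteq> cball 0 (1 + e k)"
    by metis
  have "\<exists>p. \<forall>s\<ge>0. measure lebesgue (sweeps (vs k) s K) = poly p s" for k
    using measure_sweeps_poly[OF K] .
  then obtain p where p: "\<And>k s. s \<ge> 0 \<Longrightarrow> measure lebesgue (sweeps (vs k) s K) = poly (p k) s"
    by metis
  have scale: "(*\<^sub>R) s ` cball 0 t = cball (0::'a) (s * t)" if "s > 0" for s t :: real
    using that by (subst cball_scale) auto
  have sub1: "mink_sum K (cball 0 ((1 - e k) * s)) \<subseteq> sweeps (vs k) s K"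
    and sub2: "sweeps (vs k) s K \<subseteq> mink_sum K (cball 0 ((1 + e k) * s))" if "s > 0" for k s
  proof -
    have "cball 0 ((1 - e k) * s) \<subseteq> (*\<^sub>R) s ` sweeps (vs k) 1 {0}"
      using image_mono[OF vs(1)[of k], of "(*\<^sub>R) s"] scale[OF that] by (simp add: mult.commute)
    then show "mink_sum K (cball 0 ((1 - e k) * s)) \<subseteq> sweeps (vs k) s K"
      unfolding sweeps_conv_mink_sum[OF less_imp_le[OF that], of "vs k" K] by (rule mink_sum_mono)
    have "(*\<^sub>R) s ` sweeps (vs k) 1 {0} \<subseteq> cball 0 ((1 + e k) * s)"
      using image_mono[OF vs(2)[of k], of "(*\<^sub>R) s"] scale[OF that] by (simp add: mult.commute)
    then show "sweeps (vs k) s K \<subseteq> mink_sum K (cball 0 ((1 + e k) * s))"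
      unfolding sweeps_conv_mink_sum[OF less_imp_le[OF that], of "vs k" K] by (rule mink_sum_mono)
  qed
  have lmS: "sweeps (vs k) s K \<in> lmeasurable" for k s
    using K by (intro lmeasurable_compact compact_sweeps) auto
  have lower: "(1 - e k) ^ DIM('a) * F s \<le> poly (p k) s" if "s > 0" for k s
  proof -
    have "(1 - e k) ^ DIM('a) * F s \<le> F ((1 - e k) * s)"
      unfolding F_def using e[of k] that by (intro measure_mink_sum_cball_scale K) auto
    also have "\<dots> \<le> measure lebesgue (sweeps (vs k) s K)"
      unfolding F_def using lm by (intro measure_mono_fmeasurable sub1 that lmS) auto
    finally show ?thesis using p that by simp
  qed
  have upper: "poly (p k) s \<le> (1 + e k) ^ DIM('a) * F s" if "s > 0" for k s
  proof -
    have "measure lebesgue (sweeps (vs k) s K) \<le> F ((1 + e k) * s)"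
      unfolding F_def by (rule measure_mono_fmeasurable[OF sub2[OF that] fmeasurableD[OF lmS] lm])
    then have "poly (p k) s \<le> F ((1 + e k) * s)"
      using p[of s k] that by simp
    \<comment> \<open>The ratio must not exceed 1, so the estimate is applied to the larger radius
      (1 + \<open>e k\<close>) s with ratio 1 / (1 + \<open>e k\<close>) and then solved for the
      volume at that radius.\<close>
    moreover have "(1 / (1 + e k)) ^ DIM('a) * F ((1 + e k) * s) \<le> F ((1 / (1 + e k)) * ((1 + e k) * s))"
      unfolding F_def using e[of k] that by (intro measure_mink_sum_cball_scale K) auto
    then have "F ((1 + e k) * s) / (1 + e k) ^ DIM('a) \<le> F s"
      using e(1)[of k] by (simp add: power_one_over)
    then have "F ((1 + e k) * s) \<le> (1 + e k) ^ DIM('a) * F s"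
      using e(1)[of k] by (simp add: divide_le_eq mult.commute)
    ultimately show ?thesis by linarith
  qed
  have lim: "(\<lambda>k. poly (p k) s) \<longlonglongrightarrow> F s" if "s > 0" for s
  proof (rule tendsto_sandwich)
    show "\<forall>\<^sub>F k in sequentially. (1 - e k) ^ DIM('a) * F s \<le> poly (p k) s"
      using lower[OF that] by simp
    show "\<forall>\<^sub>F k in sequentially. poly (p k) s \<le> (1 + e k) ^ DIM('a) * F s"
      using upper[OF that] by simp
    have "(\<lambda>k. (1 - e k) ^ DIM('a) * F s) \<longlonglongrightarrow> (1 - 0) ^ DIM('a) * F s"
      by (intro tendsto_intros e0)
    then show "(\<lambda>k. (1 - e k) ^ DIM('a) * F s) \<longlonglongrightarrow> F s" by simp
    have "(\<lambda>k. (1 + e k) ^ DIM('a) * F s) \<longlonglongrightarrow> (1 + 0) ^ DIM('a) * F s"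
      by (intro tendsto_intros e0)
    then show "(\<lambda>k. (1 + e k) ^ DIM('a) * F s) \<longlonglongrightarrow> F s" by simp
  qed
  obtain R where R: "R > 0" "\<And>x. x \<in> K \<Longrightarrow> norm x \<le> R"
    using compact_imp_bounded[OF K(1)] bounded_pos by blast
  have "degree (p k) \<le> DIM('a)" for k
  proof (rule degree_le_of_growth)
    fix s :: real assume s: "s \<ge> 1"
    \<comment> \<open>For s at least 1, R + s is at most (R + 1) s, so the parallel body fits into a
      ball whose radius is linear in s.\<close>
    have "mink_sum K (cball 0 s) \<subseteq> (\<lambda>x. ((R + 1) * s) *\<^sub>R x + 0) ` cball 0 1"
    proof
      fix y assume "y \<in> mink_sum K (cball 0 s)"
      then obtain x b where x: "x \<in> K" "norm b \<le> s" "y = x + b" by (auto simp: mink_sum_def)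
      have "norm y \<le> R + s" using x R(2)[OF x(1)] norm_triangle_ineq[of x b] by simp
      also have "\<dots> \<le> (R + 1) * s" using s R by (simp add: algebra_simps)
      finally have ny: "norm y \<le> (R + 1) * s" .
      define c where "c = (R + 1) * s"
      have "c > 0" using s R by (simp add: c_def)
      moreover have "norm y \<le> c" using ny by (simp only: c_def)
      ultimately have "y /\<^sub>R c \<in> cball 0 1" "y = c *\<^sub>R (y /\<^sub>R c) + 0"
        by (simp_all add: field_simps)
      then show "y \<in> (\<lambda>x. ((R + 1) * s) *\<^sub>R x + 0) ` cball 0 1"
        unfolding c_def by blast
    qed
    then have "F s \<le> measure lebesgue ((\<lambda>x. ((R + 1) * s) *\<^sub>R x + 0) ` cball (0::'a) 1)"
      unfolding F_def using lm
      by (intro measure_mono_fmeasurable lmeasurable_compact compact_continuous_image continuous_intros) auto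
    also have "\<dots> = ((R + 1) * s) ^ DIM('a) * measure lebesgue (cball (0::'a) 1)"
      unfolding measure_lebesgue_affine using s R by simp
    finally have Fs: "F s \<le> ((R + 1) * s) ^ DIM('a) * measure lebesgue (cball (0::'a) 1)" .
    have "(1 + e k) ^ DIM('a) \<le> 2 ^ DIM('a)" using e[of k] by (intro power_mono) auto
    then have "poly (p k) s \<le> 2 ^ DIM('a) * F s"
      using upper[of s k] s mult_right_mono[of "(1 + e k) ^ DIM('a)" "2 ^ DIM('a)" "F s"] by (simp add: F_def)
    also have "\<dots> \<le> 2 ^ DIM('a) * (((R + 1) * s) ^ DIM('a) * measure lebesgue (cball (0::'a) 1))"
      using Fs by simp
    finally show "\<bar>poly (p k) s\<bar> \<le> (2 ^ DIM('a) * (R + 1) ^ DIM('a) * measure lebesgue (cball (0::'a) 1)) * s ^ DIM('a)"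
      using p[of s k, symmetric] s by (simp add: power_mult_distrib mult_ac)
  qed
  then show ?thesis using tendsto_poly_closed[of p "DIM('a)" F] lim by (simp add: F_def)
qed

text \<open>Steiner's formula was proved for compact bodies, while the quermassintegrals are those
  of open sets. Passing to the closure adds only points of the frontier of a convex set, which is a
  null set.\<close>

lemma measure_mink_sum_cball_closure:
  fixes K :: "'a::euclidean_space set"
  assumes K: "open K" "bounded K" "convex K" and s: "s > 0"
  shows "measure lebesgue (mink_sum K (cball 0 s)) = measure lebesgue (mink_sum (closure K) (cball 0 s))"
proof -
  have cK: "compact (closure K)" using K by (simp add: compact_closure)
  have sub: "mink_sum K (cball 0 s) \<subseteq> mink_sum (closure K) (cball 0 s)"
    using closure_subset[of K] by (auto simp: mink_sum_def)
  have sub': "mink_sum (closure K) (cball 0 s) \<subseteq> closure (mink_sum K (cball 0 s))"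
  proof
    fix y assume "y \<in> mink_sum (closure K) (cball 0 s)"
    then obtain x b where x: "x \<in> closure K" "b \<in> cball 0 s" "y = x + b" by (auto simp: mink_sum_def)
    then obtain f where f: "\<And>n. f n \<in> K" "f \<longlonglongrightarrow> x" by (auto simp: closure_sequential)
    have "(\<lambda>n. f n + b) \<longlonglongrightarrow> y" using f x by (auto intro: tendsto_intros)
    moreover have "f n + b \<in> mink_sum K (cball 0 s)" for n using f x by (auto simp: mink_sum_def)
    ultimately show "y \<in> closure (mink_sum K (cball 0 s))" unfolding closure_sequential
      by (intro exI[of _ "\<lambda>n. f n + b"]) simp
  qed
  have eq: "mink_sum K (cball 0 s) = (\<Union>x\<in>K. \<Union>y\<in>cball 0 s. {x + y})"
    unfolding mink_sum_def by blast
  have "convex (mink_sum K (cball 0 s))"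
    using convex_sums[OF K(3) convex_cball[of 0 s]] by (simp add: eq)
  then have neg: "negligible (frontier (mink_sum K (cball 0 s)))" by (rule negligible_convex_frontier)
  have "mink_sum (closure K) (cball 0 s) - mink_sum K (cball 0 s) \<subseteq> frontier (mink_sum K (cball 0 s))"
  proof -
    have "open (mink_sum K (cball 0 s))"
      unfolding eq using K(1) by (intro open_sums) simp
    then show ?thesis using sub' by (auto simp: frontier_def interior_open)
  qed
  with neg have "negligible (mink_sum (closure K) (cball 0 s) - mink_sum K (cball 0 s))"
    using negligible_subset by blast
  then show ?thesis
    using sub by (intro measure_negligible_symdiff)
      (auto intro!: lmeasurable_compact compact_mink_sum cK simp: Diff_eq_empty_iff[THEN iffD2])
qed

section \<open>The mean width\<close>

lemma normalize_scaleR: "c > 0 \<Longrightarrow> (c *\<^sub>R x) /\<^sub>R norm (c *\<^sub>R x) = x /\<^sub>R norm x"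
  for x :: "'a::real_normed_vector"
  by (simp add: divide_simps)

text \<open>Polar coordinates without a surface measure. On the directions where the radial function
  has the value c, the set is the dilation by c of the corresponding sector of the unit ball, so its
  volume is multiplied by c^n.\<close>

lemma emeasure_radial_simple:
  fixes f :: "'a::euclidean_space \<Rightarrow> real"
  assumes f: "simple_function borel f" "\<And>x. 0 \<le> f x"
  shows "emeasure lborel {x. norm x < f (x /\<^sub>R norm x)} =
    (\<integral>\<^sup>+x. ennreal (f (x /\<^sub>R norm x) ^ DIM('a)) * indicator (ball 0 1) x \<partial>lborel)"
proof -
  have [measurable]: "f \<in> borel_measurable borel" using f(1) by (rule borel_measurable_simple_function)
  have fin: "finite (range f)" using simple_functionD(1)[OF f(1)] by simp
  define E where "E c r = {x. f (x /\<^sub>R norm x) = c \<and> norm x < r}" for c r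
  have [measurable]: "E c r \<in> sets borel" for c r unfolding E_def by measurable
  have scale: "emeasure lborel (E c c) = ennreal (c ^ DIM('a)) * emeasure lborel (E c 1)" if c: "0 \<le> c" for c
  proof (cases "c = 0")
    case True
    then have "E c c = {}" by (auto simp: E_def)
    then show ?thesis using True by (simp add: power_0_left)
  next
    case False
    then have c: "c > 0" using c by simp
    have "E c c = (\<lambda>x. c *\<^sub>R x + 0) ` E c 1"
    proof (intro equalityI subsetI)
      fix x assume x: "x \<in> E c c"
      then have "x /\<^sub>R c \<in> E c 1"
        using c normalize_scaleR[of "inverse c" x] unfolding E_def mem_Collect_eq by (simp add: field_simps)
      then show "x \<in> (\<lambda>x. c *\<^sub>R x + 0) ` E c 1"
        using c by (intro image_eqI[of _ _ "x /\<^sub>R c"]) auto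
    next
      fix x assume "x \<in> (\<lambda>x. c *\<^sub>R x + 0) ` E c 1"
      then obtain y where "x = c *\<^sub>R y" "f (y /\<^sub>R norm y) = c" "norm y < 1" by (auto simp: E_def)
      moreover from this have "f (x /\<^sub>R norm x) = c" using normalize_scaleR[OF c, of y] by metis
      ultimately show "x \<in> E c c" using c by (simp add: E_def)
    qed
    then have "emeasure lebesgue (E c c) = \<bar>c\<bar> ^ DIM('a) * emeasure lebesgue (E c 1)"
      by (simp add: emeasure_lebesgue_affine del: add_0_right)
    then show ?thesis using c by simp
  qed
  have eq: "{x. norm x < f (x /\<^sub>R norm x)} = (\<Union>c\<in>range f. E c c)" by (auto simp: E_def)
  have "emeasure lborel {x. norm x < f (x /\<^sub>R norm x)} = (\<Sum>c\<in>range f. emeasure lborel (E c c))"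
    unfolding eq
  proof (rule sum_emeasure[symmetric])
    show "disjoint_family_on (\<lambda>c. E c c) (range f)" unfolding disjoint_family_on_def E_def by blast
  qed (use fin in auto)
  also have "\<dots> = (\<Sum>c\<in>range f. ennreal (c ^ DIM('a)) * emeasure lborel (E c 1))"
    by (intro sum.cong refl scale) (auto simp: f)
  also have "\<dots> = (\<integral>\<^sup>+x. (\<Sum>c\<in>range f. ennreal (c ^ DIM('a)) * indicator (E c 1) x) \<partial>lborel)"
    using fin by (subst nn_integral_sum) (auto simp: nn_integral_cmult_indicator)
  also have "\<dots> = (\<integral>\<^sup>+x. ennreal (f (x /\<^sub>R norm x) ^ DIM('a)) * indicator (ball 0 1) x \<partial>lborel)"
  proof (intro nn_integral_cong)
    fix x :: 'a
    have "(\<Sum>c\<in>range f. ennreal (c ^ DIM('a)) * indicator (E c 1) x) =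
      (\<Sum>c\<in>range f. if c = f (x /\<^sub>R norm x) then ennreal (c ^ DIM('a)) * indicator (ball 0 1) x else 0)"
      by (intro sum.cong) (auto simp: E_def indicator_def)
    then show "(\<Sum>c\<in>range f. ennreal (c ^ DIM('a)) * indicator (E c 1) x) =
      ennreal (f (x /\<^sub>R norm x) ^ DIM('a)) * indicator (ball 0 1) x"
      using fin by simp
  qed
  finally show ?thesis .
qed

text \<open>Monotone approximation by simple functions. The strict inequality in the set matters: if
  norm x lies below the limit, it already lies below some approximation, so the approximating sets
  exhaust the limit set.\<close>

lemma emeasure_radial:
  fixes R :: "'a::euclidean_space \<Rightarrow> real"
  assumes R [measurable]: "R \<in> borel_measurable borel" and pos: "\<And>x. 0 \<le> R x"
  shows "emeasure lborel {x. norm x < R (x /\<^sub>R norm x)} =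
    (\<integral>\<^sup>+x. ennreal (R (x /\<^sub>R norm x) ^ DIM('a)) * indicator (ball 0 1) x \<partial>lborel)"
proof -
  obtain f where f: "incseq f" "\<And>i. simple_function borel (f i)"
      "\<And>x. bdd_above (range (\<lambda>i. f i x))" "\<And>i x. 0 \<le> f i x" "R = (SUP i. f i)"
    using borel_measurable_implies_simple_function_sequence_real[OF R pos] by metis
  have [measurable]: "ball (0::'a) 1 \<in> sets borel" by simp
  have [measurable]: "f i \<in> borel_measurable borel" for i using f(2) by (rule borel_measurable_simple_function)
  have inc: "incseq (\<lambda>i. f i x)" for x using f(1) by (auto simp: incseq_def le_fun_def)
  have Rx: "R x = (SUP i. f i x)" for x
    unfolding f(5) by (simp add: image_image)
  have lim: "(\<lambda>i. f i x) \<longlonglongrightarrow> R x" for x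
    unfolding Rx by (rule LIMSEQ_incseq_SUP[OF f(3) inc])
  have "(\<lambda>i. emeasure lborel {x. norm x < f i (x /\<^sub>R norm x)})
      \<longlonglongrightarrow> emeasure lborel (\<Union>i. {x. norm x < f i (x /\<^sub>R norm x)})"
  proof (rule Lim_emeasure_incseq)
    show "incseq (\<lambda>i. {x. norm x < f i (x /\<^sub>R norm x)})"
      using inc by (auto simp: incseq_def intro: less_le_trans)
  qed auto
  also have "(\<Union>i. {x. norm x < f i (x /\<^sub>R norm x)}) = {x. norm x < R (x /\<^sub>R norm x)}"
  proof (intro equalityI subsetI)
    fix x :: 'a assume "x \<in> {x. norm x < R (x /\<^sub>R norm x)}"
    then have "\<forall>\<^sub>F i in sequentially. norm x < f i (x /\<^sub>R norm x)"
      using lim by (intro order_tendstoD) auto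
    then show "x \<in> (\<Union>i. {x. norm x < f i (x /\<^sub>R norm x)})"
      by (auto simp: eventually_sequentially)
  next
    fix x :: 'a assume "x \<in> (\<Union>i. {x. norm x < f i (x /\<^sub>R norm x)})"
    then obtain i where "norm x < f i (x /\<^sub>R norm x)" by auto
    also have "\<dots> \<le> R (x /\<^sub>R norm x)" by (rule incseq_le[OF inc lim])
    finally show "x \<in> {x. norm x < R (x /\<^sub>R norm x)}" by simp
  qed
  finally have 1: "(\<lambda>i. emeasure lborel {x. norm x < f i (x /\<^sub>R norm x)})
      \<longlonglongrightarrow> emeasure lborel {x. norm x < R (x /\<^sub>R norm x)}" .
  have 2: "(\<lambda>i. \<integral>\<^sup>+x. ennreal (f i (x /\<^sub>R norm x) ^ DIM('a)) * indicator (ball 0 1) x \<partial>lborel)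
     \<longlonglongrightarrow> (\<integral>\<^sup>+x. ennreal (R (x /\<^sub>R norm x) ^ DIM('a)) * indicator (ball 0 1) x \<partial>lborel)"
  proof (rule nn_integral_LIMSEQ)
    show "incseq (\<lambda>i x. ennreal (f i (x /\<^sub>R norm x) ^ DIM('a)) * indicator (ball 0 1) x)"
      using inc f(4) by (auto simp: incseq_def le_fun_def intro!: mult_right_mono ennreal_leI power_mono)
    show "(\<lambda>i. ennreal (f i (x /\<^sub>R norm x) ^ DIM('a)) * indicator (ball 0 1) x)
        \<longlonglongrightarrow> ennreal (R (x /\<^sub>R norm x) ^ DIM('a)) * indicator (ball 0 1) x" for x
      by (cases "x \<in> ball 0 1") (auto intro!: tendsto_intros lim)
  qed measurable
  show ?thesis
    using LIMSEQ_unique[OF 1] 2 by (simp add: emeasure_radial_simple f)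
qed

lemma measure_radial:
  fixes R :: "'a::euclidean_space \<Rightarrow> real"
  assumes R [measurable]: "R \<in> borel_measurable borel" and pos: "\<And>x. 0 \<le> R x" and bd: "\<And>x. R x \<le> C"
  shows "{x. norm x < R (x /\<^sub>R norm x)} \<in> lmeasurable"
    "measure lebesgue {x. norm x < R (x /\<^sub>R norm x)} = integral (ball 0 1) (\<lambda>x. R (x /\<^sub>R norm x) ^ DIM('a))"
proof -
  have sets [measurable]: "{x. norm x < R (x /\<^sub>R norm x)} \<in> sets borel" by measurable
  have "bounded {x. norm x < R (x /\<^sub>R norm x)}"
    by (rule bounded_subset[OF bounded_cball[of 0 C]]) (auto intro: order.trans[OF less_imp_le bd])
  then show "{x. norm x < R (x /\<^sub>R norm x)} \<in> lmeasurable"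
    using sets by (intro bounded_set_imp_lmeasurable) auto
  have int: "set_integrable lborel (ball 0 1) (\<lambda>x. R (x /\<^sub>R norm x) ^ DIM('a))"
    unfolding set_integrable_def
  proof (rule integrableI_bounded_set_indicator[where B = "C ^ DIM('a)"])
    show "AE x in lborel. x \<in> ball 0 1 \<longrightarrow> norm (R (x /\<^sub>R norm x) ^ DIM('a)) \<le> C ^ DIM('a)"
      using pos bd by (auto simp: power_mono)
  qed (auto simp: emeasure_lborel_ball_finite[unfolded infinity_ennreal_def])
  have "measure lborel {x. norm x < R (x /\<^sub>R norm x)} =
      enn2real (\<integral>\<^sup>+x. ennreal (R (x /\<^sub>R norm x) ^ DIM('a)) * indicator (ball 0 1) x \<partial>lborel)"
    by (simp add: measure_def emeasure_radial[OF R pos])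
  also have "(\<integral>\<^sup>+x. ennreal (R (x /\<^sub>R norm x) ^ DIM('a)) * indicator (ball 0 1) x \<partial>lborel) =
    (\<integral>\<^sup>+x. ennreal (indicator (ball 0 1) x *\<^sub>R R (x /\<^sub>R norm x) ^ DIM('a)) \<partial>lborel)"
    by (intro nn_integral_cong) (auto simp: indicator_def)
  also have "enn2real \<dots> = (LINT x:ball 0 1|lborel. R (x /\<^sub>R norm x) ^ DIM('a))"
    unfolding set_lebesgue_integral_def using int[unfolded set_integrable_def] pos
    by (subst integral_eq_nn_integral) auto
  also have "\<dots> = integral (ball 0 1) (\<lambda>x. R (x /\<^sub>R norm x) ^ DIM('a))"
    by (rule set_borel_integral_eq_integral(2)[OF int])
  finally show "measure lebesgue {x. norm x < R (x /\<^sub>R norm x)} = integral (ball 0 1) (\<lambda>x. R (x /\<^sub>R norm x) ^ DIM('a))"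
    by simp
qed

section \<open>Support functions and the volume of B + eK\<close>

definition support_fun :: "'a::euclidean_space set \<Rightarrow> 'a \<Rightarrow> real" where
  "support_fun K u = (SUP x\<in>K. x \<bullet> u)"

text \<open>In the induction each further factor 1 + a is at most 2 in absolute value, which
  explains the crude 2^n. Only the order a^2 of the error matters.\<close>

lemma power_linear_approx:
  "\<bar>a\<bar> \<le> 1 \<Longrightarrow> \<bar>(1 + a) ^ n - (1 + real n * a)\<bar> \<le> real n * 2 ^ n * a\<^sup>2" for a :: real
proof (induction n)
  case 0
  show ?case by simp
next
  case (Suc n)
  have "(1 + a) ^ Suc n - (1 + real (Suc n) * a) =
      (1 + a) * ((1 + a) ^ n - (1 + real n * a)) + real n * a\<^sup>2"
    by (simp add: algebra_simps power2_eq_square)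
  also have "\<bar>\<dots>\<bar> \<le> \<bar>1 + a\<bar> * \<bar>(1 + a) ^ n - (1 + real n * a)\<bar> + real n * a\<^sup>2"
    by (rule order.trans[OF abs_triangle_ineq]) (simp add: abs_mult)
  also have "\<dots> \<le> 2 * (real n * 2 ^ n * a\<^sup>2) + real n * a\<^sup>2"
    using Suc by (intro add_right_mono mult_mono) auto
  also have "\<dots> \<le> real (Suc n) * 2 ^ Suc n * a\<^sup>2"
  proof -
    have "real n \<le> 2 ^ Suc n"
      by (metis less_imp_le less_exp lessI less_trans of_nat_less_iff of_nat_numeral of_nat_power)
    then have "real n * a\<^sup>2 \<le> 2 ^ Suc n * a\<^sup>2" by (intro mult_right_mono) auto
    then show ?thesis by (simp add: algebra_simps)
  qed
  finally show ?case .
qed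

context
  fixes K :: "'a::euclidean_space set" and M :: real
  assumes K: "compact K" "K \<noteq> {}" and M: "\<And>x. x \<in> K \<Longrightarrow> norm x \<le> M"
begin

lemma inner_le_support_fun: "x \<in> K \<Longrightarrow> x \<bullet> u \<le> support_fun K u"
  unfolding support_fun_def
proof (rule cSUP_upper)
  have "compact ((\<lambda>x. x \<bullet> u) ` K)" using K by (intro compact_continuous_image continuous_intros)
  then show "bdd_above ((\<lambda>x. x \<bullet> u) ` K)" by (intro bounded_imp_bdd_above compact_imp_bounded)
qed

lemma support_fun_attained: "\<exists>x\<in>K. x \<bullet> u = support_fun K u"
proof -
  have "\<exists>x\<in>K. \<forall>y\<in>K. y \<bullet> u \<le> x \<bullet> u"
    using K by (intro continuous_attains_sup continuous_intros)
  then obtain x where x: "x \<in> K" "\<And>y. y \<in> K \<Longrightarrow> y \<bullet> u \<le> x \<bullet> u" by blast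
  then have "support_fun K u \<le> x \<bullet> u"
    unfolding support_fun_def using K by (intro cSUP_least) auto
  then show ?thesis using inner_le_support_fun[OF x(1), of u] x(1) by (intro bexI[of _ x]) auto
qed

lemma support_fun_lipschitz: "\<bar>support_fun K u - support_fun K v\<bar> \<le> M * norm (u - v)"
proof -
  have "support_fun K u - support_fun K v \<le> M * norm (u - v)" for u v
  proof -
    obtain x where x: "x \<in> K" "x \<bullet> u = support_fun K u" using support_fun_attained by blast
    have "support_fun K u - support_fun K v \<le> x \<bullet> (u - v)"
      using x inner_le_support_fun[OF x(1), of v] by (simp add: inner_diff_right)
    also have "\<dots> \<le> norm x * norm (u - v)" by (rule norm_cauchy_schwarz)
    also have "\<dots> \<le> M * norm (u - v)" using M[OF x(1)] by (rule mult_right_mono) simp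
    finally show ?thesis .
  qed
  from this[of u v] this[of v u] show ?thesis by (simp add: norm_minus_commute abs_le_iff)
qed

lemma abs_support_fun_le: "\<bar>support_fun K u\<bar> \<le> M * norm u"
proof -
  have "support_fun K 0 = 0" using support_fun_attained[of 0] by auto
  then show ?thesis using support_fun_lipschitz[of u 0] by simp
qed

lemma continuous_on_support_fun: "continuous_on S (support_fun K)"
proof -
  have "M \<ge> 0" using K M order.trans[OF norm_ge_zero] by blast
  have "M-lipschitz_on S (support_fun K)"
    using support_fun_lipschitz \<open>M \<ge> 0\<close> by (auto simp: lipschitz_on_def dist_norm)
  then show ?thesis by (rule lipschitz_on_continuous_on)
qed

text \<open>The point y is tested against its own direction: the ball contributes at most 1, and e K
  at most e times its support function.\<close>

lemma mink_sum_cball_upper: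
  assumes e: "e > 0" "e * M \<le> 1 / 2" and y: "y \<in> mink_sum (cball 0 1) ((*\<^sub>R) e ` K)"
  shows "norm y \<le> 1 + e * support_fun K (y /\<^sub>R norm y)"
proof (cases "y = 0")
  case True
  have "support_fun K 0 = 0" using support_fun_attained[of 0] by auto
  then show ?thesis using True by simp
next
  case False
  define u where "u = y /\<^sub>R norm y"
  have u: "norm u = 1" using False by (simp add: u_def)
  obtain b k where b: "norm b \<le> 1" "k \<in> K" "y = b + e *\<^sub>R k"
    using y by (auto simp: mink_sum_def)
  have "norm y = y \<bullet> u" using False by (simp add: u_def power2_norm_eq_inner[symmetric] power2_eq_square)
  also have "\<dots> = b \<bullet> u + e * (k \<bullet> u)" by (simp add: b inner_left_distrib)
  also have "\<dots> \<le> 1 + e * support_fun K u"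
    using norm_cauchy_schwarz[of b u] b u e inner_le_support_fun[OF b(2), of u]
    by (intro add_mono mult_left_mono) auto
  finally show ?thesis by (simp add: u_def)
qed

text \<open>Subtract from y the point e k where k maximises the inner product with the direction u
  of y. The squared distance is (|y| - e h)^2 + e^2 (|k|^2 - h^2), and the tangential part costs at
  most (e M)^2. The deficit M^2 e^2 in the hypothesis pays for it.\<close>

lemma mink_sum_cball_lower:
  assumes e: "e > 0" "e * M \<le> 1 / 2"
    and y: "norm y < 1 + e * support_fun K (y /\<^sub>R norm y) - M\<^sup>2 * e\<^sup>2"
  shows "y \<in> mink_sum (cball 0 1) ((*\<^sub>R) e ` K)"
proof -
  have M0: "M \<ge> 0" using K M order.trans[OF norm_ge_zero] by blast
  have eM: "(e * M)\<^sup>2 \<le> 1 / 4" using power_mono[OF e(2), of 2] e M0 by (simp add: power2_eq_square)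
  define u where "u = y /\<^sub>R norm y"
  define s where "s = norm y"
  have su: "y = s *\<^sub>R u" by (cases "y = 0") (simp_all add: s_def u_def)
  obtain k where k: "k \<in> K" "k \<bullet> u = support_fun K u" using support_fun_attained by blast
  define h where "h = support_fun K u"
  have "norm (y - e *\<^sub>R k) \<le> 1"
  proof (cases "y = 0")
    case True
    have "e * norm k \<le> e * M" using M[OF k(1)] e by simp
    then have "e * norm k \<le> 1" using e by linarith
    then show ?thesis using True e by simp
  next
    case False
    have u: "norm u = 1" using False by (simp add: u_def)
    have h: "\<bar>h\<bar> \<le> M" using abs_support_fun_le[of u] u by (simp add: h_def)
    have "norm (y - e *\<^sub>R k) ^ 2 = (s - e * h)\<^sup>2 + e\<^sup>2 * ((norm k)\<^sup>2 - h\<^sup>2)"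
    proof -
      have "norm (y - e *\<^sub>R k) ^ 2 = s\<^sup>2 * (u \<bullet> u) - 2 * s * e * (k \<bullet> u) + e\<^sup>2 * (k \<bullet> k)"
        unfolding su power2_norm_eq_inner
        by (simp add: inner_diff_left inner_diff_right inner_commute power2_eq_square algebra_simps)
      then show ?thesis using u k
        by (simp add: h_def power2_norm_eq_inner[symmetric] power2_eq_square algebra_simps)
    qed
    also have "\<dots> \<le> (s - e * h)\<^sup>2 + (e * M)\<^sup>2"
    proof -
      have "(norm k)\<^sup>2 - h\<^sup>2 \<le> M\<^sup>2" using power_mono[OF M[OF k(1)] norm_ge_zero, of 2] zero_le_power2[of h] by linarith
      then show ?thesis by (simp add: power_mult_distrib mult_left_mono)
    qed
    also have "\<dots> \<le> 1"
    proof -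
      have up: "s - e * h \<le> 1 - (e * M)\<^sup>2"
        using y by (simp add: s_def h_def u_def power_mult_distrib mult.commute)
      have "e * h \<le> e * M" using h e by (intro mult_left_mono) auto
      moreover have "s \<ge> 0" by (simp add: s_def)
      ultimately have lo: "- (1 / 2) \<le> s - e * h" using e by linarith
      \<comment> \<open>If |y| - e h is nonnegative, it is at most 1 - (e M)^2, whose square is at
        most itself. Otherwise it lies above -1/2 and its square is at most 1/4, as is (e
        M)^2.\<close>
      show ?thesis
      proof (cases "0 \<le> s - e * h")
        case True
        have "(s - e * h)\<^sup>2 \<le> (1 - (e * M)\<^sup>2)\<^sup>2" using up True by (intro power_mono) auto
        also have "\<dots> \<le> 1 - (e * M)\<^sup>2"
          using eM zero_le_power2[of "e * M"] mult_right_mono[of "1 - (e * M)\<^sup>2" 1 "1 - (e * M)\<^sup>2"]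
          by (simp add: power2_eq_square[of "1 - (e * M)\<^sup>2"])
        finally show ?thesis by simp
      next
        case False
        then have "\<bar>s - e * h\<bar> \<le> 1 / 2" using lo by linarith
        then have "(s - e * h)\<^sup>2 \<le> (1 / 2)\<^sup>2" by (simp add: abs_le_square_iff[symmetric])
        then show ?thesis using eM by (simp add: power2_eq_square)
      qed
    qed
    finally show ?thesis by (simp add: power_le_one_iff abs_square_le_1)
  qed
  moreover have "y = (y - e *\<^sub>R k) + e *\<^sub>R k" by simp
  ultimately show ?thesis unfolding mink_sum_def using k(1)
    by (intro CollectI exI[of _ "y - e *\<^sub>R k"] exI[of _ "e *\<^sub>R k"]) auto
qed

lemma integrable_support_fun:
  fixes f :: "real \<Rightarrow> real"
  assumes [measurable]: "f \<in> borel_measurable borel" and bd: "\<And>x. \<bar>f (support_fun K (x /\<^sub>R norm x))\<bar> \<le> B"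
  shows "(\<lambda>x. f (support_fun K (x /\<^sub>R norm x))) integrable_on ball 0 1"
proof -
  have [measurable]: "support_fun K \<in> borel_measurable borel"
    by (rule borel_measurable_continuous_onI continuous_on_support_fun)+
  have "set_integrable lborel (ball 0 1) (\<lambda>x. f (support_fun K (x /\<^sub>R norm x)))"
    unfolding set_integrable_def
    by (rule integrableI_bounded_set_indicator[where B = B])
       (use bd in \<open>auto simp: emeasure_lborel_ball_finite[unfolded infinity_ennreal_def]\<close>)
  then show ?thesis by (rule set_borel_integral_eq_integral)
qed

text \<open>The body lies between two star-shaped sets whose radial functions agree with 1 + e h up
  to multiples of e^2. Taking n-th powers and integrating gives the volume up to O(e^2), with a
  constant depending only on M and n.\<close>

lemma measure_cball_plus_scaled:
  "\<exists>C. \<forall>e. 0 < e \<and> e * M \<le> 1 / 4 \<and> e \<le> 1 / 2 \<longrightarrow>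
    \<bar>measure lebesgue (mink_sum (cball 0 1) ((*\<^sub>R) e ` K)) - (measure lebesgue (ball (0::'a) 1)
      + real DIM('a) * e * integral (ball 0 1) (\<lambda>x. support_fun K (x /\<^sub>R norm x)))\<bar> \<le> C * e\<^sup>2"
proof -
  have M0: "M \<ge> 0" using K M order.trans[OF norm_ge_zero] by blast
  define n where "n = DIM('a)"
  define \<omega> where "\<omega> = measure lebesgue (ball (0::'a) 1)"
  define h where "h x = support_fun K (x /\<^sub>R norm x)" for x
  have h: "\<bar>h x\<bar> \<le> M" for x
    using abs_support_fun_le[of "x /\<^sub>R norm x"] M0 by (cases "x = 0") (auto simp: h_def)
  have meas [measurable]: "support_fun K \<in> borel_measurable borel"
    by (rule borel_measurable_continuous_onI continuous_on_support_fun)+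
  define I where "I = integral (ball 0 1) h"
  have hint: "h integrable_on ball 0 1"
    using integrable_support_fun[of "\<lambda>x. x" M] h by (simp add: h_def[abs_def])
  have const: "integral (ball 0 1) (\<lambda>x::'a. c) = c * \<omega>" for c :: real
    using integral_mult_right[of "ball (0::'a) 1" c "\<lambda>_. 1"]
    by (simp add: \<omega>_def lmeasure_integral[OF lmeasurable_ball])
  define D where "D = M + 1 + M\<^sup>2"
  define C where "C = (real n * (1 + M\<^sup>2) + real n * 2 ^ n * D\<^sup>2) * \<omega>"
  \<comment> \<open>Both bounds for the radial function have the form 1 + e h + c e^2.\<close>
  have approx: "\<bar>integral (ball 0 1) (\<lambda>x. (1 + e * h x + c * e\<^sup>2) ^ n) - (\<omega> + real n * e * I)\<bar> \<le> C * e\<^sup>2"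
    if e: "0 < e" "e * M \<le> 1 / 4" "e \<le> 1 / 2" and c: "\<bar>c\<bar> \<le> 1 + M\<^sup>2" "\<bar>c * e\<^sup>2\<bar> \<le> 1 / 2" for e c
  proof -
    have a: "\<bar>e * h x + c * e\<^sup>2\<bar> \<le> 1" for x
    proof -
      have "\<bar>e * h x\<bar> \<le> e * M" using h[of x] e by (simp add: abs_mult)
      then show ?thesis using e c by linarith
    qed
    have aD: "\<bar>e * h x + c * e\<^sup>2\<bar> \<le> D * e" for x
    proof -
      have "\<bar>e * h x\<bar> \<le> e * M" using h[of x] e by (simp add: abs_mult)
      moreover have "\<bar>c * e\<^sup>2\<bar> \<le> (1 + M\<^sup>2) * e"
      proof -
        have "e\<^sup>2 \<le> e" using e by (simp add: power2_eq_square mult_left_le)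
        then show ?thesis unfolding abs_mult using c by (intro mult_mono) auto
      qed
      ultimately show ?thesis by (simp add: D_def algebra_simps)
    qed
    have int: "(\<lambda>x. (1 + e * h x + c * e\<^sup>2) ^ n) integrable_on ball 0 1"
      unfolding h_def
    proof (rule integrable_support_fun[of "\<lambda>y. (1 + e * y + c * e\<^sup>2) ^ n" "2 ^ n"])
      fix x :: 'a
      have "\<bar>1 + (e * h x + c * e\<^sup>2)\<bar> \<le> 2" using a[of x] by linarith
      then show "\<bar>(1 + e * support_fun K (x /\<^sub>R norm x) + c * e\<^sup>2) ^ n\<bar> \<le> 2 ^ n"
        unfolding power_abs h_def by (intro power_mono) (auto simp: add.assoc)
    qed simp
    have hint': "(\<lambda>x. real n * e * h x) integrable_on ball 0 1"
      using integrable_cmul[OF hint, of "real n * e"] by simp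
    have lin: "integral (ball 0 1) (\<lambda>x. 1 + real n * e * h x) = \<omega> + real n * e * I"
      using hint' by (subst integral_add) (auto simp: const I_def intro: integrable_on_const)
    have lint: "(\<lambda>x. 1 + real n * e * h x) integrable_on ball 0 1"
      using hint' by (intro integrable_add integrable_on_const) auto
    have pt: "\<bar>(1 + e * h x + c * e\<^sup>2) ^ n - (1 + real n * e * h x)\<bar>
        \<le> (real n * (1 + M\<^sup>2) + real n * 2 ^ n * D\<^sup>2) * e\<^sup>2" for x
    proof -
      define a where "a = e * h x + c * e\<^sup>2"
      have "\<bar>(1 + a) ^ n - (1 + real n * a)\<bar> \<le> real n * 2 ^ n * a\<^sup>2"
        using a[of x] by (intro power_linear_approx) (simp add: a_def)
      also have "\<dots> \<le> real n * 2 ^ n * (D * e)\<^sup>2"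
        using aD[of x] power_mono[of "\<bar>a\<bar>" "D * e" 2] by (intro mult_left_mono) (auto simp: a_def)
      finally have "\<bar>(1 + a) ^ n - (1 + real n * a)\<bar> \<le> real n * 2 ^ n * D\<^sup>2 * e\<^sup>2"
        by (simp add: power_mult_distrib mult.assoc)
      moreover have "\<bar>real n * c * e\<^sup>2\<bar> \<le> real n * (1 + M\<^sup>2) * e\<^sup>2"
        unfolding abs_mult abs_of_nat abs_power2 using c by (intro mult_right_mono mult_left_mono) auto
      moreover have "(1 + e * h x + c * e\<^sup>2) ^ n - (1 + real n * e * h x) =
          ((1 + a) ^ n - (1 + real n * a)) + real n * c * e\<^sup>2"
        by (simp add: a_def algebra_simps)
      ultimately show ?thesis
        using abs_triangle_ineq[of "(1 + a) ^ n - (1 + real n * a)" "real n * c * e\<^sup>2"]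
        by (simp add: distrib_right)
    qed
    have "norm (integral (ball 0 1) (\<lambda>x. (1 + e * h x + c * e\<^sup>2) ^ n - (1 + real n * e * h x)))
      \<le> integral (ball (0::'a) 1) (\<lambda>x. (real n * (1 + M\<^sup>2) + real n * 2 ^ n * D\<^sup>2) * e\<^sup>2)"
      using pt by (intro integral_norm_bound_integral integrable_diff int lint integrable_on_const) auto
    also have "\<dots> = C * e\<^sup>2" unfolding const C_def by (simp add: algebra_simps)
    finally show ?thesis using int lint lin by (simp add: integral_diff)
  qed
  show ?thesis
  proof (intro exI[of _ C] allI impI)
    fix e :: real assume e: "0 < e \<and> e * M \<le> 1 / 4 \<and> e \<le> 1 / 2"
    define G where "G = mink_sum (cball 0 1) ((*\<^sub>R) e ` K)"
    have G: "G \<in> lmeasurable"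
      unfolding G_def using K
      by (intro lmeasurable_compact compact_mink_sum compact_scaling) auto
    have eM: "(e * M)\<^sup>2 \<le> 1 / 16" using power_mono[of "e * M" "1 / 4" 2] e M0 by (simp add: power2_eq_square)
    have e2: "e\<^sup>2 \<le> 1 / 4" using power_mono[of e "1 / 2" 2] e by (simp add: power2_eq_square)
    have heM: "\<bar>e * h x\<bar> \<le> 1 / 4" for x
    proof -
      have "e * \<bar>h x\<bar> \<le> e * M" using h[of x] e by (intro mult_left_mono) auto
      moreover have "\<bar>e * h x\<bar> = e * \<bar>h x\<bar>" using e by (simp add: abs_mult)
      ultimately show ?thesis using e by linarith
    qed
    have r: "0 \<le> 1 + e * h x + c * e\<^sup>2" "1 + e * h x + c * e\<^sup>2 \<le> 3" if "\<bar>c * e\<^sup>2\<bar> \<le> 1 / 2" for x c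
      using heM[of x] that by linarith+
    show "\<bar>measure lebesgue (mink_sum (cball 0 1) ((*\<^sub>R) e ` K)) - (measure lebesgue (ball (0::'a) 1)
      + real DIM('a) * e * integral (ball 0 1) (\<lambda>x. support_fun K (x /\<^sub>R norm x)))\<bar> \<le> C * e\<^sup>2"
    proof -
      have rad: "S c \<in> lmeasurable" "measure lebesgue (S c) = integral (ball 0 1) (\<lambda>x. (1 + e * h x + c * e\<^sup>2) ^ n)"
        if S: "\<And>c. S c = {x. norm x < 1 + e * h x + c * e\<^sup>2}" and c: "\<bar>c * e\<^sup>2\<bar> \<le> 1 / 2" for S c
      proof -
        \<comment> \<open>The volume formula wants bounds at every vector, not only at normalised
          ones. Clamping to the interval from 0 to 3 provides them and changes nothing at the
          arguments x/|x|.\<close>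
        define R where "R u = max 0 (min 3 (1 + e * support_fun K u + c * e\<^sup>2))" for u
        have Rh: "R (x /\<^sub>R norm x) = 1 + e * h x + c * e\<^sup>2" for x
          using r[OF c, of x] by (simp add: R_def h_def)
        have [measurable]: "R \<in> borel_measurable borel" unfolding R_def by measurable
        have "S c = {x. norm x < R (x /\<^sub>R norm x)}" by (simp add: S Rh)
        then show "S c \<in> lmeasurable"
          "measure lebesgue (S c) = integral (ball 0 1) (\<lambda>x. (1 + e * h x + c * e\<^sup>2) ^ n)"
          using measure_radial[of R 3] by (auto simp: Rh n_def) (auto simp: R_def)
      qed
      define S where "S c = {x. norm x < 1 + e * h x + c * e\<^sup>2}" for c
      have cl: "\<bar>(- M\<^sup>2) * e\<^sup>2\<bar> \<le> 1 / 2" using eM by (simp add: power_mult_distrib mult.commute)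
      have cu: "\<bar>1 * e\<^sup>2\<bar> \<le> 1 / 2" using e2 by simp
      have "S (- M\<^sup>2) \<subseteq> G"
      proof
        fix y assume "y \<in> S (- M\<^sup>2)"
        then show "y \<in> G" unfolding G_def using e
          by (intro mink_sum_cball_lower) (auto simp: S_def h_def)
      qed
      then have 1: "measure lebesgue (S (- M\<^sup>2)) \<le> measure lebesgue G"
        using rad(1)[of S, OF S_def cl] G by (intro measure_mono_fmeasurable) auto
      \<comment> \<open>The extra e^2 serves only to turn the weak inequality for points of the body
        into the strict one that defines the star-shaped set.\<close>
      have "G \<subseteq> S 1"
      proof
        fix y assume "y \<in> G"
        then have "norm y \<le> 1 + e * h y"
          unfolding G_def h_def using e by (intro mink_sum_cball_upper) auto
        moreover have "e\<^sup>2 > 0" using e by simp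
        ultimately show "y \<in> S 1" unfolding S_def mem_Collect_eq by linarith
      qed
      then have 2: "measure lebesgue G \<le> measure lebesgue (S 1)"
        using rad(1)[of S, OF S_def cu] G by (intro measure_mono_fmeasurable) auto
      have "\<bar>measure lebesgue (S (- M\<^sup>2)) - (\<omega> + real n * e * I)\<bar> \<le> C * e\<^sup>2"
        unfolding rad(2)[of S, OF S_def cl] using e cl by (intro approx) auto
      moreover have "\<bar>measure lebesgue (S 1) - (\<omega> + real n * e * I)\<bar> \<le> C * e\<^sup>2"
        unfolding rad(2)[of S, OF S_def cu] using e cu by (intro approx) auto
      ultimately have "\<bar>measure lebesgue G - (\<omega> + real n * e * I)\<bar> \<le> C * e\<^sup>2"
        using 1 2 by linarith
      then show ?thesis by (simp add: G_def \<omega>_def n_def I_def h_def[abs_def])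
    qed
  qed
qed

end

section \<open>The quermassintegral as an integral of the support function\<close>

lemma poly_coeff_0_eq_0:
  fixes p :: "real poly"
  assumes e0: "e0 > 0" and b: "\<And>e. 0 < e \<Longrightarrow> e \<le> e0 \<Longrightarrow> \<bar>poly p e\<bar> \<le> C * e"
  shows "poly.coeff p 0 = 0"
proof -
  have "((\<lambda>e. poly p e) \<longlongrightarrow> poly p 0) (at_right 0)" by (intro tendsto_intros)
  moreover have "(poly p \<longlongrightarrow> 0) (at_right 0)"
  proof (rule Lim_null_comparison)
    show "\<forall>\<^sub>F e in at_right 0. norm (poly p e) \<le> C * e"
      using eventually_at_right_less[of 0] eventually_at_rightI[of 0 e0 "\<lambda>e. e \<le> e0"] e0
      by (auto intro!: eventually_at_rightI[of 0 e0] b)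
    have "((\<lambda>e. C * e) \<longlongrightarrow> C * 0) (at_right 0)" by (intro tendsto_intros)
    then show "((\<lambda>e. C * e) \<longlongrightarrow> 0) (at_right 0)" by simp
  qed
  ultimately have "poly p 0 = 0" using tendsto_unique[of "at_right (0::real)"] by force
  then show ?thesis by (simp add: poly_0_coeff_0)
qed

text \<open>A polynomial that is O(e^2) as e decreases to 0 has no constant term; after division by
  the variable it is O(e), so its linear coefficient vanishes as well.\<close>

lemma poly_coeff_1_eqI:
  fixes p :: "real poly"
  assumes e0: "e0 > 0" and b: "\<And>e. 0 < e \<Longrightarrow> e \<le> e0 \<Longrightarrow> \<bar>poly p e - (a + b * e)\<bar> \<le> C * e\<^sup>2"
  shows "poly.coeff p 1 = b"
proof -
  define q where "q = p - [:a, b:]"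
  have q: "\<bar>poly q e\<bar> \<le> C * e\<^sup>2" if "0 < e" "e \<le> e0" for e
    using b[OF that] by (simp add: q_def algebra_simps)
  have C: "C \<ge> 0"
  proof -
    have "0 \<le> C * e0\<^sup>2" using q[of e0] e0 by linarith
    then show ?thesis using e0 by (simp add: zero_le_mult_iff)
  qed
  have "poly.coeff q 0 = 0"
  proof (rule poly_coeff_0_eq_0[OF e0, where C = "C * e0"])
    fix e assume e: "0 < e" "e \<le> e0"
    then have "C * (e * e) \<le> C * (e0 * e)" using C by (intro mult_left_mono mult_right_mono) auto
    then have "C * e\<^sup>2 \<le> C * e0 * e" by (simp add: power2_eq_square mult.assoc)
    then show "\<bar>poly q e\<bar> \<le> C * e0 * e" using q[OF e] by linarith
  qed
  then obtain r where r: "q = pCons 0 r" by (metis pCons_cases coeff_pCons_0)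
  have "poly.coeff r 0 = 0"
  proof (rule poly_coeff_0_eq_0[OF e0, where C = C])
    fix e assume e: "0 < e" "e \<le> e0"
    then have "e * \<bar>poly r e\<bar> \<le> e * (C * e)"
      using q[OF e] by (simp add: r abs_mult power2_eq_square algebra_simps)
    then show "\<bar>poly r e\<bar> \<le> C * e" using e by simp
  qed
  then have "poly.coeff q 1 = 0" by (simp add: r)
  then show ?thesis by (simp add: q_def)
qed

text \<open>The linear coefficient of the volume of B + eK is computed twice: from the reversed
  Steiner polynomial it is n W_(n-1), from the radial functions it is n times the integral of h over
  the ball.\<close>

proposition quermass_mean_width:
  fixes \<Omega> :: "'a::euclidean_space set"
  assumes \<Omega>: "open \<Omega>" "bounded \<Omega>" "convex \<Omega>" "\<Omega> \<noteq> {}"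
  shows "quermass \<Omega> (DIM('a) - 1) = integral (ball 0 1) (\<lambda>x. support_fun (closure \<Omega>) (x /\<^sub>R norm x))"
proof -
  define n where "n = DIM('a)"
  have n: "n \<ge> 1" by (simp add: n_def Suc_leI)
  define K where "K = closure \<Omega>"
  have K: "compact K" "convex K" "K \<noteq> {}"
    using \<Omega> by (auto simp: K_def compact_closure)
  obtain M where M: "\<And>x. x \<in> K \<Longrightarrow> norm x \<le> M" "M > 0"
    using compact_imp_bounded[OF K(1)] bounded_pos by blast
  define P where "P W \<longleftrightarrow> (\<forall>\<rho>>0. measure lebesgue (mink_sum \<Omega> (cball 0 \<rho>)) =
        (\<Sum>j\<le>n. real (n choose j) * W j * \<rho> ^ j))" for W
  \<comment> \<open>Without a witness the chosen W would be arbitrary. The coefficients of the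
    Steiner polynomial, divided by the binomials, provide one.\<close>
  have "\<exists>W. P W"
  proof -
    obtain q where q: "degree q \<le> n" "\<And>s. s > 0 \<Longrightarrow> measure lebesgue (mink_sum K (cball 0 s)) = poly q s"
      using steiner_polynomial[OF K(1,2)] unfolding n_def by blast
    have "poly q s = (\<Sum>j\<le>n. real (n choose j) * (poly.coeff q j / real (n choose j)) * s ^ j)" for s
    proof -
      have "poly q s = (\<Sum>j\<le>n. poly.coeff q j * s ^ j)"
        unfolding poly_altdef using q(1)
        by (intro sum.mono_neutral_left) (auto simp: coeff_eq_0)
      then show ?thesis by (simp add: binomial_eq_0_iff)
    qed
    then have "P (\<lambda>j. poly.coeff q j / real (n choose j))"
      unfolding P_def using q(2) measure_mink_sum_cball_closure[OF \<Omega>(1-3)] by (simp add: K_def)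
    then show ?thesis by blast
  qed
  define W where "W = (SOME W. P W)"
  have W: "P W" unfolding W_def using \<open>\<exists>W. P W\<close> by (rule someI_ex)
  have quer: "quermass \<Omega> (DIM('a) - 1) = W (n - 1)"
    unfolding quermass_def W_def P_def n_def ..
  define p where "p = (\<Sum>j\<le>n. monom (real (n choose j) * W j) (n - j))"
  define I where "I = integral (ball 0 1) (\<lambda>x. support_fun K (x /\<^sub>R norm x))"
  obtain C where C: "\<And>e. 0 < e \<Longrightarrow> e * M \<le> 1 / 4 \<Longrightarrow> e \<le> 1 / 2 \<Longrightarrow>
    \<bar>measure lebesgue (mink_sum (cball 0 1) ((*\<^sub>R) e ` K)) - (measure lebesgue (ball (0::'a) 1) + real n * e * I)\<bar> \<le> C * e\<^sup>2"
    using measure_cball_plus_scaled[OF K(1,3) M(1)] unfolding n_def I_def by blast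
  \<comment> \<open>The dilation by e gives |B + eK| = e^n |K + B/e|. Substituting 1/e for the
    radius sends the power j to n - j, which is how \<open>p\<close> is defined.\<close>
  have vol: "measure lebesgue (mink_sum (cball 0 1) ((*\<^sub>R) e ` K)) = poly p e" if e: "e > 0" for e
  proof -
    have "mink_sum (cball 0 1) ((*\<^sub>R) e ` K) = (\<lambda>x. e *\<^sub>R x + 0) ` mink_sum K (cball 0 (1 / e))"
    proof (intro equalityI subsetI)
      fix y assume "y \<in> mink_sum (cball 0 1) ((*\<^sub>R) e ` K)"
      then obtain b k where b: "norm b \<le> 1" "k \<in> K" "y = b + e *\<^sub>R k" by (auto simp: mink_sum_def)
      moreover from this have "b /\<^sub>R e \<in> cball 0 (1 / e)" using e by (simp add: field_simps)
      ultimately have "k + b /\<^sub>R e \<in> mink_sum K (cball 0 (1 / e))" "y = e *\<^sub>R (k + b /\<^sub>R e) + 0"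
        using e unfolding mink_sum_def by (blast, simp add: algebra_simps)
      then show "y \<in> (\<lambda>x. e *\<^sub>R x + 0) ` mink_sum K (cball 0 (1 / e))" by blast
    next
      fix y assume "y \<in> (\<lambda>x. e *\<^sub>R x + 0) ` mink_sum K (cball 0 (1 / e))"
      then obtain b k where b: "norm b \<le> 1 / e" "k \<in> K" "y = e *\<^sub>R (k + b)" by (auto simp: mink_sum_def)
      then have "y = e *\<^sub>R b + e *\<^sub>R k" "e *\<^sub>R b \<in> cball 0 1"
        using e by (auto simp: field_simps)
      then show "y \<in> mink_sum (cball 0 1) ((*\<^sub>R) e ` K)" unfolding mink_sum_def using b(2) by blast
    qed
    then have "measure lebesgue (mink_sum (cball 0 1) ((*\<^sub>R) e ` K)) =
        e ^ n * measure lebesgue (mink_sum K (cball 0 (1 / e)))"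
      using e by (simp only: measure_lebesgue_affine n_def abs_of_pos)
    also have "\<dots> = e ^ n * (\<Sum>j\<le>n. real (n choose j) * W j * (1 / e) ^ j)"
      using W e measure_mink_sum_cball_closure[OF \<Omega>(1-3), of "1 / e"] by (simp add: P_def K_def)
    also have "\<dots> = poly p e"
      unfolding sum_distrib_left p_def poly_sum poly_monom
      using e by (intro sum.cong) (auto simp: power_diff power_one_over field_simps)
    finally show ?thesis .
  qed
  have "poly.coeff p 1 = real n * I"
  proof (rule poly_coeff_1_eqI)
    show "min (1 / 2) (1 / (4 * M)) > 0" using M(2) by simp
    fix e assume e: "0 < e" "e \<le> min (1 / 2) (1 / (4 * M))"
    then have "e * M \<le> 1 / 4" using M(2) by (simp add: field_simps)
    then show "\<bar>poly p e - (measure lebesgue (ball (0::'a) 1) + real n * I * e)\<bar> \<le> C * e\<^sup>2"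
      using C[of e] e vol[of e] by (simp add: mult_ac)
  qed
  moreover have "poly.coeff p 1 = real n * W (n - 1)"
  proof -
    have "poly.coeff p 1 = (\<Sum>j\<le>n. if j = n - 1 then real (n choose j) * W j else 0)"
      unfolding p_def coeff_sum coeff_monom using n by (intro sum.cong) auto
    also have "\<dots> = real (n choose (n - 1)) * W (n - 1)" by simp
    also have "n choose (n - 1) = n" using n binomial_symmetric[of 1 n] by simp
    finally show ?thesis .
  qed
  ultimately show ?thesis using n quer by (simp add: I_def K_def)
qed

section \<open>The integral of the second symmetric function of the Hessian\<close>

definition C1c :: "('a::euclidean_space \<Rightarrow> real) \<Rightarrow> ('a \<Rightarrow> 'a \<Rightarrow> real) \<Rightarrow> bool" where
  "C1c F F' \<longleftrightarrow> (\<forall>x. (F has_derivative F' x) (at x)) \<and>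
    (\<forall>a. continuous_on UNIV (\<lambda>x. F' x a)) \<and> (\<exists>R. \<forall>x. norm x > R \<longrightarrow> F x = 0)"

lemma integrable_continuous_compact_support:
  fixes f :: "'a::euclidean_space \<Rightarrow> real"
  assumes "continuous_on UNIV f" "\<And>x. norm x > R \<Longrightarrow> f x = 0"
  shows "integrable lborel f"
proof -
  have "integrable lborel (\<lambda>x. indicator (cball 0 R) x *\<^sub>R f x)"
    by (rule borel_integrable_compact) (auto intro: continuous_on_subset assms)
  also have "(\<lambda>x. indicator (cball 0 R) x *\<^sub>R f x) = f"
    using assms(2) by (force simp: indicator_def)
  finally show ?thesis .
qed

lemma integral_lborel_translate:
  fixes f :: "'a::euclidean_space \<Rightarrow> real"
  assumes "f \<in> borel_measurable borel"
  shows "(\<integral>x. f (x + c) \<partial>lborel) = (\<integral>x. f x \<partial>lborel)"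
proof -
  have "(\<integral>x. f x \<partial>lborel) = (\<integral>x. f x \<partial>(distr lborel borel (\<lambda>x. c + x)))"
    by (simp add: lborel_distr_plus)
  also have "\<dots> = (\<integral>x. f (c + x) \<partial>lborel)" using assms by (subst integral_distr) auto
  finally show ?thesis by (simp add: add.commute)
qed

lemma C1cD:
  assumes "C1c F F'"
  shows "(F has_derivative F' x) (at x)" "continuous_on S (\<lambda>x. F' x a)" "continuous_on S F"
proof -
  show 1: "(F has_derivative F' x) (at x)" for x using assms by (simp add: C1c_def)
  show "continuous_on S (\<lambda>x. F' x a)"
    using assms continuous_on_subset[of UNIV _ S] by (auto simp: C1c_def)
  show "continuous_on S F"
    using has_derivative_continuous_on[of S F F'] 1 has_derivative_at_withinI by blast
qed

lemma C1c_deriv_support: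
  assumes F: "C1c F F'" and R: "\<And>x. norm x > R \<Longrightarrow> F x = 0" and x: "norm x > R"
  shows "F' x a = 0"
proof -
  have "open {x. norm x > R}" by (intro open_Collect_less continuous_intros)
  then have "\<forall>\<^sub>F y in at x. F y = 0"
    using x R by (auto simp: eventually_at_topological)
  then have "((\<lambda>_. 0) has_derivative F' x) (at x)"
    using has_derivative_transform_eventually[OF C1cD(1)[OF F, of x], of "\<lambda>_. 0"] R x by simp
  then have "F' x = (\<lambda>_. 0)"
    using has_derivative_unique[OF _ has_derivative_const[of 0 "at x"]] by blast
  then show ?thesis by simp
qed

text \<open>Mean value inequality along the line x + s a; the directional derivative is bounded
  because it is continuous and vanishes outside a ball. The bound is the dominating constant for s
  tending to 0, and at s = 0 division by zero makes the quotient 0.\<close>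

lemma C1c_difference_quotient_bound:
  assumes F: "C1c F F'"
  shows "\<exists>B. \<forall>x s. \<bar>(F (x + s *\<^sub>R a) - F x) / s\<bar> \<le> B"
proof -
  obtain R where R: "\<And>x. norm x > R \<Longrightarrow> F x = 0" using F by (auto simp: C1c_def)
  have "bounded ((\<lambda>x. F' x a) ` cball 0 R)"
    by (intro compact_imp_bounded compact_continuous_image C1cD[OF F]) auto
  then obtain B where "B > 0" "\<forall>y\<in>(\<lambda>x. F' x a) ` cball 0 R. norm y \<le> B"
    unfolding bounded_pos by blast
  then have B: "\<And>x. x \<in> cball 0 R \<Longrightarrow> \<bar>F' x a\<bar> \<le> B" "B > 0" by auto
  have B': "\<bar>F' x a\<bar> \<le> B" for x
    using B C1c_deriv_support[OF F R, where x = x and a = a] by (cases "norm x > R") auto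
  have "\<bar>(F (x + s *\<^sub>R a) - F x) / s\<bar> \<le> B" for x s
  proof (cases "s = 0")
    case False
    have d: "((\<lambda>s. F (x + s *\<^sub>R a)) has_derivative (\<lambda>h. F' (x + s *\<^sub>R a) (h *\<^sub>R a))) (at s within UNIV)" for s
      by (rule has_derivative_compose[OF _ C1cD(1)[OF F]]) (auto intro!: derivative_eq_intros)
    have lin: "F' y (h *\<^sub>R a) = h * F' y a" for y h
      using linear_scale[OF has_derivative_linear[OF C1cD(1)[OF F, of y]]] by simp
    have "norm (F (x + s *\<^sub>R a) - F (x + 0 *\<^sub>R a)) \<le> B * norm (s - 0)"
    proof (rule differentiable_bound[OF convex_UNIV d])
      show "onorm (\<lambda>h. F' (x + s *\<^sub>R a) (h *\<^sub>R a)) \<le> B" for s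
      proof (rule onorm_le)
        fix h :: real
        have "norm (F' (x + s *\<^sub>R a) (h *\<^sub>R a)) = \<bar>F' (x + s *\<^sub>R a) a\<bar> * norm h"
          by (simp add: lin abs_mult)
        also have "\<dots> \<le> B * norm h" by (intro mult_right_mono B') simp
        finally show "norm (F' (x + s *\<^sub>R a) (h *\<^sub>R a)) \<le> B * norm h" .
      qed
    qed auto
    then show ?thesis using False by (simp add: divide_le_eq)
  qed (use B(2) in auto)
  then show ?thesis by blast
qed

text \<open>The test function is only continuous, so it may itself be a directional derivative of
  another C^1 function.\<close>

lemma C1c_difference_quotient_integral:
  fixes F :: "'a::euclidean_space \<Rightarrow> real"
  assumes F: "C1c F F'" and \<phi>: "continuous_on UNIV \<phi>" "\<And>x. norm x > R \<Longrightarrow> \<phi> x = 0"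
    and s: "s \<longlonglongrightarrow> 0" "\<And>k. s k \<noteq> 0"
  shows "(\<lambda>k. \<integral>x. (F (x + s k *\<^sub>R a) - F x) / s k * \<phi> x \<partial>lborel) \<longlonglongrightarrow> (\<integral>x. F' x a * \<phi> x \<partial>lborel)"
proof -
  obtain B where B: "\<And>x s. \<bar>(F (x + s *\<^sub>R a) - F x) / s\<bar> \<le> B"
    using C1c_difference_quotient_bound[OF F] by blast
  have [measurable]: "F \<in> borel_measurable borel" "\<phi> \<in> borel_measurable borel"
     "(\<lambda>x. F' x a) \<in> borel_measurable borel"
    by (auto intro!: borel_measurable_continuous_onI C1cD[OF F] \<phi>)
  show ?thesis
  proof (rule integral_dominated_convergence[where w = "\<lambda>x. B * \<bar>\<phi> x\<bar>"])
    show "integrable lborel (\<lambda>x. B * \<bar>\<phi> x\<bar>)"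
      by (rule integrable_continuous_compact_support[of _ R]) (auto intro!: continuous_intros \<phi>)
    show "AE x in lborel. (\<lambda>k. (F (x + s k *\<^sub>R a) - F x) / s k * \<phi> x) \<longlonglongrightarrow> F' x a * \<phi> x"
    proof (rule AE_I2)
      fix x
      have "((\<lambda>s. F (x + s *\<^sub>R a)) has_derivative (\<lambda>h. F' (x + 0 *\<^sub>R a) (h *\<^sub>R a))) (at 0)"
        by (rule has_derivative_compose[OF _ C1cD(1)[OF F]]) (auto intro!: derivative_eq_intros)
      moreover have "F' x (h *\<^sub>R a) = F' x a * h" for h
        using linear_scale[OF has_derivative_linear[OF C1cD(1)[OF F, of x]]] by simp
      ultimately have "((\<lambda>s. F (x + s *\<^sub>R a)) has_field_derivative F' x a) (at 0)"
        by (simp add: has_field_derivative_def)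
      then have "((\<lambda>s. (F (x + s *\<^sub>R a) - F x) / s) \<longlongrightarrow> F' x a) (at 0)"
        by (simp add: DERIV_def)
      moreover have "filterlim s (at 0) sequentially"
        using s by (auto simp: filterlim_at)
      ultimately have "(\<lambda>k. (F (x + s k *\<^sub>R a) - F x) / s k) \<longlonglongrightarrow> F' x a"
        using filterlim_compose by blast
      then show "(\<lambda>k. (F (x + s k *\<^sub>R a) - F x) / s k * \<phi> x) \<longlonglongrightarrow> F' x a * \<phi> x"
        by (intro tendsto_intros)
    qed
    show "AE x in lborel. norm ((F (x + s k *\<^sub>R a) - F x) / s k * \<phi> x) \<le> B * \<bar>\<phi> x\<bar>" for k
      unfolding real_norm_def abs_mult by (intro AE_I2 mult_right_mono B) simp
  qed measurable
qed

text \<open>Discrete integration by parts, which is nothing but translation invariance of the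
  integral. The function F needs neither a derivative nor compact support.\<close>

lemma integral_difference_shift:
  fixes F \<phi> :: "'a::euclidean_space \<Rightarrow> real"
  assumes F: "continuous_on UNIV F" and \<phi>: "continuous_on UNIV \<phi>" "\<And>x. norm x > R \<Longrightarrow> \<phi> x = 0"
  shows "(\<integral>x. (F (x + s *\<^sub>R a) - F x) / s * \<phi> x \<partial>lborel) = - (\<integral>x. F x * ((\<phi> (x + (- s) *\<^sub>R a) - \<phi> x) / (- s)) \<partial>lborel)"
proof -
  have c: "continuous_on UNIV (\<lambda>x. F (x + c))" "continuous_on UNIV (\<lambda>x. \<phi> (x + c))" for c
    by (auto intro!: continuous_on_compose2[OF F] continuous_on_compose2[OF \<phi>(1)] continuous_intros)
  have i1: "integrable lborel (\<lambda>x. F (x + s *\<^sub>R a) * \<phi> x)"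
    by (rule integrable_continuous_compact_support[of _ R]) (auto intro!: continuous_intros c \<phi>)
  have i2: "integrable lborel (\<lambda>x. F x * \<phi> x)"
    by (rule integrable_continuous_compact_support[of _ R]) (auto intro!: continuous_intros F \<phi>)
  have i3: "integrable lborel (\<lambda>x. F x * \<phi> (x - s *\<^sub>R a))"
  proof (rule integrable_continuous_compact_support[of _ "R + norm (s *\<^sub>R a)"])
    show "continuous_on UNIV (\<lambda>x. F x * \<phi> (x - s *\<^sub>R a))"
      using c(2)[of "- (s *\<^sub>R a)"] by (auto intro!: continuous_intros F)
    fix x :: 'a assume "R + norm (s *\<^sub>R a) < norm x"
    then have "norm (x - s *\<^sub>R a) > R" using norm_triangle_ineq2[of x "s *\<^sub>R a"] by linarith
    then show "F x * \<phi> (x - s *\<^sub>R a) = 0" using \<phi> by simp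
  qed
  have m: "(\<lambda>x. F x * \<phi> (x - s *\<^sub>R a)) \<in> borel_measurable borel" using i3 by auto
  have eq: "(\<integral>x. F (x + s *\<^sub>R a) * \<phi> x \<partial>lborel) = (\<integral>x. F x * \<phi> (x - s *\<^sub>R a) \<partial>lborel)"
    using integral_lborel_translate[OF m, of "s *\<^sub>R a"] by simp
  have "(\<integral>x. (F (x + s *\<^sub>R a) - F x) / s * \<phi> x \<partial>lborel) = (\<integral>x. (F (x + s *\<^sub>R a) * \<phi> x - F x * \<phi> x) / s \<partial>lborel)"
    by (intro Bochner_Integration.integral_cong) (auto simp: field_simps)
  also have "\<dots> = ((\<integral>x. F (x + s *\<^sub>R a) * \<phi> x \<partial>lborel) - (\<integral>x. F x * \<phi> x \<partial>lborel)) / s"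
    using i1 i2 by simp
  also have "\<dots> = (\<integral>x. (F x * \<phi> (x - s *\<^sub>R a) - F x * \<phi> x) / s \<partial>lborel)"
    using i2 i3 eq by simp
  also have "\<dots> = (\<integral>x. - (F x * ((\<phi> (x + (- s) *\<^sub>R a) - \<phi> x) / (- s))) \<partial>lborel)"
    by (intro Bochner_Integration.integral_cong) (auto simp: field_simps)
  finally show ?thesis by simp
qed

lemma C1c_integral_by_parts:
  fixes F K :: "'a::euclidean_space \<Rightarrow> real"
  assumes F: "C1c F F'" and K: "C1c K K'"
  shows "(\<integral>x. F' x a * K x \<partial>lborel) = - (\<integral>x. F x * K' x a \<partial>lborel)"
proof -
  obtain R where R: "\<And>x. norm x > R \<Longrightarrow> F x = 0" using F by (auto simp: C1c_def)
  obtain R' where R': "\<And>x. norm x > R' \<Longrightarrow> K x = 0" using K by (auto simp: C1c_def)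
  define s where "s k = 1 / real (Suc k)" for k
  have s: "s \<longlonglongrightarrow> 0" "\<And>k. s k \<noteq> 0" unfolding s_def using LIMSEQ_Suc[OF lim_1_over_n] by auto
  have s': "(\<lambda>k. - s k) \<longlonglongrightarrow> 0" using tendsto_minus[OF s(1)] by simp
  have 1: "(\<lambda>k. \<integral>x. (F (x + s k *\<^sub>R a) - F x) / s k * K x \<partial>lborel) \<longlonglongrightarrow> (\<integral>x. F' x a * K x \<partial>lborel)"
    by (rule C1c_difference_quotient_integral[OF F C1cD(3)[OF K] R' s])
  have 2: "(\<lambda>k. - (\<integral>x. (K (x + (- s k) *\<^sub>R a) - K x) / (- s k) * F x \<partial>lborel))
      \<longlonglongrightarrow> - (\<integral>x. K' x a * F x \<partial>lborel)"
    using s(2) by (intro tendsto_minus C1c_difference_quotient_integral[OF K C1cD(3)[OF F] R s']) auto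
  have 3: "(\<integral>x. (F (x + s k *\<^sub>R a) - F x) / s k * K x \<partial>lborel) =
      - (\<integral>x. (K (x + (- s k) *\<^sub>R a) - K x) / (- s k) * F x \<partial>lborel)" for k
    using integral_difference_shift[OF C1cD(3)[OF F] C1cD(3)[OF K] R', where s = "s k" and a = a] by (simp add: mult.commute)
  show ?thesis
    using LIMSEQ_unique[OF 1[unfolded 3] 2] by (simp add: mult.commute)
qed

\<comment> \<open>Only one of the two functions is replaced by a difference quotient, so that no second derivative is needed.\<close>
lemma C1c_integral_swap:
  fixes F K :: "'a::euclidean_space \<Rightarrow> real"
  assumes F: "C1c F F'" and K: "C1c K K'"
  shows "(\<integral>x. F' x a * K' x b \<partial>lborel) = (\<integral>x. F' x b * K' x a \<partial>lborel)"
proof -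
  obtain R where R: "\<And>x. norm x > R \<Longrightarrow> F x = 0" using F by (auto simp: C1c_def)
  obtain R' where R': "\<And>x. norm x > R' \<Longrightarrow> K x = 0" using K by (auto simp: C1c_def)
  note RF = C1c_deriv_support[OF F R] and RK = C1c_deriv_support[OF K R']
  define s where "s k = 1 / real (Suc k)" for k
  have s: "s \<longlonglongrightarrow> 0" "\<And>k. s k \<noteq> 0" unfolding s_def using LIMSEQ_Suc[OF lim_1_over_n] by auto
  have s': "(\<lambda>k. - s k) \<longlonglongrightarrow> 0" using tendsto_minus[OF s(1)] by simp
  have 1: "(\<lambda>k. \<integral>x. (K (x + s k *\<^sub>R b) - K x) / s k * F' x a \<partial>lborel) \<longlonglongrightarrow> (\<integral>x. K' x b * F' x a \<partial>lborel)"
    by (rule C1c_difference_quotient_integral[OF K C1cD(2)[OF F] RF s])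
  have 2: "(\<lambda>k. \<integral>x. (F (x + (- s k) *\<^sub>R b) - F x) / (- s k) * K' x a \<partial>lborel) \<longlonglongrightarrow> (\<integral>x. F' x b * K' x a \<partial>lborel)"
    using s(2) by (intro C1c_difference_quotient_integral[OF F C1cD(2)[OF K] RK s']) auto
  have "(\<integral>x. (K (x + s k *\<^sub>R b) - K x) / s k * F' x a \<partial>lborel) =
     (\<integral>x. (F (x + (- s k) *\<^sub>R b) - F x) / (- s k) * K' x a \<partial>lborel)" for k
  proof -
    \<comment> \<open>For fixed step the difference quotient of K in direction b is again C^1 with
      compact support. The derivative in direction a can then be moved from F onto it, and the
      discrete rule moves the quotient in direction b back onto F.\<close>
    have Q: "C1c (\<lambda>x. (K (x + s k *\<^sub>R b) - K x) / s k) (\<lambda>x a. (K' (x + s k *\<^sub>R b) a - K' x a) / s k)"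
      unfolding C1c_def
    proof (intro conjI allI)
      fix x
      have i: "((\<lambda>x. x + s k *\<^sub>R b) has_derivative (\<lambda>h. h)) (at x)"
        by (auto intro!: derivative_eq_intros)
      have d: "((\<lambda>x. K (x + s k *\<^sub>R b)) has_derivative (\<lambda>h. K' (x + s k *\<^sub>R b) h)) (at x)"
        by (rule has_derivative_compose[OF i C1cD(1)[OF K]])
      have "((\<lambda>x. (K (x + s k *\<^sub>R b) - K x) * (1 / s k)) has_derivative
          (\<lambda>a. (K' (x + s k *\<^sub>R b) a - K' x a) * (1 / s k))) (at x)"
        by (rule has_derivative_mult_left[OF has_derivative_diff[OF d C1cD(1)[OF K]]])
      then show "((\<lambda>x. (K (x + s k *\<^sub>R b) - K x) / s k) has_derivative
          (\<lambda>a. (K' (x + s k *\<^sub>R b) a - K' x a) / s k)) (at x)"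
        by (simp only: times_divide_eq_right mult_1_right)
    next
      fix a
      have "continuous_on UNIV (\<lambda>x. K' (x + s k *\<^sub>R b) a)"
        by (rule continuous_on_compose2[OF C1cD(2)[OF K, of UNIV a]]) (auto intro!: continuous_intros)
      then show "continuous_on UNIV (\<lambda>x. (K' (x + s k *\<^sub>R b) a - K' x a) / s k)"
        using s(2) by (intro continuous_on_divide continuous_on_diff continuous_on_const C1cD(2)[OF K]) simp_all
    next
      have "(K (x + s k *\<^sub>R b) - K x) / s k = 0" if "norm x > R' + norm (s k *\<^sub>R b)" for x
      proof -
        have "norm x \<le> norm (x + s k *\<^sub>R b) + norm (s k *\<^sub>R b)"
          using norm_triangle_ineq4[of "x + s k *\<^sub>R b" "s k *\<^sub>R b"] by simp
        moreover have "norm (s k *\<^sub>R b) \<ge> 0" by simp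
        ultimately have "norm x > R'" "norm (x + s k *\<^sub>R b) > R'" using that by linarith+
        then show ?thesis using R' by simp
      qed
      then show "\<exists>R. \<forall>x. norm x > R \<longrightarrow> (K (x + s k *\<^sub>R b) - K x) / s k = 0" by blast
    qed
    have "(\<integral>x. (K (x + s k *\<^sub>R b) - K x) / s k * F' x a \<partial>lborel) =
      - (\<integral>x. (K' (x + s k *\<^sub>R b) a - K' x a) / s k * F x \<partial>lborel)"
      using C1c_integral_by_parts[OF F Q, of a] by (simp add: mult.commute)
    also have "\<dots> = (\<integral>x. K' x a * ((F (x + (- s k) *\<^sub>R b) - F x) / (- s k)) \<partial>lborel)"
      using integral_difference_shift[OF C1cD(2)[OF K] C1cD(3)[OF F] R, where s = "s k" and a = b] by simp
    finally show ?thesis by (simp add: mult.commute)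
  qed
  then have "(\<lambda>k. \<integral>x. (F (x + (- s k) *\<^sub>R b) - F x) / (- s k) * K' x a \<partial>lborel) \<longlonglongrightarrow> (\<integral>x. K' x b * F' x a \<partial>lborel)"
    using 1 by simp
  then show ?thesis using LIMSEQ_unique[OF 2] by (simp add: mult.commute)
qed

lemma C1c_integral_deriv_eq_0:
  fixes F :: "'a::euclidean_space \<Rightarrow> real"
  assumes F: "C1c F F'"
  shows "(\<integral>x. F' x a \<partial>lborel) = 0"
proof -
  obtain R where R: "\<And>x. norm x > R \<Longrightarrow> F x = 0" using F by (auto simp: C1c_def)
  define s where "s k = 1 / real (Suc k)" for k
  have s: "s \<longlonglongrightarrow> 0" "\<And>k. s k \<noteq> 0" unfolding s_def using LIMSEQ_Suc[OF lim_1_over_n] by auto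
  \<comment> \<open>The constant 1 lacks compact support, so this plateau replaces it. It equals 1
    wherever F or one of its translates by a vector of norm at most \<open>norm a\<close> is
    nonzero.\<close>
  define \<phi> :: "'a \<Rightarrow> real" where "\<phi> x = max 0 (min 1 (R + norm a + 1 - norm x))" for x
  have \<phi>: "continuous_on UNIV \<phi>" unfolding \<phi>_def by (intro continuous_intros)
  have \<phi>1: "\<phi> x = 1" if "norm x \<le> R + norm a" for x using that by (simp add: \<phi>_def)
  have "(\<lambda>k. \<integral>x. (F (x + s k *\<^sub>R a) - F x) / s k * \<phi> x \<partial>lborel) \<longlonglongrightarrow> (\<integral>x. F' x a * \<phi> x \<partial>lborel)"
    by (rule C1c_difference_quotient_integral[OF F \<phi> _ s, of "R + norm a + 1"]) (simp add: \<phi>_def)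
  moreover have "(\<integral>x. (F (x + s k *\<^sub>R a) - F x) / s k * \<phi> x \<partial>lborel) = 0" for k
  proof -
    have "0 \<le> s k" "s k \<le> 1" by (auto simp: s_def)
    then have sk: "norm (s k *\<^sub>R a) \<le> norm a" by (simp add: mult_left_le_one_le)
    have Rn: "norm (x + s k *\<^sub>R a) > R" if "norm x > R + norm a" for x
      using that sk norm_triangle_ineq4[of "x + s k *\<^sub>R a" "s k *\<^sub>R a"] by simp
    have i: "integrable lborel F" by (rule integrable_continuous_compact_support[OF C1cD(3)[OF F] R])
    have "continuous_on UNIV (\<lambda>x. F (x + s k *\<^sub>R a))"
      by (rule continuous_on_compose2[OF C1cD(3)[OF F, of UNIV]]) (auto intro!: continuous_intros)
    then have i': "integrable lborel (\<lambda>x. F (x + s k *\<^sub>R a))"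
      by (rule integrable_continuous_compact_support[of _ "R + norm a"]) (use R Rn in auto)
    have "(\<integral>x. (F (x + s k *\<^sub>R a) - F x) / s k * \<phi> x \<partial>lborel) = (\<integral>x. (F (x + s k *\<^sub>R a) - F x) / s k \<partial>lborel)"
    proof (rule Bochner_Integration.integral_cong[OF refl])
      fix x
      show "(F (x + s k *\<^sub>R a) - F x) / s k * \<phi> x = (F (x + s k *\<^sub>R a) - F x) / s k"
      proof (cases "norm x \<le> R + norm a")
        case False
        then have "norm x > R" using norm_ge_zero[of a] by linarith
        then show ?thesis using R[of x] R[OF Rn[of x]] False by simp
      qed (simp add: \<phi>1)
    qed
    also have "\<dots> = 0"
      using i i' integral_lborel_translate[of F "s k *\<^sub>R a"] by (simp add: borel_measurable_integrable)
    finally show ?thesis .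
  qed
  ultimately have "(\<lambda>k::nat. 0) \<longlonglongrightarrow> (\<integral>x. F' x a * \<phi> x \<partial>lborel)" by (simp only:)
  then have "(\<integral>x. F' x a * \<phi> x \<partial>lborel) = 0" using LIMSEQ_unique tendsto_const by blast
  moreover have "F' x a * \<phi> x = F' x a" for x
  proof (cases "norm x > R")
    case True
    then show ?thesis using C1c_deriv_support[OF F R True] by simp
  next
    case False
    then show ?thesis using \<phi>1[of x] norm_ge_zero[of a] by (simp del: norm_ge_zero)
  qed
  ultimately show ?thesis by simp
qed

section \<open>Traces and integrals of the second symmetric function\<close>

lemma ltrace_add: "ltrace (\<lambda>w. f w + g w) = ltrace f + ltrace g"
  by (simp add: ltrace_def inner_add_left sum.distrib)

lemma ltrace_diff: "ltrace (\<lambda>w. f w - g w) = ltrace f - ltrace g"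
  by (simp add: ltrace_def inner_diff_left sum_subtractf)

lemma ltrace_scaleR: "ltrace (\<lambda>w. c *\<^sub>R f w) = c * ltrace f"
  by (simp add: ltrace_def sum_distrib_left)

lemma ltrace_rank_one: "ltrace (\<lambda>w. (p \<bullet> w) *\<^sub>R q) = p \<bullet> q"
  by (simp add: ltrace_def euclidean_inner[of p q])

lemma ltrace_rank_one_scaled: "ltrace (\<lambda>w. (c * (p \<bullet> w)) *\<^sub>R q) = c * (p \<bullet> q)"
  using ltrace_rank_one[of "c *\<^sub>R p" q] by simp

lemma ltrace_id: "ltrace (\<lambda>w. w :: 'a::euclidean_space) = real DIM('a)"
  by (simp add: ltrace_def inner_same_Basis)

lemma linear_ltrace_rank_one:
  assumes "linear f"
  shows "ltrace (\<lambda>w. (p \<bullet> f w) *\<^sub>R q) = p \<bullet> f q"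
proof -
  have "f q = (\<Sum>b\<in>Basis. (q \<bullet> b) *\<^sub>R f b)"
    using arg_cong[OF euclidean_representation[of q], of f] assms by (simp add: linear_sum linear_scale)
  then show ?thesis
    by (simp add: ltrace_def inner_sum_right mult.commute)
qed

text \<open>The right-hand side is half the sum of all 2 by 2 principal minors, over ordered pairs
  of basis vectors. In this form the integral can be treated minor by minor.\<close>

lemma S2_linear:
  assumes "linear f"
  shows "S2 f = (\<Sum>a\<in>Basis. \<Sum>b\<in>Basis. ((f a \<bullet> a) * (f b \<bullet> b) - (f b \<bullet> a) * (f a \<bullet> b)) / 2)"
proof -
  have "f (f a) \<bullet> a = (\<Sum>b\<in>Basis. (f b \<bullet> a) * (f a \<bullet> b))" for a
  proof -
    have "f (f a) = (\<Sum>b\<in>Basis. (f a \<bullet> b) *\<^sub>R f b)"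
      using arg_cong[OF euclidean_representation[of "f a"], of f] assms
      by (simp add: linear_sum linear_scale)
    then show ?thesis by (simp add: inner_sum_left mult.commute)
  qed
  then have tr2: "ltrace (f \<circ> f) = (\<Sum>a\<in>Basis. \<Sum>b\<in>Basis. (f b \<bullet> a) * (f a \<bullet> b))"
    by (simp add: ltrace_def)
  have tr1: "(ltrace f)\<^sup>2 = (\<Sum>a\<in>Basis. \<Sum>b\<in>Basis. (f a \<bullet> a) * (f b \<bullet> b))"
    by (simp add: ltrace_def power2_eq_square sum_product)
  show ?thesis
    unfolding S2_def tr1 tr2 by (simp add: sum_subtractf sum_divide_distrib diff_divide_distrib)
qed

lemma integral_ltrace_deriv_eq_0:
  fixes Y :: "'a::euclidean_space \<Rightarrow> 'a"
  assumes Y: "\<And>b. b \<in> Basis \<Longrightarrow> C1c (\<lambda>x. Y x \<bullet> b) (\<lambda>x a. Y' x a \<bullet> b)"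
  shows "integrable lborel (\<lambda>x. ltrace (Y' x))" "(\<integral>x. ltrace (Y' x) \<partial>lborel) = 0"
proof -
  have i: "integrable lborel (\<lambda>x. Y' x b \<bullet> b)" if b: "b \<in> Basis" for b
  proof -
    obtain R where R: "\<And>x. norm x > R \<Longrightarrow> Y x \<bullet> b = 0" using Y[OF b] by (auto simp: C1c_def)
    show ?thesis
      by (rule integrable_continuous_compact_support[OF C1cD(2)[OF Y[OF b]] C1c_deriv_support[OF Y[OF b] R]])
  qed
  then show "integrable lborel (\<lambda>x. ltrace (Y' x))" by (simp add: ltrace_def)
  show "(\<integral>x. ltrace (Y' x) \<partial>lborel) = 0"
    using i by (simp add: ltrace_def C1c_integral_deriv_eq_0[OF Y])
qed

text \<open>Each minor is a null Lagrangian: by \<open>C1c_integral_swap\<close> the two products in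
  it have the same integral.\<close>

lemma integral_S2_deriv_eq_0:
  fixes Y :: "'a::euclidean_space \<Rightarrow> 'a"
  assumes Y: "\<And>b. b \<in> Basis \<Longrightarrow> C1c (\<lambda>x. Y x \<bullet> b) (\<lambda>x a. Y' x a \<bullet> b)"
    and lin: "\<And>x. linear (Y' x)"
  shows "integrable lborel (\<lambda>x. S2 (Y' x))" "(\<integral>x. S2 (Y' x) \<partial>lborel) = 0"
proof -
  have i: "integrable lborel (\<lambda>x. (Y' x a \<bullet> b) * (Y' x c \<bullet> d))" if b: "b \<in> Basis" "d \<in> Basis" for a b c d
  proof -
    obtain R where R: "\<And>x. norm x > R \<Longrightarrow> Y x \<bullet> b = 0" using Y[OF b(1)] by (auto simp: C1c_def)
    show ?thesis
      by (rule integrable_continuous_compact_support[of _ R])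
        (auto intro!: continuous_on_mult C1cD(2)[OF Y] b simp: C1c_deriv_support[OF Y[OF b(1)] R])
  qed
  note S2 = S2_linear[OF lin]
  show "integrable lborel (\<lambda>x. S2 (Y' x))"
    unfolding S2 by (intro Bochner_Integration.integrable_sum integrable_divide Bochner_Integration.integrable_diff i)
  have "(\<integral>x. S2 (Y' x) \<partial>lborel) = (\<Sum>a\<in>Basis. \<Sum>b\<in>Basis.
     ((\<integral>x. (Y' x a \<bullet> a) * (Y' x b \<bullet> b) \<partial>lborel) - (\<integral>x. (Y' x b \<bullet> a) * (Y' x a \<bullet> b) \<partial>lborel)) / 2)"
    unfolding S2 using i by (simp add: Bochner_Integration.integral_sum Bochner_Integration.integral_diff)
  also have "\<dots> = 0"
    by (intro sum.neutral ballI) (simp add: C1c_integral_swap[OF Y Y])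
  finally show "(\<integral>x. S2 (Y' x) \<partial>lborel) = 0" .
qed

text \<open>For fields built from a homogeneous gradient, which is singular at 0, and a cutoff that
  vanishes near 0. Differentiability then has to be checked only away from the origin.\<close>

lemma C1cI_away_from_0:
  fixes F :: "'a::euclidean_space \<Rightarrow> real"
  assumes d: "\<And>x. x \<noteq> 0 \<Longrightarrow> (F has_derivative F' x) (at x)"
    and c: "\<And>a. continuous_on (-{0}) (\<lambda>x. F' x a)"
    and z: "\<delta> > 0" "\<And>x. norm x < \<delta> \<Longrightarrow> F x = 0" "\<And>x a. norm x < \<delta> \<Longrightarrow> F' x a = 0"
    and R: "\<And>x. norm x > R \<Longrightarrow> F x = 0"
  shows "C1c F F'"
  unfolding C1c_def
proof (intro conjI allI exI[of _ R] impI R)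
  fix x :: 'a
  show "(F has_derivative F' x) (at x)"
  proof (cases "x = 0")
    case True
    have "((\<lambda>_. 0) has_derivative F' x) (at x)"
    proof -
      have "F' x = (\<lambda>_. 0)" using z(1,3) True by auto
      then show ?thesis by simp
    qed
    then show ?thesis
      by (rule has_derivative_transform_within_open[OF _ open_ball[of 0 \<delta>]]) (use z True in auto)
  qed (rule d)
next
  fix a
  have "continuous_on (ball 0 \<delta>) (\<lambda>x. F' x a)"
    by (rule continuous_on_eq[of _ "\<lambda>_. 0"]) (use z in auto)
  then have "continuous_on (ball 0 \<delta> \<union> -{0}) (\<lambda>x. F' x a)"
    using c by (intro continuous_on_open_Un) auto
  moreover have "ball 0 \<delta> \<union> -{0} = (UNIV :: 'a set)" using z(1) by auto
  ultimately show "continuous_on UNIV (\<lambda>x. F' x a)" by simp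
qed

section \<open>The 0-homogeneous extension, its gradient G and its Hessian H\<close>

locale C2_sphere_fun =
  fixes V :: "'a::euclidean_space \<Rightarrow> real"
  assumes C2: "C2_sphere V"
begin

definition G :: "'a \<Rightarrow> 'a" where "G = egrad (hext V)"
definition H :: "'a \<Rightarrow> 'a \<Rightarrow> 'a" where "H x = frechet_derivative G (at x)"

lemma hext_scaleR: "c > 0 \<Longrightarrow> hext V (c *\<^sub>R x) = hext V x"
  unfolding hext_def by (simp add: divide_simps)

lemma hext_has_derivative: "x \<noteq> 0 \<Longrightarrow> (hext V has_derivative (\<lambda>w. G x \<bullet> w)) (at x)"
proof -
  assume "x \<noteq> 0"
  then have d: "(hext V has_derivative frechet_derivative (hext V) (at x)) (at x)"
    using C2 frechet_derivative_works by (auto simp: C2_sphere_def)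
  have "frechet_derivative (hext V) (at x) w = G x \<bullet> w" for w
  proof -
    have "frechet_derivative (hext V) (at x) w = frechet_derivative (hext V) (at x) (\<Sum>b\<in>Basis. (w \<bullet> b) *\<^sub>R b)"
      by (simp add: euclidean_representation)
    also have "\<dots> = (\<Sum>b\<in>Basis. (w \<bullet> b) * frechet_derivative (hext V) (at x) b)"
      using has_derivative_linear[OF d] by (simp add: linear_sum linear_scale)
    also have "\<dots> = G x \<bullet> w" by (simp add: G_def egrad_def inner_sum_left inner_commute[of w] mult.commute)
    finally show ?thesis .
  qed
  then have "frechet_derivative (hext V) (at x) = (\<lambda>w. G x \<bullet> w)" by blast
  with d show ?thesis by simp
qed

lemma G_has_derivative: "x \<noteq> 0 \<Longrightarrow> (G has_derivative H x) (at x)"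
  unfolding H_def using C2 frechet_derivative_works by (auto simp: C2_sphere_def G_def)

lemma linear_H: "x \<noteq> 0 \<Longrightarrow> linear (H x)"
  using G_has_derivative has_derivative_linear by blast

lemma continuous_on_H: "S \<subseteq> -{0} \<Longrightarrow> continuous_on S (\<lambda>x. H x a)"
  using C2 continuous_on_subset[of "-{0}" _ S] by (auto simp: C2_sphere_def G_def H_def)

lemma continuous_on_G: "S \<subseteq> -{0} \<Longrightarrow> continuous_on S G"
  by (rule has_derivative_continuous_on[of S G H]) (auto intro: has_derivative_at_withinI G_has_derivative)

lemma G_scaleR: "x \<noteq> 0 \<Longrightarrow> c > 0 \<Longrightarrow> G (c *\<^sub>R x) = G x /\<^sub>R c"
proof -
  assume x: "x \<noteq> 0" and c: "c > 0"
  have s: "((\<lambda>x. c *\<^sub>R x) has_derivative (\<lambda>h. c *\<^sub>R h)) (at x)"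
    by (auto intro!: derivative_eq_intros)
  have "((\<lambda>x. hext V (c *\<^sub>R x)) has_derivative (\<lambda>h. G (c *\<^sub>R x) \<bullet> (c *\<^sub>R h))) (at x)"
    by (rule has_derivative_compose[OF s hext_has_derivative]) (use x c in simp)
  then have "(hext V has_derivative (\<lambda>h. G (c *\<^sub>R x) \<bullet> (c *\<^sub>R h))) (at x)"
    using c by (simp only: hext_scaleR)
  then have "(\<lambda>h. G (c *\<^sub>R x) \<bullet> (c *\<^sub>R h)) = (\<lambda>w. G x \<bullet> w)"
    using hext_has_derivative[OF x] has_derivative_unique by blast
  then have "(c *\<^sub>R G (c *\<^sub>R x)) \<bullet> h = G x \<bullet> h" for h by (metis inner_scaleR_left inner_scaleR_right)
  then have "c *\<^sub>R G (c *\<^sub>R x) = G x" by (metis vector_eq_rdot)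
  then show ?thesis using c by (metis scaleR_scaleR left_inverse less_irrefl scaleR_one)
qed

lemma H_scaleR: "x \<noteq> 0 \<Longrightarrow> c > 0 \<Longrightarrow> H (c *\<^sub>R x) w = H x w /\<^sub>R c\<^sup>2"
proof -
  assume x: "x \<noteq> 0" and c: "c > 0"
  have s: "((\<lambda>x. c *\<^sub>R x) has_derivative (\<lambda>h. c *\<^sub>R h)) (at x)"
    by (auto intro!: derivative_eq_intros)
  have 1: "((\<lambda>x. G (c *\<^sub>R x)) has_derivative (\<lambda>h. H (c *\<^sub>R x) (c *\<^sub>R h))) (at x)"
    by (rule has_derivative_compose[OF s G_has_derivative]) (use x c in simp)
  have "((\<lambda>x. G x /\<^sub>R c) has_derivative (\<lambda>h. H x h /\<^sub>R c)) (at x)"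
    by (rule has_derivative_scaleR_right[OF G_has_derivative[OF x]])
  then have 2: "((\<lambda>x. G (c *\<^sub>R x)) has_derivative (\<lambda>h. H x h /\<^sub>R c)) (at x)"
    by (rule has_derivative_transform_within_open[OF _ open_Compl[OF closed_singleton[of 0]]]) (use x c in \<open>auto simp: G_scaleR\<close>)
  have "H (c *\<^sub>R x) (c *\<^sub>R w) = H x w /\<^sub>R c"
    using has_derivative_unique[OF 1 2] by meson
  then have "c *\<^sub>R H (c *\<^sub>R x) w = H x w /\<^sub>R c"
    using linear_scale[OF linear_H[of "c *\<^sub>R x"]] x c by simp
  then have "(1 / c) *\<^sub>R c *\<^sub>R H (c *\<^sub>R x) w = (1 / c) *\<^sub>R (H x w /\<^sub>R c)" by simp
  then show ?thesis using c by (simp add: power2_eq_square divide_inverse)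
qed

text \<open>Infinitesimal forms of the homogeneity of hext V (degree 0) and of G (degree -1).\<close>

lemma inner_G_self: "x \<noteq> 0 \<Longrightarrow> G x \<bullet> x = 0"
proof -
  assume x: "x \<noteq> 0"
  have 1: "((\<lambda>t. hext V (t *\<^sub>R x)) has_derivative (\<lambda>h. G (1 *\<^sub>R x) \<bullet> (h *\<^sub>R x))) (at 1)"
    by (rule has_derivative_compose[OF _ hext_has_derivative])
       (use x in \<open>auto intro!: derivative_eq_intros\<close>)
  have 2: "((\<lambda>t. hext V (t *\<^sub>R x)) has_derivative (\<lambda>h. 0)) (at (1::real))"
    by (rule has_derivative_transform_within_open[OF has_derivative_const[of "hext V x"] open_greaterThan[of 0]])
       (auto simp: hext_scaleR)
  have "G (1 *\<^sub>R x) \<bullet> (1 *\<^sub>R x) = 0"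
    using fun_cong[OF has_derivative_unique[OF 1 2], of 1] .
  then show ?thesis by simp
qed

lemma H_self: "x \<noteq> 0 \<Longrightarrow> H x x = - G x"
proof -
  assume x: "x \<noteq> 0"
  have 1: "((\<lambda>t. G (t *\<^sub>R x)) has_derivative (\<lambda>h. H (1 *\<^sub>R x) (h *\<^sub>R x))) (at 1)"
    by (rule has_derivative_compose[OF _ G_has_derivative])
       (use x in \<open>auto intro!: derivative_eq_intros\<close>)
  have "((\<lambda>t. inverse t *\<^sub>R G x) has_derivative (\<lambda>h. (- h) *\<^sub>R G x)) (at (1::real))"
    by (auto intro!: derivative_eq_intros)
  then have 2: "((\<lambda>t. G (t *\<^sub>R x)) has_derivative (\<lambda>h. (- h) *\<^sub>R G x)) (at (1::real))"
    by (rule has_derivative_transform_within_open[OF _ open_greaterThan[of 0]]) (use x in \<open>auto simp: G_scaleR\<close>)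
  have "H (1 *\<^sub>R x) (1 *\<^sub>R x) = (- 1) *\<^sub>R G x"
    using has_derivative_unique[OF 1 2] by meson
  then show ?thesis by simp
qed

lemma inner_H: "x \<noteq> 0 \<Longrightarrow> x \<bullet> H x w = - (G x \<bullet> w)"
proof -
  assume x: "x \<noteq> 0"
  have 1: "((\<lambda>x. G x \<bullet> x) has_derivative (\<lambda>h. G x \<bullet> h + H x h \<bullet> x)) (at x)"
    by (auto intro!: derivative_eq_intros G_has_derivative x)
  have 2: "((\<lambda>x. G x \<bullet> x) has_derivative (\<lambda>h. 0)) (at x)"
    by (rule has_derivative_transform_within_open[OF has_derivative_const[of 0] open_Compl[OF closed_singleton[of 0]]])
       (use x in \<open>auto simp: inner_G_self\<close>)
  have "G x \<bullet> w + H x w \<bullet> x = 0" using has_derivative_unique[OF 1 2] by meson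
  then show ?thesis by (simp add: inner_commute)
qed

lemma sph_grad_eq: "norm \<xi> = 1 \<Longrightarrow> sph_grad V \<xi> = G \<xi>"
  using inner_G_self[of \<xi>] by (force simp: sph_grad_def tproj_def G_def)

text \<open>Since H maps \<xi> to -G and \<xi> . H w = -(G . w), projecting H on both sides adds the
  rank-one maps (\<xi> . w) G and (G . w) \<xi>. The trace is unchanged, the trace of the square
  drops by 2 |G|^2, and so S_2 grows by |G|^2.\<close>

lemma S2_sph_hess:
  assumes xi: "norm \<xi> = 1"
  shows "S2 (sph_hess V \<xi>) = S2 (H \<xi>) + (norm (G \<xi>))\<^sup>2"
proof -
  have nz: "\<xi> \<noteq> 0" using xi by auto
  have one: "\<xi> \<bullet> \<xi> = 1" using xi by (simp add: power2_norm_eq_inner[symmetric])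
  note facts = inner_G_self[OF nz] H_self[OF nz] inner_H[OF nz]
  have lin: "linear (H \<xi>)" by (rule linear_H[OF nz])
  have N: "sph_hess V \<xi> w = H \<xi> w + (\<xi> \<bullet> w) *\<^sub>R G \<xi> + (G \<xi> \<bullet> w) *\<^sub>R \<xi>" for w
  proof -
    have "H \<xi> (w - (w \<bullet> \<xi>) *\<^sub>R \<xi>) = H \<xi> w + (\<xi> \<bullet> w) *\<^sub>R G \<xi>"
      using lin by (simp add: linear_diff linear_scale facts inner_commute)
    then show ?thesis
      using facts(1) facts(3)[of w]
      by (simp add: sph_hess_def tproj_def H_def[symmetric] G_def[symmetric] inner_add_left inner_commute[of "H \<xi> w"])
  qed
  have NN: "sph_hess V \<xi> (sph_hess V \<xi> w) = H \<xi> (H \<xi> w) + (\<xi> \<bullet> w) *\<^sub>R H \<xi> (G \<xi>) - (G \<xi> \<bullet> w) *\<^sub>R G \<xi>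
     + (G \<xi> \<bullet> H \<xi> w) *\<^sub>R \<xi> + (G \<xi> \<bullet> G \<xi>) *\<^sub>R ((\<xi> \<bullet> w) *\<^sub>R \<xi>)" for w
  proof -
    define y where "y = sph_hess V \<xi> w"
    have y: "y = H \<xi> w + (\<xi> \<bullet> w) *\<^sub>R G \<xi> + (G \<xi> \<bullet> w) *\<^sub>R \<xi>" unfolding y_def by (rule N)
    have "H \<xi> y = H \<xi> (H \<xi> w) + (\<xi> \<bullet> w) *\<^sub>R H \<xi> (G \<xi>) - (G \<xi> \<bullet> w) *\<^sub>R G \<xi>"
      unfolding y using lin by (simp add: linear_add linear_scale facts)
    moreover have "\<xi> \<bullet> y = 0"
      unfolding y using facts(1) by (simp add: inner_add_right facts(3) one inner_commute[of \<xi> "G \<xi>"])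
    moreover have "G \<xi> \<bullet> y = G \<xi> \<bullet> H \<xi> w + (\<xi> \<bullet> w) * (G \<xi> \<bullet> G \<xi>)"
      unfolding y using facts(1) by (simp add: inner_add_right)
    moreover have "sph_hess V \<xi> y = H \<xi> y + (\<xi> \<bullet> y) *\<^sub>R G \<xi> + (G \<xi> \<bullet> y) *\<^sub>R \<xi>" by (rule N)
    ultimately show ?thesis unfolding y_def[symmetric] by (simp add: scaleR_add_left mult.commute)
  qed
  have "ltrace (sph_hess V \<xi>) = ltrace (\<lambda>w. H \<xi> w + (\<xi> \<bullet> w) *\<^sub>R G \<xi> + (G \<xi> \<bullet> w) *\<^sub>R \<xi>)"
    by (simp add: N[abs_def] ext[of "sph_hess V \<xi>", OF N])
  also have "\<dots> = ltrace (H \<xi>)"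
    using facts(1) by (simp add: ltrace_add ltrace_rank_one inner_commute[of \<xi> "G \<xi>"])
  finally have tr1: "ltrace (sph_hess V \<xi>) = ltrace (H \<xi>)" .
  have "ltrace (sph_hess V \<xi> \<circ> sph_hess V \<xi>) = ltrace (\<lambda>w. H \<xi> (H \<xi> w) + (\<xi> \<bullet> w) *\<^sub>R H \<xi> (G \<xi>) - (G \<xi> \<bullet> w) *\<^sub>R G \<xi>
     + (G \<xi> \<bullet> H \<xi> w) *\<^sub>R \<xi> + (G \<xi> \<bullet> G \<xi>) *\<^sub>R ((\<xi> \<bullet> w) *\<^sub>R \<xi>))"
    unfolding o_def by (rule arg_cong[of _ _ ltrace], rule ext, rule NN)
  also have "\<dots> = ltrace (\<lambda>w. H \<xi> (H \<xi> w)) - 2 * (G \<xi> \<bullet> G \<xi>)"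
    by (simp add: ltrace_add ltrace_diff ltrace_scaleR ltrace_rank_one ltrace_rank_one_scaled
        linear_ltrace_rank_one[OF lin] facts one)
  finally show ?thesis by (simp add: S2_def tr1 o_def power2_norm_eq_inner field_simps)
qed

end

section \<open>Functions of x/|x| and a C^1 step function\<close>

lemma continuous_on_normalize:
  fixes \<phi> :: "'a::euclidean_space \<Rightarrow> real"
  assumes "continuous_on (sphere 0 1) \<phi>"
  shows "continuous_on (-{0}) (\<lambda>x. \<phi> (x /\<^sub>R norm x))"
proof (rule continuous_on_compose2[OF assms])
  show "continuous_on (-{0}) (\<lambda>x::'a. x /\<^sub>R norm x)" by (auto intro!: continuous_intros)
  show "(\<lambda>x::'a. x /\<^sub>R norm x) ` (-{0}) \<subseteq> sphere 0 1"
  proof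
    fix y assume "y \<in> (\<lambda>x::'a. x /\<^sub>R norm x) ` (-{0})"
    then obtain x :: 'a where "x \<noteq> 0" "y = x /\<^sub>R norm x" by auto
    then show "y \<in> sphere 0 1" by simp
  qed
qed

lemma normalize_bounded:
  fixes \<phi> :: "'a::euclidean_space \<Rightarrow> real"
  assumes "continuous_on (sphere 0 1) \<phi>"
  obtains B where "B \<ge> 0" "\<And>x. norm x = 1 \<Longrightarrow> \<bar>\<phi> x\<bar> \<le> B" "\<And>x. x \<noteq> 0 \<Longrightarrow> \<bar>\<phi> (x /\<^sub>R norm x)\<bar> \<le> B"
proof -
  have "bounded (\<phi> ` sphere 0 1)"
    by (intro compact_imp_bounded compact_continuous_image assms compact_sphere)
  then obtain B where "B > 0" "\<forall>y\<in>\<phi> ` sphere 0 1. norm y \<le> B"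
    unfolding bounded_pos by blast
  then show ?thesis by (intro that[of B]) auto
qed

lemma borel_measurable_normalize:
  fixes \<phi> :: "'a::euclidean_space \<Rightarrow> real"
  assumes "continuous_on (sphere 0 1) \<phi>"
  shows "(\<lambda>x. indicator (-{0}) x *\<^sub>R \<phi> (x /\<^sub>R norm x)) \<in> borel_measurable borel"
  by (rule borel_measurable_continuous_on_indicator) (auto intro: continuous_on_normalize assms)

text \<open>At the origin x/|x| evaluates to 0, where nothing is known about the function. The
  Lebesgue integral is therefore taken over the punctured ball and the null set restored
  afterwards.\<close>

lemma integrable_normalize:
  fixes \<phi> :: "'a::euclidean_space \<Rightarrow> real"
  assumes \<phi>: "continuous_on (sphere 0 1) \<phi>"
  shows "set_integrable lborel (ball 0 1 - {0}) (\<lambda>x. \<phi> (x /\<^sub>R norm x))"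
    "(\<lambda>x. \<phi> (x /\<^sub>R norm x)) integrable_on ball 0 1"
    "integral (ball 0 1) (\<lambda>x. \<phi> (x /\<^sub>R norm x)) = (LINT x:ball 0 1 - {0}|lborel. \<phi> (x /\<^sub>R norm x))"
proof -
  obtain B where B: "B \<ge> 0" "\<And>x. x \<noteq> 0 \<Longrightarrow> \<bar>\<phi> (x /\<^sub>R norm x)\<bar> \<le> B" using normalize_bounded[OF \<phi>] by metis
  have "integrable lborel (\<lambda>x. indicator (ball 0 1) x *\<^sub>R (indicator (-{0}) x *\<^sub>R \<phi> (x /\<^sub>R norm x)))"
    by (rule integrableI_bounded_set_indicator[where B = B])
       (use borel_measurable_normalize[OF \<phi>] B in \<open>auto simp: emeasure_lborel_ball_finite[unfolded infinity_ennreal_def] indicator_def\<close>)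
  also have "(\<lambda>x. indicator (ball 0 1) x *\<^sub>R (indicator (-{0}) x *\<^sub>R \<phi> (x /\<^sub>R norm x))) =
     (\<lambda>x. indicator (ball 0 1 - {0}) x *\<^sub>R \<phi> (x /\<^sub>R norm x))"
    by (auto simp: indicator_def fun_eq_iff)
  finally show 1: "set_integrable lborel (ball 0 1 - {0}) (\<lambda>x. \<phi> (x /\<^sub>R norm x))"
    by (simp add: set_integrable_def)
  have neg: "negligible {x \<in> ball 0 1 - (ball 0 1 - {0}). (\<phi> (x /\<^sub>R norm x)) \<noteq> 0}"
     "negligible {x \<in> (ball 0 1 - {0}) - ball (0::'a) 1. (\<phi> (x /\<^sub>R norm x)) \<noteq> 0}"
    by (rule negligible_subset[of "{0}"]; force)+
  show "(\<lambda>x. \<phi> (x /\<^sub>R norm x)) integrable_on ball 0 1"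
    by (rule integrable_spike_set[OF set_borel_integral_eq_integral(1)[OF 1] neg(2,1)])
  show "integral (ball 0 1) (\<lambda>x. \<phi> (x /\<^sub>R norm x)) = (LINT x:ball 0 1 - {0}|lborel. \<phi> (x /\<^sub>R norm x))"
    using set_borel_integral_eq_integral(2)[OF 1] integral_spike_set[OF neg] by simp
qed

text \<open>Rises from 0 to 1 on the unit interval, where it equals 1 - (1 - y^2)^2. Building it
  from the C^1 function (max 0 y)^2 lets the chain rule produce its derivative with no matching at 0
  and 1.\<close>

definition smoothstep :: "real \<Rightarrow> real" where
  "smoothstep y = 1 - (max 0 (1 - (max 0 y)\<^sup>2))\<^sup>2"

lemma has_real_derivative_max_0_square: "((\<lambda>y. (max 0 y)\<^sup>2) has_real_derivative 2 * max 0 y) (at y)"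
proof -
  consider "y > 0" | "y < 0" | "y = 0" by linarith
  then show ?thesis
  proof cases
    case 1
    have "((\<lambda>y. y\<^sup>2) has_real_derivative 2 * max 0 y) (at y)"
      using 1 by (auto intro!: derivative_eq_intros)
    then show ?thesis
      by (rule has_field_derivative_transform_within_open[of _ _ _ "{0<..}"]) (use 1 in auto)
  next
    case 2
    have "((\<lambda>y. 0) has_real_derivative 2 * max 0 y) (at y)" using 2 by simp
    then show ?thesis
      by (rule has_field_derivative_transform_within_open[of _ _ _ "{..<0}"]) (use 2 in auto)
  next
    case 3
    have "((\<lambda>h. (max 0 h)\<^sup>2 / h) \<longlongrightarrow> 0) (at (0::real))"
    proof (rule Lim_null_comparison)
      show "\<forall>\<^sub>F h in at (0::real). norm ((max 0 h)\<^sup>2 / h) \<le> \<bar>h\<bar>"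
        by (rule always_eventually) (auto simp: max_def power2_eq_square)
      show "((\<lambda>h. \<bar>h\<bar>) \<longlongrightarrow> 0) (at (0::real))" by (intro tendsto_eq_intros refl) auto
    qed
    then show ?thesis using 3 by (simp add: DERIV_def)
  qed
qed

lemma smoothstep_deriv:
  "(smoothstep has_real_derivative 4 * max 0 (1 - (max 0 y)\<^sup>2) * max 0 y) (at y)"
proof -
  have "((\<lambda>y. 1 - (max 0 y)\<^sup>2) has_real_derivative 0 - 2 * max 0 y) (at y)"
    by (intro DERIV_diff DERIV_const has_real_derivative_max_0_square)
  then have "((\<lambda>y. (max 0 (1 - (max 0 y)\<^sup>2))\<^sup>2) has_real_derivative 2 * max 0 (1 - (max 0 y)\<^sup>2) * (0 - 2 * max 0 y)) (at y)"
    by (rule DERIV_chain2[OF has_real_derivative_max_0_square])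
  then have "((\<lambda>y. 1 - (max 0 (1 - (max 0 y)\<^sup>2))\<^sup>2) has_real_derivative 0 - 2 * max 0 (1 - (max 0 y)\<^sup>2) * (0 - 2 * max 0 y)) (at y)"
    by (intro DERIV_diff DERIV_const)
  then show ?thesis by (simp add: smoothstep_def[abs_def] algebra_simps)
qed

lemma smoothstep_bounds: "0 \<le> smoothstep y" "smoothstep y \<le> 1"
  by (auto simp: smoothstep_def power_le_one)

lemma smoothstep_0: "y \<le> 0 \<Longrightarrow> smoothstep y = 0"
  by (simp add: smoothstep_def)

lemma smoothstep_1: "y \<ge> 1 \<Longrightarrow> smoothstep y = 1"
  by (simp add: smoothstep_def)

section \<open>Integral identities with radial cutoffs g(|x|^2)\<close>

context C2_sphere_fun
begin

lemma continuous_on_S2_H: "S \<subseteq> -{0} \<Longrightarrow> continuous_on S (\<lambda>x. S2 (H x))"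
proof -
  assume S: "S \<subseteq> -{0}"
  have "continuous_on S (\<lambda>x. \<Sum>a\<in>Basis. \<Sum>b\<in>Basis. ((H x a \<bullet> a) * (H x b \<bullet> b) - (H x b \<bullet> a) * (H x a \<bullet> b)) / 2)"
    using S by (intro continuous_intros continuous_on_H) auto
  then show ?thesis
  proof (rule continuous_on_eq)
    fix x assume "x \<in> S"
    then have "x \<noteq> 0" using S by auto
    then show "(\<Sum>a\<in>Basis. \<Sum>b\<in>Basis. ((H x a \<bullet> a) * (H x b \<bullet> b) - (H x b \<bullet> a) * (H x a \<bullet> b)) / 2) = S2 (H x)"
      by (rule S2_linear[OF linear_H, symmetric])
  qed
qed

lemma S2_H_scaleR:
  assumes "x \<noteq> 0" "c > 0"
  shows "S2 (H (c *\<^sub>R x)) = S2 (H x) / c ^ 4"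
proof -
  have c4: "c ^ 4 = c\<^sup>2 * c\<^sup>2" by (simp flip: power_add)
  have l: "linear (H (c *\<^sub>R x))" "linear (H x)" using assms by (auto intro: linear_H)
  show ?thesis
    unfolding S2_linear[OF l(1)] S2_linear[OF l(2)] sum_divide_distrib
  proof (intro sum.cong refl)
    fix a b :: 'a
    have *: "H (c *\<^sub>R x) w \<bullet> z = (H x w \<bullet> z) / c\<^sup>2" for w z
      using assms by (simp add: H_scaleR divide_inverse mult.commute)
    show "(H (c *\<^sub>R x) a \<bullet> a * (H (c *\<^sub>R x) b \<bullet> b) - H (c *\<^sub>R x) b \<bullet> a * (H (c *\<^sub>R x) a \<bullet> b)) / 2 =
      (H x a \<bullet> a * (H x b \<bullet> b) - H x b \<bullet> a * (H x a \<bullet> b)) / 2 / c ^ 4"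
      unfolding * c4 by (simp add: diff_divide_distrib)
  qed
qed

context
  fixes g g' :: "real \<Rightarrow> real" and a b :: real
  assumes g: "\<And>q. (g has_real_derivative g' q) (at q)" "continuous_on UNIV g'"
    and ab: "0 < a" "\<And>q. q < a \<Longrightarrow> g q = 0" "\<And>q. q > b \<Longrightarrow> g q = 0"
begin

lemma cutoff_deriv_eq_0: "q < a \<Longrightarrow> g' q = 0"
proof -
  assume q: "q < a"
  have "((\<lambda>_. 0) has_real_derivative g' q) (at q)"
    by (rule has_field_derivative_transform_within_open[OF g(1) open_lessThan[of a]]) (use q ab in auto)
  then show "g' q = 0" using DERIV_unique DERIV_const by blast
qed

lemma continuous_on_cutoff: "continuous_on S g"
  by (rule DERIV_continuous_on[OF has_field_derivative_at_within[OF g(1)]])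

lemma cutoff_support: "norm x < sqrt a \<Longrightarrow> x \<bullet> x < a" "norm x > sqrt (max 0 b) \<Longrightarrow> x \<bullet> x > b" for x :: 'a
proof -
  assume "norm x < sqrt a"
  then show "x \<bullet> x < a" by (metis norm_eq_sqrt_inner real_sqrt_less_iff)
next
  assume "norm x > sqrt (max 0 b)"
  then have "x \<bullet> x > max 0 b" by (metis norm_eq_sqrt_inner real_sqrt_less_iff)
  then show "x \<bullet> x > b" by simp
qed

lemma inner_self_has_derivative: "((\<lambda>x. x \<bullet> x) has_derivative (\<lambda>h. 2 * (x \<bullet> h))) (at x)" for x :: 'a
  by (auto intro!: derivative_eq_intros simp: inner_commute)

lemma cutoff_has_derivative:
  "((\<lambda>x. g (x \<bullet> x)) has_derivative (\<lambda>h. 2 * g' (x \<bullet> x) * (x \<bullet> h))) (at x)" for x :: 'a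
  using has_derivative_compose[OF inner_self_has_derivative g(1)[unfolded has_field_derivative_def]]
  by (simp add: mult_ac)

text \<open>The null Lagrangian property for the field g G. Its derivative is g H plus a rank-one
  map in x and G; because x . G = 0 the trace is g times that of H, while the cross terms change the
  trace of the square by -4 g g' |G|^2.\<close>

lemma cutoff_S2_identity:
  "integrable lborel (\<lambda>x. (g (x \<bullet> x))\<^sup>2 * S2 (H x) + 2 * g (x \<bullet> x) * g' (x \<bullet> x) * (G x \<bullet> G x))"
  "(\<integral>x. (g (x \<bullet> x))\<^sup>2 * S2 (H x) + 2 * g (x \<bullet> x) * g' (x \<bullet> x) * (G x \<bullet> G x) \<partial>lborel) = 0"
proof -
  define Y where "Y x = g (x \<bullet> x) *\<^sub>R G x" for x :: 'a
  define Y' where "Y' x w = (2 * g' (x \<bullet> x) * (x \<bullet> w)) *\<^sub>R G x + g (x \<bullet> x) *\<^sub>R H x w" for x w :: 'a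
  have C: "C1c (\<lambda>x. Y x \<bullet> e) (\<lambda>x a. Y' x a \<bullet> e)" for e
  proof (rule C1cI_away_from_0[of _ _ "sqrt a" "sqrt (max 0 b)"])
    fix x :: 'a assume x: "x \<noteq> 0"
    have "(Y has_derivative (\<lambda>h. g (x \<bullet> x) *\<^sub>R H x h + (2 * g' (x \<bullet> x) * (x \<bullet> h)) *\<^sub>R G x)) (at x)"
      unfolding Y_def by (rule has_derivative_scaleR[OF cutoff_has_derivative G_has_derivative[OF x]])
    then have "((\<lambda>x. Y x \<bullet> e) has_derivative (\<lambda>h. (g (x \<bullet> x) *\<^sub>R H x h + (2 * g' (x \<bullet> x) * (x \<bullet> h)) *\<^sub>R G x) \<bullet> e)) (at x)"
      by (rule has_derivative_inner_left)
    then show "((\<lambda>x. Y x \<bullet> e) has_derivative (\<lambda>a. Y' x a \<bullet> e)) (at x)"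
      by (simp add: Y'_def add.commute)
  next
    fix w
    show "continuous_on (-{0}) (\<lambda>x. Y' x w \<bullet> e)"
      unfolding Y'_def
      by (intro continuous_intros continuous_on_H continuous_on_G continuous_on_compose2[OF g(2)]
           continuous_on_compose2[OF continuous_on_cutoff[of UNIV]]) auto
  qed (use ab cutoff_support cutoff_deriv_eq_0 in \<open>auto simp: Y_def Y'_def\<close>)
  \<comment> \<open>At the origin G and H are uncontrolled, but g and g' both vanish there.\<close>
  have nz: "g (x \<bullet> x) \<noteq> 0 \<or> g' (x \<bullet> x) \<noteq> 0 \<Longrightarrow> x \<noteq> 0" for x :: 'a
    using ab cutoff_deriv_eq_0[of 0] by auto
  have lin: "linear (Y' x)" for x
  proof (cases "x = 0")
    case True
    then have "Y' x = (\<lambda>_. 0)" using nz[of x] by (auto simp: Y'_def fun_eq_iff)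
    then show ?thesis by (auto intro!: linearI)
  next
    case False
    note l = linear_H[OF False]
    show ?thesis
      by (rule linearI) (auto simp: Y'_def linear_add[OF l] linear_scale[OF l] algebra_simps)
  qed
  have S2: "S2 (Y' x) = (g (x \<bullet> x))\<^sup>2 * S2 (H x) + 2 * g (x \<bullet> x) * g' (x \<bullet> x) * (G x \<bullet> G x)" for x
  proof (cases "x = 0")
    case True
    then have "Y' x = (\<lambda>_. 0)" using nz[of x] by (auto simp: Y'_def fun_eq_iff)
    moreover have "g 0 = 0" using ab(1,2) by simp
    ultimately show ?thesis using True by (simp add: S2_def ltrace_def)
  next
    case False
    define c d where "c = g (x \<bullet> x)" and "d = g' (x \<bullet> x)"
    note l = linear_H[OF False] and f = inner_G_self[OF False] H_self[OF False] inner_H[OF False]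
    have Y': "Y' x w = (2 * d * (x \<bullet> w)) *\<^sub>R G x + c *\<^sub>R H x w" for w by (simp add: Y'_def c_def d_def)
    have YY: "Y' x (Y' x w) = (- 2 * d * c * (G x \<bullet> w)) *\<^sub>R G x + (2 * c * d * (x \<bullet> w)) *\<^sub>R H x (G x) + c\<^sup>2 *\<^sub>R H x (H x w)" for w
    proof -
      define y where "y = Y' x w"
      have y: "y = (2 * d * (x \<bullet> w)) *\<^sub>R G x + c *\<^sub>R H x w" unfolding y_def by (rule Y')
      have "x \<bullet> y = - c * (G x \<bullet> w)"
        unfolding y using f(1) by (simp add: inner_add_right f(3) inner_commute[of x "G x"])
      moreover have "H x y = (2 * d * (x \<bullet> w)) *\<^sub>R H x (G x) + c *\<^sub>R H x (H x w)"
        unfolding y using l by (simp add: linear_add linear_scale)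
      moreover have "Y' x y = (2 * d * (x \<bullet> y)) *\<^sub>R G x + c *\<^sub>R H x y" by (rule Y')
      ultimately show ?thesis
        unfolding y_def[symmetric] by (simp add: algebra_simps power2_eq_square)
    qed
    have "ltrace (Y' x) = ltrace (\<lambda>w. (2 * d * (x \<bullet> w)) *\<^sub>R G x + c *\<^sub>R H x w)"
      by (rule arg_cong[of _ _ ltrace]) (rule ext, rule Y')
    also have "\<dots> = c * ltrace (H x)"
      using f(1) by (simp add: ltrace_add ltrace_scaleR ltrace_rank_one_scaled inner_commute[of x "G x"])
    finally have t1: "ltrace (Y' x) = c * ltrace (H x)" .
    have "ltrace (Y' x \<circ> Y' x) = ltrace (\<lambda>w. (- 2 * d * c * (G x \<bullet> w)) *\<^sub>R G x + (2 * c * d * (x \<bullet> w)) *\<^sub>R H x (G x) + c\<^sup>2 *\<^sub>R H x (H x w))"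
      unfolding o_def by (rule arg_cong[of _ _ ltrace]) (rule ext, rule YY)
    also have "\<dots> = - 2 * d * c * (G x \<bullet> G x) + 2 * c * d * (x \<bullet> H x (G x)) + c\<^sup>2 * ltrace (\<lambda>w. H x (H x w))"
      unfolding ltrace_add ltrace_scaleR ltrace_rank_one_scaled ..
    finally have t2: "ltrace (Y' x \<circ> Y' x) = - 4 * c * d * (G x \<bullet> G x) + c\<^sup>2 * ltrace (H x \<circ> H x)"
      by (simp add: f(3) o_def algebra_simps)
    show ?thesis
      unfolding S2_def t1 t2 c_def[symmetric] d_def[symmetric] by (simp add: field_simps power_mult_distrib)
  qed
  show "integrable lborel (\<lambda>x. (g (x \<bullet> x))\<^sup>2 * S2 (H x) + 2 * g (x \<bullet> x) * g' (x \<bullet> x) * (G x \<bullet> G x))"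
    "(\<integral>x. (g (x \<bullet> x))\<^sup>2 * S2 (H x) + 2 * g (x \<bullet> x) * g' (x \<bullet> x) * (G x \<bullet> G x) \<partial>lborel) = 0"
    using integral_S2_deriv_eq_0[of Y Y', OF C lin] unfolding S2 by auto
qed

text \<open>The divergence theorem for the radial field (g^2 / |x|^2) |G|^2 x, chosen so that its
  divergence contains the term 4 g g' |G|^2. The remaining coefficient n - 4 uses that |G|^2 is
  homogeneous of degree -2, which enters through G . H x = -|G|^2.\<close>

lemma cutoff_radial_identity:
  "integrable lborel (\<lambda>x. (4 * g (x \<bullet> x) * g' (x \<bullet> x) + (real DIM('a) - 4) * (g (x \<bullet> x))\<^sup>2 / (x \<bullet> x)) * (G x \<bullet> G x))"
  "(\<integral>x. (4 * g (x \<bullet> x) * g' (x \<bullet> x) + (real DIM('a) - 4) * (g (x \<bullet> x))\<^sup>2 / (x \<bullet> x)) * (G x \<bullet> G x) \<partial>lborel) = 0"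
proof -
  define w where "w q = (g q)\<^sup>2 / q" for q
  define w' where "w' q = 2 * g q * g' q / q - (g q)\<^sup>2 / q\<^sup>2" for q
  define Z where "Z x = (w (x \<bullet> x) * (G x \<bullet> G x)) *\<^sub>R x" for x :: 'a
  define Z' where "Z' x v = (2 * w' (x \<bullet> x) * (G x \<bullet> G x) * (x \<bullet> v)) *\<^sub>R x + (2 * w (x \<bullet> x) * (G x \<bullet> H x v)) *\<^sub>R x
     + (w (x \<bullet> x) * (G x \<bullet> G x)) *\<^sub>R v" for x v :: 'a
  have wd: "(w has_real_derivative w' q) (at q)" if "q \<noteq> 0" for q
    unfolding w_def w'_def using that
    by (auto intro!: derivative_eq_intros g(1) simp: field_simps power2_eq_square)
  have cw: "continuous_on (-{0}) w"
    unfolding w_def by (intro continuous_intros continuous_on_cutoff) auto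
  have cw': "continuous_on (-{0}) w'"
    unfolding w'_def by (intro continuous_intros continuous_on_cutoff continuous_on_subset[OF g(2)]) auto
  have C: "C1c (\<lambda>x. Z x \<bullet> e) (\<lambda>x a. Z' x a \<bullet> e)" for e
  proof (rule C1cI_away_from_0[of _ _ "sqrt a" "sqrt (max 0 b)"])
    fix x :: 'a assume x: "x \<noteq> 0"
    have "((\<lambda>x. w (x \<bullet> x)) has_derivative (\<lambda>h. w' (x \<bullet> x) * (2 * (x \<bullet> h)))) (at x)"
      using has_derivative_compose[OF inner_self_has_derivative wd[unfolded has_field_derivative_def]] x by simp
    moreover have "((\<lambda>x. G x \<bullet> G x) has_derivative (\<lambda>h. G x \<bullet> H x h + H x h \<bullet> G x)) (at x)"
      by (rule has_derivative_inner[OF G_has_derivative[OF x] G_has_derivative[OF x]])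
    ultimately have "((\<lambda>x. w (x \<bullet> x) * (G x \<bullet> G x)) has_derivative
       (\<lambda>h. w (x \<bullet> x) * (G x \<bullet> H x h + H x h \<bullet> G x) + w' (x \<bullet> x) * (2 * (x \<bullet> h)) * (G x \<bullet> G x))) (at x)"
      by (rule has_derivative_mult)
    from has_derivative_scaleR[OF this has_derivative_ident]
    have "(Z has_derivative (\<lambda>h. (w (x \<bullet> x) * (G x \<bullet> G x)) *\<^sub>R h +
       (w (x \<bullet> x) * (G x \<bullet> H x h + H x h \<bullet> G x) + w' (x \<bullet> x) * (2 * (x \<bullet> h)) * (G x \<bullet> G x)) *\<^sub>R x)) (at x)"
      unfolding Z_def .
    moreover have "(\<lambda>h. (w (x \<bullet> x) * (G x \<bullet> G x)) *\<^sub>R h +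
       (w (x \<bullet> x) * (G x \<bullet> H x h + H x h \<bullet> G x) + w' (x \<bullet> x) * (2 * (x \<bullet> h)) * (G x \<bullet> G x)) *\<^sub>R x) = Z' x"
      by (rule ext) (simp add: Z'_def inner_commute[of "H x _"] algebra_simps)
    ultimately have "(Z has_derivative Z' x) (at x)" by simp
    then show "((\<lambda>x. Z x \<bullet> e) has_derivative (\<lambda>a. Z' x a \<bullet> e)) (at x)"
      by (rule has_derivative_inner_left)
  next
    fix v
    have "continuous_on (-{0}) (\<lambda>x::'a. w (x \<bullet> x))" "continuous_on (-{0}) (\<lambda>x::'a. w' (x \<bullet> x))"
      by (auto intro!: continuous_on_compose2[OF cw] continuous_on_compose2[OF cw'] continuous_intros)
    then show "continuous_on (-{0}) (\<lambda>x. Z' x v \<bullet> e)"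
      unfolding Z'_def by (intro continuous_intros continuous_on_H continuous_on_G) auto
  qed (use ab cutoff_support cutoff_deriv_eq_0 in \<open>auto simp: Z_def Z'_def w_def w'_def\<close>)
  have tr: "ltrace (Z' x) = (4 * g (x \<bullet> x) * g' (x \<bullet> x) + (real DIM('a) - 4) * (g (x \<bullet> x))\<^sup>2 / (x \<bullet> x)) * (G x \<bullet> G x)" for x
  proof (cases "x = 0")
    case True
    then show ?thesis using ab(1,2) cutoff_deriv_eq_0[of 0] by (simp add: Z'_def ltrace_def w_def w'_def)
  next
    case False
    note l = linear_H[OF False]
    have "ltrace (Z' x) = 2 * w' (x \<bullet> x) * (G x \<bullet> G x) * (x \<bullet> x) + 2 * w (x \<bullet> x) * (G x \<bullet> H x x)
        + w (x \<bullet> x) * (G x \<bullet> G x) * real DIM('a)"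
    proof -
      have "ltrace (Z' x) = ltrace (\<lambda>v. (2 * w' (x \<bullet> x) * (G x \<bullet> G x) * (x \<bullet> v)) *\<^sub>R x + (2 * w (x \<bullet> x)) *\<^sub>R ((G x \<bullet> H x v) *\<^sub>R x)
         + (w (x \<bullet> x) * (G x \<bullet> G x)) *\<^sub>R v)"
        by (rule arg_cong[of _ _ ltrace]) (rule ext, simp add: Z'_def)
      then show ?thesis
        unfolding ltrace_add ltrace_scaleR ltrace_rank_one_scaled linear_ltrace_rank_one[OF l] ltrace_id .
    qed
    moreover have "x \<bullet> x \<noteq> 0" using False by simp
    ultimately show ?thesis
      by (simp add: w_def w'_def H_self[OF False] field_simps power2_eq_square)
  qed
  show "integrable lborel (\<lambda>x. (4 * g (x \<bullet> x) * g' (x \<bullet> x) + (real DIM('a) - 4) * (g (x \<bullet> x))\<^sup>2 / (x \<bullet> x)) * (G x \<bullet> G x))"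
    "(\<integral>x. (4 * g (x \<bullet> x) * g' (x \<bullet> x) + (real DIM('a) - 4) * (g (x \<bullet> x))\<^sup>2 / (x \<bullet> x)) * (G x \<bullet> G x) \<partial>lborel) = 0"
    using integral_ltrace_deriv_eq_0[of Z Z', OF C] unfolding tr by auto
qed

text \<open>Twice the first identity minus the second cancels g g' and leaves 2 S_2(H) against (n -
  4) |G|^2 / |x|^2. Replacing S_2(H) by the covariant S_2 minus the squared gradient turns n - 4
  into n - 2.\<close>

lemma cutoff_bochner:
  "(\<integral>x. (g (x \<bullet> x) / (x \<bullet> x))\<^sup>2 * (2 * S2 (sph_hess V (x /\<^sub>R norm x))
     - (real DIM('a) - 2) * (norm (sph_grad V (x /\<^sub>R norm x)))\<^sup>2) \<partial>lborel) = 0"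
proof -
  have eq: "(g (x \<bullet> x) / (x \<bullet> x))\<^sup>2 * (2 * S2 (sph_hess V (x /\<^sub>R norm x))
     - (real DIM('a) - 2) * (norm (sph_grad V (x /\<^sub>R norm x)))\<^sup>2) =
     2 * ((g (x \<bullet> x))\<^sup>2 * S2 (H x) + 2 * g (x \<bullet> x) * g' (x \<bullet> x) * (G x \<bullet> G x)) -
     (4 * g (x \<bullet> x) * g' (x \<bullet> x) + (real DIM('a) - 4) * (g (x \<bullet> x))\<^sup>2 / (x \<bullet> x)) * (G x \<bullet> G x)" for x
  proof (cases "x = 0")
    case True
    then show ?thesis using ab(1,2) by simp
  next
    case False
    define \<xi> where "\<xi> = x /\<^sub>R norm x"
    define q where "q = norm x"
    have q: "q > 0" and xi: "norm \<xi> = 1" "\<xi> \<noteq> 0" and x: "x = q *\<^sub>R \<xi>"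
      using False by (auto simp: q_def \<xi>_def)
    have xx: "x \<bullet> x = q\<^sup>2" by (simp add: q_def power2_norm_eq_inner)
    have GG: "G x \<bullet> G x = (norm (G \<xi>))\<^sup>2 / q\<^sup>2"
      unfolding x G_scaleR[OF xi(2) q] power2_norm_eq_inner by (simp add: divide_inverse power2_eq_square)
    have SS: "S2 (H x) = S2 (H \<xi>) / (q\<^sup>2 * q\<^sup>2)"
      unfolding x using S2_H_scaleR[OF xi(2) q] by (simp flip: power_add)
    show ?thesis
      unfolding \<xi>_def[symmetric] xx GG SS S2_sph_hess[OF xi(1)] sph_grad_eq[OF xi(1)]
      using q by (simp add: field_simps power2_eq_square)
  qed
  show ?thesis
    unfolding eq Bochner_Integration.integral_diff[OF integrable_mult_right[OF cutoff_S2_identity(1)] cutoff_radial_identity(1)]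
      integral_mult_right_zero cutoff_S2_identity(2) cutoff_radial_identity(2) by simp
qed

end

lemma continuous_on_sphere_S2: "continuous_on (sphere 0 1) (\<lambda>\<xi>. S2 (sph_hess V \<xi>))"
proof -
  have "continuous_on (sphere 0 1) (\<lambda>\<xi>. S2 (H \<xi>) + (norm (G \<xi>))\<^sup>2)"
    by (intro continuous_intros continuous_on_S2_H continuous_on_G) auto
  then show ?thesis by (rule continuous_on_eq) (auto simp: S2_sph_hess)
qed

lemma continuous_on_sphere_grad: "continuous_on (sphere 0 1) (sph_grad V)"
proof -
  have "continuous_on (sphere 0 1) G" by (rule continuous_on_G) auto
  then show ?thesis by (rule continuous_on_eq) (auto simp: sph_grad_eq)
qed

text \<open>The weights in the cutoff identity are made to converge to the indicator of the
  punctured unit ball, boundedly and with support in the ball; dominated convergence then gives the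
  sphere integral.\<close>

proposition bochner_sphere:
  "sph_integral (\<lambda>\<xi>. 2 * S2 (sph_hess V \<xi>) - (real DIM('a) - 2) * (norm (sph_grad V \<xi>))\<^sup>2) = 0"
proof -
  define f where "f \<xi> = 2 * S2 (sph_hess V \<xi>) - (real DIM('a) - 2) * (norm (sph_grad V \<xi>))\<^sup>2" for \<xi>
  have f: "continuous_on (sphere 0 1) f"
    unfolding f_def by (intro continuous_intros continuous_on_sphere_S2 continuous_on_sphere_grad)
  obtain B where B: "B \<ge> 0" "\<And>x. x \<noteq> 0 \<Longrightarrow> \<bar>f (x /\<^sub>R norm x)\<bar> \<le> B" using normalize_bounded[OF f] by metis
  \<comment> \<open>For positive k this vanishes for q up to 1/k and from 1 - 1/k on. For k at least
    4 it equals 1 between 2/k and 1 - 2/k.\<close>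
  define \<psi> where "\<psi> k q = smoothstep (real k * q - 1) * smoothstep (real k * (1 - q) - 1)" for k q
  define \<psi>' where "\<psi>' k q = (4 * max 0 (1 - (max 0 (real k * q - 1))\<^sup>2) * max 0 (real k * q - 1)) * real k * smoothstep (real k * (1 - q) - 1)
     + (4 * max 0 (1 - (max 0 (real k * (1 - q) - 1))\<^sup>2) * max 0 (real k * (1 - q) - 1)) * (- real k) * smoothstep (real k * q - 1)" for k q
  have i1: "((\<lambda>q. real k * q - 1) has_real_derivative real k) (at q)" for k q
    by (auto intro!: derivative_eq_intros)
  have i2: "((\<lambda>q. real k * (1 - q) - 1) has_real_derivative - real k) (at q)" for k q
    by (auto intro!: derivative_eq_intros)
  have \<psi>d: "(\<psi> k has_real_derivative \<psi>' k q) (at q)" for k q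
    unfolding \<psi>_def \<psi>'_def
    by (rule DERIV_mult[OF DERIV_chain2[OF smoothstep_deriv i1] DERIV_chain2[OF smoothstep_deriv i2]])
  have cs: "continuous_on UNIV smoothstep"
    by (rule DERIV_continuous_on[OF has_field_derivative_at_within[OF smoothstep_deriv]])
  have c1: "continuous_on UNIV (\<lambda>q. smoothstep (real k * q - 1))" for k
    by (rule continuous_on_compose2[OF cs _ subset_UNIV], intro continuous_intros)
  have c2: "continuous_on UNIV (\<lambda>q. smoothstep (real k * (1 - q) - 1))" for k
    by (rule continuous_on_compose2[OF cs _ subset_UNIV], intro continuous_intros)
  have \<psi>c: "continuous_on UNIV (\<psi> k)" for k
    unfolding \<psi>_def by (rule continuous_on_mult[OF c1 c2])
  have \<psi>c': "continuous_on UNIV (\<psi>' k)" for k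
    unfolding \<psi>'_def
    by (rule continuous_on_add[OF continuous_on_mult[OF _ c2] continuous_on_mult[OF _ c1]], intro continuous_intros, intro continuous_intros)
  have zero: "(\<integral>x. (\<psi> k (x \<bullet> x))\<^sup>2 * f (x /\<^sub>R norm x) \<partial>lborel) = 0" if k: "k > 0" for k
  proof -
    have "(\<integral>x. (x \<bullet> x * \<psi> k (x \<bullet> x) / (x \<bullet> x))\<^sup>2 * (2 * S2 (sph_hess V (x /\<^sub>R norm x))
     - (real DIM('a) - 2) * (norm (sph_grad V (x /\<^sub>R norm x)))\<^sup>2) \<partial>lborel) = 0"
    \<comment> \<open>With g(q) = q times the k-th weight, the factor (g(q) / q)^2 in the identity
      becomes the square of that weight.\<close>
    proof (rule cutoff_bochner[of "\<lambda>q. q * \<psi> k q" "\<lambda>q. 1 * \<psi> k q + \<psi>' k q * q" "1 / real k" 1])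
      show "((\<lambda>q. q * \<psi> k q) has_real_derivative 1 * \<psi> k q + \<psi>' k q * q) (at q)" for q
        by (rule DERIV_mult[OF DERIV_ident \<psi>d])
      show "continuous_on UNIV (\<lambda>q. 1 * \<psi> k q + \<psi>' k q * q)"
        by (intro continuous_on_add continuous_on_mult continuous_on_const continuous_on_id \<psi>c \<psi>c')
      fix q :: real
      show "q * \<psi> k q = 0" if "q < 1 / real k"
        using that k by (simp add: \<psi>_def smoothstep_0 field_simps)
      show "q * \<psi> k q = 0" if "q > 1"
      proof -
        have "real k * (1 - q) \<le> 0" using that k by (simp add: mult_nonneg_nonpos)
        then show ?thesis by (simp add: \<psi>_def smoothstep_0)
      qed
    qed (use k in auto)
    also have "(\<lambda>x. (x \<bullet> x * \<psi> k (x \<bullet> x) / (x \<bullet> x))\<^sup>2 * (2 * S2 (sph_hess V (x /\<^sub>R norm x))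
     - (real DIM('a) - 2) * (norm (sph_grad V (x /\<^sub>R norm x)))\<^sup>2)) = (\<lambda>x. (\<psi> k (x \<bullet> x))\<^sup>2 * f (x /\<^sub>R norm x))"
      by (auto simp: fun_eq_iff f_def \<psi>_def smoothstep_0)
    finally show ?thesis .
  qed
  have "(\<lambda>k. \<integral>x. (\<psi> k (x \<bullet> x))\<^sup>2 * f (x /\<^sub>R norm x) \<partial>lborel) \<longlonglongrightarrow>
      (\<integral>x. indicator (ball 0 1 - {0}) x *\<^sub>R f (x /\<^sub>R norm x) \<partial>lborel)"
  proof (rule integral_dominated_convergence[where w = "\<lambda>x. indicator (ball 0 1) x *\<^sub>R B"])
    show "(\<lambda>x. indicator (ball 0 1 - {0}) x *\<^sub>R f (x /\<^sub>R norm x)) \<in> borel_measurable lborel"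
      using integrable_normalize(1)[OF f] by (simp add: set_integrable_def)
    show "(\<lambda>x. (\<psi> k (x \<bullet> x))\<^sup>2 * f (x /\<^sub>R norm x)) \<in> borel_measurable lborel" for k
    proof -
      have "continuous_on UNIV (\<lambda>x::'a. (\<psi> k (x \<bullet> x))\<^sup>2)"
        by (intro continuous_intros continuous_on_compose2[OF \<psi>c]) auto
      then have "(\<lambda>x::'a. (\<psi> k (x \<bullet> x))\<^sup>2) \<in> borel_measurable borel"
        by (rule borel_measurable_continuous_onI)
      then have "(\<lambda>x. (\<psi> k (x \<bullet> x))\<^sup>2 * (indicator (-{0}) x *\<^sub>R f (x /\<^sub>R norm x))) \<in> borel_measurable borel"
        using borel_measurable_normalize[OF f] by (rule borel_measurable_times)
      also have "(\<lambda>x. (\<psi> k (x \<bullet> x))\<^sup>2 * (indicator (-{0}) x *\<^sub>R f (x /\<^sub>R norm x))) = (\<lambda>x. (\<psi> k (x \<bullet> x))\<^sup>2 * f (x /\<^sub>R norm x))"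
        by (auto simp: fun_eq_iff indicator_def \<psi>_def smoothstep_0)
      finally show ?thesis by simp
    qed
    show "integrable lborel (\<lambda>x::'a. indicator (ball 0 1) x *\<^sub>R B)"
      by (rule integrableI_bounded_set_indicator[where B = B])
         (use B in \<open>auto simp: emeasure_lborel_ball_finite[unfolded infinity_ennreal_def]\<close>)
    show "AE x in lborel. (\<lambda>k. (\<psi> k (x \<bullet> x))\<^sup>2 * f (x /\<^sub>R norm x)) \<longlonglongrightarrow> indicator (ball 0 1 - {0}) x *\<^sub>R f (x /\<^sub>R norm x)"
    proof (rule AE_I2, rule tendsto_eventually)
      fix x :: 'a
      consider "x = 0" | "x \<noteq> 0" "norm x < 1" | "norm x \<ge> 1" by linarith
      then show "\<forall>\<^sub>F k in sequentially. (\<psi> k (x \<bullet> x))\<^sup>2 * f (x /\<^sub>R norm x) = indicator (ball 0 1 - {0}) x *\<^sub>R f (x /\<^sub>R norm x)"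
      proof cases
        case 1
        then show ?thesis by (simp add: \<psi>_def smoothstep_0)
      next
        case 2
        define q where "q = x \<bullet> x"
        have q: "0 < q" "q < 1" using 2 by (auto simp: q_def norm_lt_square[symmetric] norm_eq_sqrt_inner)
        obtain N where N: "real N \<ge> 2 / q" "real N \<ge> 2 / (1 - q)"
          by (metis max.bounded_iff real_arch_simple)
        have "\<forall>\<^sub>F k in sequentially. k \<ge> N" by (rule eventually_ge_at_top)
        then show ?thesis
        proof eventually_elim
          case (elim k)
          have "real k \<ge> 2 / q" "real k \<ge> 2 / (1 - q)" using N elim by linarith+
          then have "real k * q - 1 \<ge> 1" "real k * (1 - q) - 1 \<ge> 1"
            using q by (simp_all add: divide_le_eq)
          then have "\<psi> k q = 1" by (simp add: \<psi>_def smoothstep_1)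
          then show ?case using 2 by (simp add: q_def)
        qed
      next
        case 3
        have "x \<bullet> x \<ge> 1" using 3 power_mono[of 1 "norm x" 2] by (simp add: power2_norm_eq_inner)
        then have le: "real k * (1 - x \<bullet> x) \<le> 0" for k by (simp add: mult_nonneg_nonpos)
        have "smoothstep (real k * (1 - x \<bullet> x) - 1) = 0" for k
          using le[of k] by (intro smoothstep_0) linarith
        then show ?thesis using 3 by (simp add: \<psi>_def)
      qed
    qed
    show "AE x in lborel. norm ((\<psi> k (x \<bullet> x))\<^sup>2 * f (x /\<^sub>R norm x)) \<le> indicator (ball 0 1) x *\<^sub>R B" for k
    proof (rule AE_I2)
      fix x :: 'a
      consider "x = 0" | "x \<noteq> 0" "norm x < 1" | "norm x \<ge> 1" by linarith
      then show "norm ((\<psi> k (x \<bullet> x))\<^sup>2 * f (x /\<^sub>R norm x)) \<le> indicator (ball 0 1) x *\<^sub>R B"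
      proof cases
        case 1
        then show ?thesis using B by (simp add: \<psi>_def smoothstep_0)
      next
        case 2
        have "0 \<le> \<psi> k (x \<bullet> x)" "\<psi> k (x \<bullet> x) \<le> 1"
          unfolding \<psi>_def by (auto intro!: mult_nonneg_nonneg mult_le_one smoothstep_bounds)
        then have "(\<psi> k (x \<bullet> x))\<^sup>2 \<le> 1" by (simp add: power_le_one)
        then have "(\<psi> k (x \<bullet> x))\<^sup>2 * \<bar>f (x /\<^sub>R norm x)\<bar> \<le> 1 * B"
          using B 2 by (intro mult_mono) auto
        then show ?thesis using 2 by (simp add: abs_mult)
      next
        case 3
        have "x \<bullet> x \<ge> 1" using 3 power_mono[of 1 "norm x" 2] by (simp add: power2_norm_eq_inner)
        then have le: "real k * (1 - x \<bullet> x) \<le> 0" for k by (simp add: mult_nonneg_nonpos)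
        have "smoothstep (real k * (1 - x \<bullet> x) - 1) = 0" for k
          using le[of k] by (intro smoothstep_0) linarith
        then show ?thesis using 3 by (simp add: \<psi>_def)
      qed
    qed
  qed
  moreover have "(\<lambda>k. \<integral>x. (\<psi> k (x \<bullet> x))\<^sup>2 * f (x /\<^sub>R norm x) \<partial>lborel) \<longlonglongrightarrow> 0"
    by (rule tendsto_eventually) (use zero in \<open>auto intro: eventually_mono[OF eventually_gt_at_top[of 0]]\<close>)
  ultimately have "(\<integral>x. indicator (ball 0 1 - {0}) x *\<^sub>R f (x /\<^sub>R norm x) \<partial>lborel) = 0"
    by (rule LIMSEQ_unique)
  then show ?thesis
    using integrable_normalize(3)[OF f] by (simp add: sph_integral_def f_def set_lebesgue_integral_def)
qed

end

section \<open>Expansion of the support function\<close>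

lemma continuous_on_sphere_C2: "C2_sphere V \<Longrightarrow> continuous_on (sphere 0 1) V"
proof -
  assume C2: "C2_sphere V"
  have "continuous_on (sphere 0 1) (hext V)"
  proof (rule differentiable_imp_continuous_on, rule differentiable_at_imp_differentiable_on)
    fix x :: 'a assume "x \<in> sphere 0 1"
    then have "x \<noteq> 0" by auto
    then show "hext V differentiable (at x)" using C2 by (simp add: C2_sphere_def)
  qed
  then show ?thesis by (rule continuous_on_eq) (auto simp: hext_def)
qed

text \<open>If the unit vectors are at distance at most 1, the segment between them stays in the
  shell from radius 1/2 to 1, where the Hessian of the extension is bounded. If they are farther
  apart, the squared distance is at least 1 and sup bounds for V and its gradient suffice.\<close>

lemma (in C2_sphere_fun) taylor_sphere:
  "\<exists>C\<ge>0. \<forall>\<xi> u. norm \<xi> = 1 \<longrightarrow> norm u = 1 \<longrightarrow>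
     \<bar>V \<xi> - V u - sph_grad V u \<bullet> (\<xi> - u)\<bar> \<le> C * (norm (\<xi> - u))\<^sup>2"
proof -
  define K where "K = cball (0::'a) 1 - ball 0 (1 / 2)"
  have K: "compact K" unfolding K_def by (intro compact_diff compact_cball open_ball)
  have K0: "K \<subseteq> -{0}" by (auto simp: K_def)
  have "bounded ((\<lambda>x. \<Sum>b\<in>Basis. norm (H x b)) ` K)"
    by (intro compact_imp_bounded compact_continuous_image K continuous_intros continuous_on_H K0)
  then obtain B where B: "B > 0" "\<forall>y\<in>(\<lambda>x. \<Sum>b\<in>Basis. norm (H x b)) ` K. norm y \<le> B"
    unfolding bounded_pos by blast
  have HB: "norm (H x w) \<le> B * norm w" if x: "x \<in> K" for x w
  proof -
    have l: "linear (H x)" using x K0 by (intro linear_H) auto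
    have eq: "H x w = (\<Sum>b\<in>Basis. (w \<bullet> b) *\<^sub>R H x b)"
      using arg_cong[OF euclidean_representation[of w], of "H x"] l by (simp add: linear_sum linear_scale)
    have "norm (H x w) \<le> (\<Sum>b\<in>Basis. norm ((w \<bullet> b) *\<^sub>R H x b))" unfolding eq by (rule norm_sum)
    also have "\<dots> \<le> (\<Sum>b\<in>Basis. norm w * norm (H x b))"
      by (intro sum_mono) (simp add: Basis_le_norm mult_right_mono)
    also have "\<dots> = norm w * (\<Sum>b\<in>Basis. norm (H x b))" by (simp add: sum_distrib_left)
    also have "\<dots> \<le> norm w * B" using B x by (intro mult_left_mono) auto
    finally show ?thesis by (simp add: mult.commute)
  qed
  have "bounded (V ` sphere 0 1)"
    by (intro compact_imp_bounded compact_continuous_image continuous_on_sphere_C2 C2 compact_sphere)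
  then obtain B0 where "B0 > 0" "\<forall>y\<in>V ` sphere 0 1. norm y \<le> B0" unfolding bounded_pos by blast
  then have B0: "B0 > 0" "\<And>x. norm x = 1 \<Longrightarrow> \<bar>V x\<bar> \<le> B0" by auto
  have "bounded (G ` sphere 0 1)"
    by (intro compact_imp_bounded compact_continuous_image continuous_on_G compact_sphere) auto
  then obtain B1 where "B1 > 0" "\<forall>y\<in>G ` sphere 0 1. norm y \<le> B1" unfolding bounded_pos by blast
  then have B1: "B1 > 0" "\<And>x. norm x = 1 \<Longrightarrow> norm (G x) \<le> B1" by auto
  have "\<bar>V \<xi> - V u - G u \<bullet> (\<xi> - u)\<bar> \<le> (B + 2 * B0 + B1) * (norm (\<xi> - u))\<^sup>2"
    if xi: "norm \<xi> = 1" and u: "norm u = 1" for \<xi> u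
  proof (cases "norm (\<xi> - u) \<le> 1")
    case True
    define d where "d = norm (\<xi> - u)"
    define S where "S = closed_segment u \<xi>"
    have SK: "S \<subseteq> K"
    proof
      fix x assume x: "x \<in> S"
      then obtain s where s: "0 \<le> s" "s \<le> 1" "x = (1 - s) *\<^sub>R u + s *\<^sub>R \<xi>"
        by (auto simp: S_def in_segment)
      have xu: "x - u = s *\<^sub>R (\<xi> - u)" "x - \<xi> = - ((1 - s) *\<^sub>R (\<xi> - u))"
        using s(3) by (simp_all add: algebra_simps)
      have "norm x \<ge> 1 / 2"
      proof (cases "s \<le> 1 / 2")
        case T: True
        have "norm (x - u) = s * norm (\<xi> - u)" using s unfolding xu by simp
        also have "\<dots> \<le> 1 / 2 * 1" using T s True by (intro mult_mono) auto
        finally show ?thesis using norm_triangle_ineq2[of u "u - x"] u by (simp add: norm_minus_commute)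
      next
        case F: False
        have "norm (x - \<xi>) = (1 - s) * norm (\<xi> - u)" using s unfolding xu by simp
        also have "\<dots> \<le> 1 / 2 * 1" using F s True by (intro mult_mono) auto
        finally show ?thesis using norm_triangle_ineq2[of \<xi> "\<xi> - x"] xi by (simp add: norm_minus_commute)
      qed
      moreover have "norm x \<le> 1"
      proof -
        have "S \<subseteq> cball 0 1" unfolding S_def using xi u by (intro closed_segment_subset convex_cball) auto
        then show ?thesis using x by auto
      qed
      ultimately show "x \<in> K" by (simp add: K_def)
    qed
    have nz: "x \<noteq> 0" if "x \<in> S" for x using that SK K0 by auto
    have cS: "convex S" "u \<in> S" "\<xi> \<in> S" by (auto simp: S_def)
    have lip: "norm (G x - G u) \<le> B * d" if x: "x \<in> S" for x
    proof -
      have "norm (G x - G u) \<le> B * norm (x - u)"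
      proof (rule differentiable_bound[OF cS(1) _ _ x cS(2)])
        show "(G has_derivative H y) (at y within S)" if "y \<in> S" for y
          using G_has_derivative[OF nz[OF that]] by (rule has_derivative_at_withinI)
        show "onorm (H y) \<le> B" if "y \<in> S" for y
          using HB SK that by (intro onorm_le) auto
      qed
      also have "\<dots> \<le> B * d"
        using x B(1) segment_bound(1)[of x u \<xi>] by (intro mult_left_mono) (auto simp: S_def d_def norm_minus_commute)
      finally show ?thesis .
    qed
    \<comment> \<open>Second application of the mean value inequality: after subtracting the linear
      part at u, the gradient along the segment is at most B d by the first one.\<close>
    have "norm ((hext V \<xi> - G u \<bullet> \<xi>) - (hext V u - G u \<bullet> u)) \<le> (B * d) * norm (\<xi> - u)"
    proof (rule differentiable_bound[OF cS(1) _ _ cS(3) cS(2)])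
      fix x assume x: "x \<in> S"
      have "((\<lambda>x. hext V x - G u \<bullet> x) has_derivative (\<lambda>w. G x \<bullet> w - G u \<bullet> w)) (at x)"
        by (rule has_derivative_diff[OF hext_has_derivative[OF nz[OF x]] has_derivative_inner_right[OF has_derivative_ident]])
      then show "((\<lambda>x. hext V x - G u \<bullet> x) has_derivative (\<lambda>w. G x \<bullet> w - G u \<bullet> w)) (at x within S)"
        by (rule has_derivative_at_withinI)
      show "onorm (\<lambda>w. G x \<bullet> w - G u \<bullet> w) \<le> B * d"
      proof (rule onorm_le)
        fix w
        have "norm (G x \<bullet> w - G u \<bullet> w) \<le> norm (G x - G u) * norm w"
          using Cauchy_Schwarz_ineq2[of "G x - G u" w] by (simp add: inner_diff_left)
        also have "\<dots> \<le> (B * d) * norm w" using lip[OF x] by (intro mult_right_mono) auto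
        finally show "norm (G x \<bullet> w - G u \<bullet> w) \<le> (B * d) * norm w" .
      qed
    qed
    moreover have "hext V \<xi> = V \<xi>" "hext V u = V u" using xi u by (auto simp: hext_def)
    ultimately have "\<bar>V \<xi> - V u - G u \<bullet> (\<xi> - u)\<bar> \<le> B * d\<^sup>2"
      by (simp add: d_def inner_diff_right power2_eq_square algebra_simps)
    also have "\<dots> \<le> (B + 2 * B0 + B1) * d\<^sup>2" using B0 B1 by (intro mult_right_mono) auto
    finally show ?thesis by (simp add: d_def)
  next
    case False
    define d where "d = norm (\<xi> - u)"
    have d: "d \<ge> 1" "d \<le> d\<^sup>2" "1 \<le> d\<^sup>2"
      using False self_le_power[of d 2] one_le_power[of d 2] by (auto simp: d_def)
    have "\<bar>G u \<bullet> (\<xi> - u)\<bar> \<le> norm (G u) * d" unfolding d_def by (rule Cauchy_Schwarz_ineq2)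
    also have "\<dots> \<le> B1 * d\<^sup>2" using B1 u d by (intro mult_mono) auto
    finally have "\<bar>V \<xi> - V u - G u \<bullet> (\<xi> - u)\<bar> \<le> 2 * B0 * 1 + B1 * d\<^sup>2"
      using B0(2)[OF xi] B0(2)[OF u] by linarith
    also have "\<dots> \<le> 2 * B0 * d\<^sup>2 + B1 * d\<^sup>2"
      using B0 d by (intro add_right_mono mult_left_mono) auto
    also have "\<dots> \<le> (B + 2 * B0 + B1) * d\<^sup>2" using B(1) by (simp add: algebra_simps)
    finally show ?thesis by (simp add: d_def)
  qed
  then show ?thesis using B(1) B0 B1
    by (intro exI[of _ "B + 2 * B0 + B1"]) (auto simp: sph_grad_eq)
qed

text \<open>With d = |\<xi> - u| one has \<xi> . u = 1 - d^2/2, while moving from u to \<xi> gains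
  at most about |t| |g| d in the radius. The maximum of |t| |g| d - d^2/2 over d is t^2 |g|^2 / 2,
  the gradient term of the expansion. The smallness 16 D |t| at most 1 keeps the errors quadratic in
  d below the concave term.\<close>

lemma support_expansion_upper:
  fixes V A R :: "'a::euclidean_space \<Rightarrow> real" and g u \<xi> :: 'a
  assumes xi: "norm \<xi> = 1" and u: "norm u = 1" and D: "D \<ge> 1" "\<bar>V \<xi>\<bar> \<le> D" "\<bar>A \<xi>\<bar> \<le> D" "norm g \<le> D"
    and T: "\<bar>V \<xi> - V u - g \<bullet> (\<xi> - u)\<bar> \<le> D * (norm (\<xi> - u))\<^sup>2"
    and L: "\<bar>A \<xi> - A u\<bar> \<le> D * norm (\<xi> - u)"
    and R: "\<bar>R \<xi> - (1 + t * V \<xi> + t\<^sup>2 / 2 * A \<xi>)\<bar> \<le> e * t\<^sup>2"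
    and e: "0 \<le> e" "e \<le> 1" and t: "16 * D * \<bar>t\<bar> \<le> 1"
  shows "R \<xi> * (\<xi> \<bullet> u) \<le> 1 + t * V u + t\<^sup>2 / 2 * (A u + (norm g)\<^sup>2) + e * t\<^sup>2 + 6 * D ^ 4 * \<bar>t\<bar> ^ 3"
proof -
  define b where "b = \<bar>t\<bar>"
  define d where "d = norm (\<xi> - u)"
  define a where "a = norm g"
  define q where "q = R \<xi> - 1"
  have b0: "0 \<le> b" and a0: "0 \<le> a" and d0: "0 \<le> d" by (auto simp: b_def a_def d_def)
  have t2: "t\<^sup>2 = b\<^sup>2" by (simp add: b_def)
  have Db: "D * b \<le> 1 / 16" using t by (simp add: b_def)
  have "1 * b \<le> D * b" using D(1) b0 by (rule mult_right_mono)
  then have b1: "b \<le> 1 / 16" using Db by simp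
  have bb: "b\<^sup>2 \<le> b" using b0 b1 by (simp add: power2_eq_square mult_left_le)
  have bD: "b \<le> D * b" using \<open>1 * b \<le> D * b\<close> by simp
  have xu: "\<xi> \<bullet> u = 1 - d\<^sup>2 / 2"
  proof -
    have "d\<^sup>2 = \<xi> \<bullet> \<xi> - 2 * (\<xi> \<bullet> u) + u \<bullet> u"
      unfolding d_def power2_norm_eq_inner by (simp add: inner_diff_left inner_diff_right inner_commute)
    then have "d\<^sup>2 = 2 - 2 * (\<xi> \<bullet> u)" using xi u by (simp add: power2_norm_eq_inner[symmetric])
    then show ?thesis by linarith
  qed
  have tA: "\<bar>t\<^sup>2 / 2 * A \<xi>\<bar> \<le> b\<^sup>2 / 2 * D"
    unfolding t2 abs_mult using D by (simp add: mult_left_mono)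
  have tV: "\<bar>t * V \<xi>\<bar> \<le> b * D" unfolding abs_mult b_def using D by (intro mult_left_mono) auto
  have q1: "\<bar>q\<bar> \<le> 3 * (D * b)"
  proof -
    have "e * b\<^sup>2 \<le> 1 * b" using e bb b0 by (intro mult_mono) auto
    moreover have "b\<^sup>2 / 2 * D \<le> b / 2 * D" using bb D by (intro mult_right_mono) auto
    ultimately show ?thesis
      using R tA tV bD unfolding q_def t2 by (simp add: mult.commute abs_le_iff)
  qed
  have main: "q \<le> t * V u + b * a * d + D * b * d\<^sup>2 + b\<^sup>2 / 2 * A u + b\<^sup>2 / 2 * (D * d) + e * b\<^sup>2"
  proof -
    have "t * (V \<xi> - V u - g \<bullet> (\<xi> - u)) \<le> b * (D * d\<^sup>2)"
    proof -
      have "t * (V \<xi> - V u - g \<bullet> (\<xi> - u)) \<le> b * \<bar>V \<xi> - V u - g \<bullet> (\<xi> - u)\<bar>"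
        unfolding b_def abs_mult[symmetric] by (rule abs_ge_self)
      also have "\<dots> \<le> b * (D * d\<^sup>2)" using T b0 by (intro mult_left_mono) (auto simp: d_def)
      finally show ?thesis .
    qed
    moreover have "t * (g \<bullet> (\<xi> - u)) \<le> b * (a * d)"
    proof -
      have "t * (g \<bullet> (\<xi> - u)) \<le> b * \<bar>g \<bullet> (\<xi> - u)\<bar>"
        unfolding b_def abs_mult[symmetric] by (rule abs_ge_self)
      also have "\<dots> \<le> b * (a * d)"
        unfolding a_def d_def using b0 Cauchy_Schwarz_ineq2 by (intro mult_left_mono) auto
      finally show ?thesis .
    qed
    moreover have "b\<^sup>2 / 2 * (A \<xi> - A u) \<le> b\<^sup>2 / 2 * (D * d)"
      using L by (intro mult_left_mono) (auto simp: d_def)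
    ultimately show ?thesis using R unfolding q_def t2 by (simp add: algebra_simps abs_le_iff)
  qed
  have "R \<xi> * (\<xi> \<bullet> u) = 1 + q - d\<^sup>2 / 2 - q * (d\<^sup>2 / 2)"
    unfolding xu q_def by (simp add: field_simps)
  also have "\<dots> \<le> 1 + q - d\<^sup>2 / 2 + 3 * (D * b) * (d\<^sup>2 / 2)"
  proof -
    have "- q * (d\<^sup>2 / 2) \<le> 3 * (D * b) * (d\<^sup>2 / 2)" using q1 by (intro mult_right_mono) auto
    then show ?thesis by simp
  qed
  finally have 1: "R \<xi> * (\<xi> \<bullet> u) \<le> 1 + q - d\<^sup>2 / 2 + 3 * (D * b) * (d\<^sup>2 / 2)" .
  \<comment> \<open>Completing the square: y measures how far \<xi> is from the optimal distance |t|
    |g|, and -y^2/2 is available to absorb errors.\<close>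
  define y where "y = d - b * a"
  have dy: "d = y + b * a" by (simp add: y_def)
  have sq: "b * a * d - d\<^sup>2 / 2 = b\<^sup>2 / 2 * a\<^sup>2 - y\<^sup>2 / 2"
    unfolding dy by (simp add: power2_eq_square algebra_simps)
  \<comment> \<open>The factor 5/2 collects D b d^2 from the Taylor remainder of V and 3 D b d^2 / 2
    from the product of R - 1 with d^2/2.\<close>
  have p1: "5 / 2 * (D * b) * d\<^sup>2 \<le> 5 / 16 * y\<^sup>2 + 5 * (D ^ 4 * b ^ 3)"
  proof -
    have "d\<^sup>2 \<le> 2 * y\<^sup>2 + 2 * (b * a)\<^sup>2"
      unfolding dy using zero_le_power2[of "y - b * a"] by (simp add: power2_eq_square algebra_simps)
    then have "5 / 2 * (D * b) * d\<^sup>2 \<le> 5 / 2 * (D * b) * (2 * y\<^sup>2 + 2 * (b * a)\<^sup>2)"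
      using D b0 by (intro mult_left_mono) auto
    also have "\<dots> = 5 * (D * b) * y\<^sup>2 + 5 * (D * b ^ 3) * a\<^sup>2"
      by (simp add: algebra_simps power2_eq_square power3_eq_cube)
    also have "5 * (D * b) * y\<^sup>2 \<le> 5 * (1 / 16) * y\<^sup>2" using Db by (intro mult_right_mono) auto
    also have "5 * (D * b ^ 3) * a\<^sup>2 \<le> 5 * (D * b ^ 3) * D ^ 3"
    proof (rule mult_left_mono)
      have "a\<^sup>2 \<le> D\<^sup>2" using D a0 by (intro power_mono) (auto simp: a_def)
      also have "\<dots> \<le> D ^ 3" using D by (intro power_increasing) auto
      finally show "a\<^sup>2 \<le> D ^ 3" .
    qed (use D b0 in auto)
    also have "5 * (D * b ^ 3) * D ^ 3 = 5 * (D ^ 4 * b ^ 3)"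
      by (simp add: power3_eq_cube power4_eq_xxxx)
    finally show ?thesis by simp
  qed
  have p2: "b\<^sup>2 / 2 * (D * d) \<le> y\<^sup>2 / 8 + D ^ 4 * b ^ 3"
  proof -
    have "b\<^sup>2 / 2 * (D * d) = (b\<^sup>2 * D / 2) * y + b ^ 3 * (D * a) / 2"
      unfolding dy by (simp add: algebra_simps power2_eq_square power3_eq_cube)
    moreover have "(b\<^sup>2 * D / 2) * y \<le> y\<^sup>2 / 8 + 2 * (b\<^sup>2 * D / 2)\<^sup>2"
      using zero_le_power2[of "y - 4 * (b\<^sup>2 * D / 2)"] by (simp add: power2_eq_square algebra_simps)
    moreover have "2 * (b\<^sup>2 * D / 2)\<^sup>2 \<le> b ^ 3 * D\<^sup>2 / 2"
    proof -
      have "2 * (b\<^sup>2 * D / 2)\<^sup>2 = b * (b ^ 3 * D\<^sup>2 / 2)" by (simp add: power2_eq_square power3_eq_cube)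
      also have "\<dots> \<le> 1 * (b ^ 3 * D\<^sup>2 / 2)" using b1 b0 by (intro mult_right_mono) auto
      finally show ?thesis by simp
    qed
    moreover have "b ^ 3 * D\<^sup>2 / 2 \<le> b ^ 3 * D ^ 4 / 2"
      using D b0 by (intro divide_right_mono mult_left_mono power_increasing) auto
    moreover have "b ^ 3 * (D * a) / 2 \<le> b ^ 3 * D ^ 4 / 2"
    proof -
      have "D * a \<le> D * D" using D by (intro mult_left_mono) (auto simp: a_def)
      also have "\<dots> = D ^ 2" by (simp add: power2_eq_square)
      also have "\<dots> \<le> D ^ 4" using D by (intro power_increasing) auto
      finally show ?thesis using b0 by (intro divide_right_mono mult_left_mono) auto
    qed
    ultimately show ?thesis by (simp add: mult.commute)
  qed
  have "R \<xi> * (\<xi> \<bullet> u) \<le> 1 + (t * V u + b\<^sup>2 / 2 * A u + e * b\<^sup>2) + (b * a * d - d\<^sup>2 / 2) + 5 / 2 * (D * b) * d\<^sup>2 + b\<^sup>2 / 2 * (D * d)"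
    using 1 main by (simp add: algebra_simps)
  \<comment> \<open>The two errors consume 5/16 + 1/8 = 7/16 of y^2, less than the available 1/2.
    Their cubic parts, 5 and 1, add up to the constant 6.\<close>
  also have "\<dots> \<le> 1 + (t * V u + b\<^sup>2 / 2 * A u + e * b\<^sup>2) + b\<^sup>2 / 2 * a\<^sup>2 + 6 * (D ^ 4 * b ^ 3)"
    using p1 p2 zero_le_power2[of y] unfolding sq by linarith
  finally show ?thesis unfolding t2 by (simp add: a_def b_def algebra_simps add_divide_distrib)
qed

text \<open>The normalised vector u + t g is nearly optimal: it moves by about t g along the
  gradient. The slope of V then gains t^2 |g|^2 and the loss through \<xi> . u is t^2 |g|^2 / 2. The
  cubic errors add up to 5, rounded up to the constant of the upper bound.\<close>

lemma support_expansion_lower: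
  fixes V A R :: "'a::euclidean_space \<Rightarrow> real" and g u :: 'a
  assumes u: "norm u = 1" and gu: "g \<bullet> u = 0"
    and D: "D \<ge> 1" "\<And>\<xi>. norm \<xi> = 1 \<Longrightarrow> \<bar>V \<xi>\<bar> \<le> D" "\<And>\<xi>. norm \<xi> = 1 \<Longrightarrow> \<bar>A \<xi>\<bar> \<le> D" "norm g \<le> D"
    and T: "\<And>\<xi>. norm \<xi> = 1 \<Longrightarrow> \<bar>V \<xi> - V u - g \<bullet> (\<xi> - u)\<bar> \<le> D * (norm (\<xi> - u))\<^sup>2"
    and L: "\<And>\<xi>. norm \<xi> = 1 \<Longrightarrow> \<bar>A \<xi> - A u\<bar> \<le> D * norm (\<xi> - u)"
    and R: "\<And>\<xi>. norm \<xi> = 1 \<Longrightarrow> \<bar>R \<xi> - (1 + t * V \<xi> + t\<^sup>2 / 2 * A \<xi>)\<bar> \<le> e * t\<^sup>2"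
    and e: "0 \<le> e" "e \<le> 1" and t: "16 * D * \<bar>t\<bar> \<le> 1"
  shows "\<exists>\<xi>. norm \<xi> = 1 \<and> 1 + t * V u + t\<^sup>2 / 2 * (A u + (norm g)\<^sup>2) - e * t\<^sup>2 - 6 * D ^ 4 * \<bar>t\<bar> ^ 3 \<le> R \<xi> * (\<xi> \<bullet> u)"
proof -
  define b where "b = \<bar>t\<bar>"
  define a where "a = norm g"
  define s where "s = norm (u + t *\<^sub>R g)"
  define \<xi> where "\<xi> = (u + t *\<^sub>R g) /\<^sub>R s"
  define d where "d = norm (\<xi> - u)"
  define q where "q = R \<xi> - 1"
  have b0: "0 \<le> b" and a0: "0 \<le> a" and d0: "0 \<le> d" by (auto simp: b_def a_def d_def)
  have aD: "a \<le> D" using D by (simp add: a_def)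
  have t2: "t\<^sup>2 = b\<^sup>2" by (simp add: b_def)
  have Db: "D * b \<le> 1 / 16" using t by (simp add: b_def)
  have bD: "b \<le> D * b" using mult_right_mono[OF D(1) b0] by simp
  then have b1: "b \<le> 1 / 16" using Db by simp
  have bb: "b\<^sup>2 \<le> b" using b0 b1 by (simp add: power2_eq_square mult_left_le)
  have uu: "u \<bullet> u = 1" using u by (simp add: power2_norm_eq_inner[symmetric])
  have s2: "s\<^sup>2 = 1 + (b * a)\<^sup>2"
  proof -
    have "s\<^sup>2 = u \<bullet> u + 2 * t * (g \<bullet> u) + t\<^sup>2 * (g \<bullet> g)"
      unfolding s_def power2_norm_eq_inner
      by (simp add: inner_add_left inner_add_right inner_commute power2_eq_square algebra_simps)
    then show ?thesis using gu uu t2 by (simp add: a_def power2_norm_eq_inner power_mult_distrib)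
  qed
  have s1: "s \<ge> 1"
  proof (rule power2_le_imp_le)
    show "1\<^sup>2 \<le> s\<^sup>2" unfolding s2 by simp
  qed (simp add: s_def)
  \<comment> \<open>This is \<xi> . u. As g is orthogonal to u, the norm s is sqrt (1 + t^2 |g|^2),
    so 1 - v is at most t^2 |g|^2 / 2.\<close>
  define v where "v = 1 / s"
  have v: "0 < v" "v \<le> 1" using s1 by (auto simp: v_def)
  have v_lower: "1 - v \<le> (b * a)\<^sup>2 / 2"
  proof -
    have s: "s \<le> 1 + (b * a)\<^sup>2 / 2"
    proof (rule power2_le_imp_le)
      have "1 + x \<le> (1 + x / 2)\<^sup>2" for x :: real
        using zero_le_power2[of x] by (simp add: power2_eq_square algebra_simps)
      then show "s\<^sup>2 \<le> (1 + (b * a)\<^sup>2 / 2)\<^sup>2" unfolding s2 .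
    qed simp
    have "1 - v = v * (s - 1)" using s1 by (simp add: v_def field_simps)
    also have "\<dots> \<le> 1 * (s - 1)" using v s1 by (intro mult_right_mono) auto
    also have "\<dots> \<le> (b * a)\<^sup>2 / 2" using s by simp
    finally show ?thesis .
  qed
  have xi: "norm \<xi> = 1" using s1 unfolding \<xi>_def norm_scaleR s_def[symmetric] by simp
  have xi': "\<xi> = v *\<^sub>R (u + t *\<^sub>R g)" by (simp add: \<xi>_def v_def divide_inverse)
  have xu: "\<xi> \<bullet> u = v" unfolding xi' using gu uu by (simp add: inner_add_left)
  have gxi: "g \<bullet> (\<xi> - u) = t * v * a\<^sup>2"
    unfolding xi' using gu by (simp add: inner_diff_right inner_add_right a_def power2_norm_eq_inner)
  have d2: "d\<^sup>2 = 2 * (1 - v)"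
  proof -
    have "d\<^sup>2 = \<xi> \<bullet> \<xi> - 2 * (\<xi> \<bullet> u) + u \<bullet> u"
      unfolding d_def power2_norm_eq_inner by (simp add: inner_diff_left inner_diff_right inner_commute)
    then show ?thesis using xi uu xu by (simp add: power2_norm_eq_inner[symmetric])
  qed
  have d2': "d\<^sup>2 \<le> (b * a)\<^sup>2" using d2 v_lower by simp
  have d1: "d \<le> b * a" using a0 b0 by (intro power2_le_imp_le[OF d2']) simp
  have a2: "a\<^sup>2 \<le> D\<^sup>2" using aD a0 by (rule power_mono)
  have D23: "D\<^sup>2 \<le> D ^ 4" "D ^ 3 \<le> D ^ 4" using D(1) by (simp_all add: power_increasing)
  have b3: "0 \<le> b ^ 3" using b0 by simp
  have tA: "\<bar>t\<^sup>2 / 2 * A \<xi>\<bar> \<le> b\<^sup>2 / 2 * D"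
    using D(3)[OF xi] mult_left_mono[of "\<bar>A \<xi>\<bar>" D "b\<^sup>2 / 2"] by (simp add: t2 abs_mult)
  have tV: "\<bar>t * V \<xi>\<bar> \<le> b * D" unfolding abs_mult b_def using D(2)[OF xi] by (intro mult_left_mono) auto
  have q1: "\<bar>q\<bar> \<le> 3 * (D * b)"
  proof -
    have "e * b\<^sup>2 \<le> 1 * b" using e bb b0 by (intro mult_mono) auto
    moreover have "b\<^sup>2 / 2 * D \<le> b / 2 * D" using bb D by (intro mult_right_mono) auto
    ultimately show ?thesis
      using R[OF xi] tA tV bD unfolding q_def t2 by (simp add: mult.commute abs_le_iff)
  qed
  have main: "q \<ge> t * V u + b\<^sup>2 * (v * a\<^sup>2) + b\<^sup>2 / 2 * A u - b * (D * d\<^sup>2) - b\<^sup>2 / 2 * (D * d) - e * b\<^sup>2"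
  proof -
    have "- (b * (D * d\<^sup>2)) \<le> t * (V \<xi> - V u - g \<bullet> (\<xi> - u))"
    proof -
      have "- (t * (V \<xi> - V u - g \<bullet> (\<xi> - u))) \<le> b * \<bar>V \<xi> - V u - g \<bullet> (\<xi> - u)\<bar>"
        unfolding b_def abs_mult[symmetric] by (rule abs_ge_minus_self)
      also have "\<dots> \<le> b * (D * d\<^sup>2)" using T[OF xi] b0 by (intro mult_left_mono) (auto simp: d_def)
      finally show ?thesis by linarith
    qed
    moreover have "t * (g \<bullet> (\<xi> - u)) = b\<^sup>2 * (v * a\<^sup>2)"
      unfolding gxi t2[symmetric] by (simp add: power2_eq_square)
    moreover have "b\<^sup>2 / 2 * (A \<xi> - A u) \<ge> b\<^sup>2 / 2 * (- (D * d))"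
      using L[OF xi] by (intro mult_left_mono) (auto simp: d_def)
    ultimately show ?thesis using R[OF xi] unfolding q_def t2 by (simp add: algebra_simps abs_le_iff)
  qed
  have e1: "b\<^sup>2 * (v * a\<^sup>2) \<ge> b\<^sup>2 * a\<^sup>2 - D ^ 4 * b ^ 3"
  proof -
    have "b\<^sup>2 * a\<^sup>2 * (1 - v) \<le> b\<^sup>2 * a\<^sup>2 * ((b * a)\<^sup>2 / 2)" using v_lower by (intro mult_left_mono) auto
    also have "\<dots> = (b ^ 3 * (b / 2)) * (a\<^sup>2 * a\<^sup>2)" by (simp add: power2_eq_square power3_eq_cube)
    also have "\<dots> \<le> (b ^ 3 * 1) * (D\<^sup>2 * D\<^sup>2)"
      using a2 b0 b1 by (intro mult_mono) auto
    also have "\<dots> = D ^ 4 * b ^ 3" by (simp add: power2_eq_square power4_eq_xxxx)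
    finally show ?thesis by (simp add: algebra_simps)
  qed
  have e2: "b * (D * d\<^sup>2) \<le> D ^ 4 * b ^ 3"
  proof -
    have "b * (D * d\<^sup>2) \<le> b * (D * (b\<^sup>2 * D\<^sup>2))"
      using d2' a2 b0 D by (intro mult_left_mono order.trans[OF d2']) (auto simp: power_mult_distrib mult_left_mono)
    also have "\<dots> = D ^ 3 * b ^ 3" by (simp add: power2_eq_square power3_eq_cube)
    also have "\<dots> \<le> D ^ 4 * b ^ 3" using D23 b3 by (intro mult_right_mono) auto
    finally show ?thesis .
  qed
  have e3: "b\<^sup>2 / 2 * (D * d) \<le> D ^ 4 * b ^ 3"
  proof -
    have "b * a \<le> b * D" using aD b0 by (rule mult_left_mono)
    then have "b\<^sup>2 / 2 * (D * d) \<le> b\<^sup>2 * (D * (b * D))"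
      using d1 b0 D d0 by (intro mult_mono mult_left_mono) auto
    also have "\<dots> = D\<^sup>2 * b ^ 3" by (simp add: power2_eq_square power3_eq_cube)
    also have "\<dots> \<le> D ^ 4 * b ^ 3" using D23 b3 by (intro mult_right_mono) auto
    finally show ?thesis .
  qed
  have e4: "(1 + q) * (1 - v) \<le> b\<^sup>2 * a\<^sup>2 / 2 + 2 * (D ^ 4 * b ^ 3)"
  proof -
    have "(1 + q) * (1 - v) \<le> (1 + 3 * (D * b)) * ((b * a)\<^sup>2 / 2)"
      using q1 v v_lower D b0 by (intro mult_mono) auto
    also have "\<dots> = b\<^sup>2 * a\<^sup>2 / 2 + 3 / 2 * (D * b ^ 3 * a\<^sup>2)"
      by (simp add: power2_eq_square power3_eq_cube algebra_simps)
    also have "D * b ^ 3 * a\<^sup>2 \<le> D * b ^ 3 * D\<^sup>2" using a2 D b3 by (intro mult_left_mono) auto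
    also have "D * b ^ 3 * D\<^sup>2 = D ^ 3 * b ^ 3" by (simp add: power2_eq_square power3_eq_cube)
    also have "D ^ 3 * b ^ 3 \<le> D ^ 4 * b ^ 3" using D23 b3 by (intro mult_right_mono) auto
    finally have "(1 + q) * (1 - v) \<le> b\<^sup>2 * a\<^sup>2 / 2 + 3 / 2 * (D ^ 4 * b ^ 3)" by simp
    moreover have "0 \<le> D ^ 4 * b ^ 3" using D(1) b3 by simp
    ultimately show ?thesis by linarith
  qed
  have "R \<xi> * (\<xi> \<bullet> u) = (1 + q) - (1 + q) * (1 - v)"
    unfolding xu q_def by (simp add: algebra_simps)
  also have "\<dots> \<ge> 1 + t * V u + b\<^sup>2 / 2 * A u + b\<^sup>2 * a\<^sup>2 / 2 - e * b\<^sup>2 - 6 * (D ^ 4 * b ^ 3)"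
  proof -
    have "0 \<le> D ^ 4 * b ^ 3" using D(1) b3 by simp
    then show ?thesis using main e1 e2 e3 e4 by linarith
  qed
  finally have "1 + t * V u + t\<^sup>2 / 2 * (A u + (norm g)\<^sup>2) - e * t\<^sup>2 - 6 * D ^ 4 * \<bar>t\<bar> ^ 3 \<le> R \<xi> * (\<xi> \<bullet> u)"
    unfolding t2 by (simp add: a_def b_def algebra_simps add_divide_distrib)
  with xi show ?thesis by blast
qed

section \<open>Cone integrals: sphere integrals divided by n, the normalisation in which W_(n-1) is
  the integral of h\<close>

definition cone_integral :: "('a::euclidean_space \<Rightarrow> real) \<Rightarrow> real" where
  "cone_integral \<phi> = integral (ball 0 1) (\<lambda>x. \<phi> (x /\<^sub>R norm x))"

lemma sph_integral_eq: "sph_integral \<phi> = real DIM('a) * cone_integral \<phi>" for \<phi> :: "'a::euclidean_space \<Rightarrow> real"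
  by (simp add: sph_integral_def cone_integral_def)

lemma cone_integral_add:
  "continuous_on (sphere 0 1) \<phi> \<Longrightarrow> continuous_on (sphere 0 1) \<psi> \<Longrightarrow>
    cone_integral (\<lambda>\<xi>. \<phi> \<xi> + \<psi> \<xi>) = cone_integral \<phi> + cone_integral \<psi>"
  unfolding cone_integral_def by (intro integral_add integrable_normalize(2))

lemma cone_integral_diff:
  "continuous_on (sphere 0 1) \<phi> \<Longrightarrow> continuous_on (sphere 0 1) \<psi> \<Longrightarrow>
    cone_integral (\<lambda>\<xi>. \<phi> \<xi> - \<psi> \<xi>) = cone_integral \<phi> - cone_integral \<psi>"
  unfolding cone_integral_def by (intro integral_diff integrable_normalize(2))

lemma cone_integral_cmult: "cone_integral (\<lambda>\<xi>. c * \<phi> \<xi>) = c * cone_integral \<phi>"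
  unfolding cone_integral_def by (rule integral_mult_right)

lemma cone_integral_const: "cone_integral (\<lambda>_::'a::euclidean_space. c) = c * measure lebesgue (ball (0::'a) 1)"
  using integral_mult_right[of "ball (0::'a) 1" c "\<lambda>_. 1"]
  by (simp add: cone_integral_def lmeasure_integral[OF lmeasurable_ball])

lemma abs_cone_integral_le:
  fixes \<phi> :: "'a::euclidean_space \<Rightarrow> real"
  assumes \<phi>: "continuous_on (sphere 0 1) \<phi>" and B: "0 \<le> B" "\<And>\<xi>. norm \<xi> = 1 \<Longrightarrow> \<bar>\<phi> \<xi>\<bar> \<le> B"
  shows "\<bar>cone_integral \<phi>\<bar> \<le> B * measure lebesgue (ball (0::'a) 1)"
proof -
  \<comment> \<open>The bound is known only on the unit sphere, so the value at the origin, a null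
    set, is reset to 0.\<close>
  define \<psi> where "\<psi> x = (if x = 0 then 0 else \<phi> (x /\<^sub>R norm x))" for x
  have eq: "cone_integral \<phi> = integral (ball 0 1) \<psi>"
    unfolding cone_integral_def \<psi>_def by (rule integral_spike[OF negligible_sing[of 0]]) auto
  have int: "\<psi> integrable_on ball 0 1"
    by (rule integrable_spike[OF integrable_normalize(2)[OF \<phi>] negligible_sing[of 0]]) (auto simp: \<psi>_def)
  have "norm (integral (ball 0 1) \<psi>) \<le> integral (ball (0::'a) 1) (\<lambda>_. B)"
  proof (rule integral_norm_bound_integral[OF int])
    show "(\<lambda>_::'a. B) integrable_on ball 0 1" by (rule integrable_on_const) simp
    fix x :: 'a
    have "norm (x /\<^sub>R norm x) = 1" if "x \<noteq> 0" using that by simp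
    then show "norm (\<psi> x) \<le> B" unfolding \<psi>_def using B(1) B(2)[of "x /\<^sub>R norm x"] by auto
  qed
  then show ?thesis using cone_integral_const[of B, where 'a = 'a] unfolding eq by (simp add: cone_integral_def)
qed

text \<open>A linear functional u . x is not maximal at an interior point, which could be moved
  further along u. The maximum over the closure is thus attained on the frontier, where points have
  the radial form.\<close>

lemma support_fun_radial:
  fixes \<Omega> :: "'a::euclidean_space set"
  assumes \<Omega>: "open \<Omega>" "bounded \<Omega>" and fr: "frontier \<Omega> = {R \<xi> *\<^sub>R \<xi> | \<xi>. norm \<xi> = 1}"
    and u: "norm u = 1"
  shows "norm \<xi> = 1 \<Longrightarrow> R \<xi> * (\<xi> \<bullet> u) \<le> support_fun (closure \<Omega>) u"
    and "\<exists>\<xi>. norm \<xi> = 1 \<and> support_fun (closure \<Omega>) u = R \<xi> * (\<xi> \<bullet> u)"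
proof -
  have K: "compact (closure \<Omega>)" using \<Omega>(2) by (simp add: compact_closure)
  obtain M where M: "\<And>x. x \<in> closure \<Omega> \<Longrightarrow> norm x \<le> M"
    using compact_imp_bounded[OF K] bounded_pos by blast
  have frc: "R \<xi> *\<^sub>R \<xi> \<in> closure \<Omega>" if "norm \<xi> = 1" for \<xi>
    using fr that frontier_def[of \<Omega>] by blast
  have ne: "closure \<Omega> \<noteq> {}" using frc[OF u] by auto
  have inner_le: "x \<bullet> u \<le> support_fun (closure \<Omega>) u" if "x \<in> closure \<Omega>" for x
    using inner_le_support_fun[OF K ne M] that by blast
  show "norm \<xi> = 1 \<Longrightarrow> R \<xi> * (\<xi> \<bullet> u) \<le> support_fun (closure \<Omega>) u"
    using inner_le[OF frc] by simp
  obtain x where x: "x \<in> closure \<Omega>" "x \<bullet> u = support_fun (closure \<Omega>) u"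
    using support_fun_attained[OF K ne M] by blast
  have "x \<notin> \<Omega>"
  proof
    assume "x \<in> \<Omega>"
    then obtain e where e: "e > 0" "cball x e \<subseteq> \<Omega>" using \<Omega>(1) open_contains_cball by blast
    have "x + e *\<^sub>R u \<in> cball x e" using u e by (simp add: dist_norm)
    then have "x + e *\<^sub>R u \<in> closure \<Omega>" using e closure_subset by blast
    then have "(x + e *\<^sub>R u) \<bullet> u \<le> x \<bullet> u" unfolding x(2) by (rule inner_le)
    moreover have "(x + e *\<^sub>R u) \<bullet> u = x \<bullet> u + e" using u by (simp add: inner_add_left power2_norm_eq_inner[symmetric])
    ultimately show False using e by simp
  qed
  then have "x \<in> frontier \<Omega>" using x \<Omega>(1) by (simp add: frontier_def interior_open)
  then obtain \<xi> where "norm \<xi> = 1" "x = R \<xi> *\<^sub>R \<xi>" using fr by auto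
  then show "\<exists>\<xi>. norm \<xi> = 1 \<and> support_fun (closure \<Omega>) u = R \<xi> * (\<xi> \<bullet> u)"
    using x by (intro exI[of _ \<xi>]) auto
qed

section \<open>The second-order expansion of W_(n-1)\<close>

theorem theorem3p2:
  fixes \<Omega> :: "real \<Rightarrow> 'a::euclidean_space set"
    and r :: "'a \<Rightarrow> real \<Rightarrow> real"
    and V A :: "'a \<Rightarrow> real"
  assumes dim: "DIM('a) \<ge> 2"
    and fam: "\<exists>\<delta>>0. \<forall>t. \<bar>t\<bar> < \<delta> \<longrightarrow>
               open (\<Omega> t) \<and> bounded (\<Omega> t) \<and> convex (\<Omega> t) \<and>
               frontier (\<Omega> t) = {r \<xi> t *\<^sub>R \<xi> | \<xi>. norm \<xi> = 1}"
    and init: "\<Omega> 0 = ball 0 1"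
    and expand: "\<forall>\<epsilon>>0. \<exists>\<eta>>0. \<forall>t \<xi>. \<bar>t\<bar> < \<eta> \<and> norm \<xi> = 1 \<longrightarrow>
               \<bar>r \<xi> t - (1 + t * V \<xi> + t\<^sup>2 / 2 * A \<xi>)\<bar> \<le> \<epsilon> * t\<^sup>2"
    and smoothV: "C2_sphere V"
    and smoothA: "C2_sphere A"
  shows "(\<lambda>t. quermass (\<Omega> t) (DIM('a) - 1)
            - (measure lebesgue (ball (0::'a) 1)
               + t / real DIM('a) * sph_integral V
               + t\<^sup>2 / (2 * real DIM('a) * (real DIM('a) - 1)) *
                 sph_integral (\<lambda>\<xi>. (real DIM('a) - 1) * A \<xi>
                    + 2 * (real DIM('a) - 3) * S2 (sph_hess V \<xi>)
                    - ((real DIM('a))\<^sup>2 - 6 * real DIM('a) + 7) * (norm (sph_grad V \<xi>))\<^sup>2)))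
         \<in> o[at (0::real)](\<lambda>t. t\<^sup>2)"
proof -
  interpret V: C2_sphere_fun V by (rule C2_sphere_fun.intro[OF smoothV])
  interpret A: C2_sphere_fun A by (rule C2_sphere_fun.intro[OF smoothA])
  define n where "n = real DIM('a)"
  have n: "n \<ge> 2" using dim by (simp add: n_def)
  define \<omega> where "\<omega> = measure lebesgue (ball (0::'a) 1)"
  have w0: "\<omega> \<ge> 0" by (simp add: \<omega>_def)
  define \<gamma> where "\<gamma> \<xi> = (norm (sph_grad V \<xi>))\<^sup>2" for \<xi>
  define \<sigma> where "\<sigma> \<xi> = S2 (sph_hess V \<xi>)" for \<xi>
  have cV: "continuous_on (sphere 0 1) V" and cA: "continuous_on (sphere 0 1) A"
    using continuous_on_sphere_C2 smoothV smoothA by auto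
  have cG: "continuous_on (sphere 0 1) (\<lambda>\<xi>. norm (sph_grad V \<xi>))"
     "continuous_on (sphere 0 1) (\<lambda>\<xi>. norm (sph_grad A \<xi>))"
    by (intro continuous_intros V.continuous_on_sphere_grad A.continuous_on_sphere_grad)+
  have c\<gamma>: "continuous_on (sphere 0 1) \<gamma>" unfolding \<gamma>_def by (intro continuous_intros cG)
  have c\<sigma>: "continuous_on (sphere 0 1) \<sigma>" unfolding \<sigma>_def by (rule V.continuous_on_sphere_S2)

  obtain BV where BV: "BV \<ge> 0" "\<And>x. norm x = 1 \<Longrightarrow> \<bar>V x\<bar> \<le> BV" using normalize_bounded[OF cV] by metis
  obtain BA where BA: "BA \<ge> 0" "\<And>x. norm x = 1 \<Longrightarrow> \<bar>A x\<bar> \<le> BA" using normalize_bounded[OF cA] by metis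
  obtain BG where BG: "BG \<ge> 0" "\<And>x. norm x = 1 \<Longrightarrow> norm (sph_grad V x) \<le> BG"
    using normalize_bounded[OF cG(1)] by (metis abs_norm_cancel)
  obtain BH where BH: "BH \<ge> 0" "\<And>x. norm x = 1 \<Longrightarrow> norm (sph_grad A x) \<le> BH"
    using normalize_bounded[OF cG(2)] by (metis abs_norm_cancel)
  obtain CV where CV: "CV \<ge> 0" "\<And>\<xi> u. norm \<xi> = 1 \<Longrightarrow> norm u = 1 \<Longrightarrow>
     \<bar>V \<xi> - V u - sph_grad V u \<bullet> (\<xi> - u)\<bar> \<le> CV * (norm (\<xi> - u))\<^sup>2"
    using V.taylor_sphere by blast
  obtain CA where CA: "CA \<ge> 0" "\<And>\<xi> u. norm \<xi> = 1 \<Longrightarrow> norm u = 1 \<Longrightarrow>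
     \<bar>A \<xi> - A u - sph_grad A u \<bullet> (\<xi> - u)\<bar> \<le> CA * (norm (\<xi> - u))\<^sup>2"
    using A.taylor_sphere by blast
  \<comment> \<open>One constant for all bounds. The part BH + 2 CA is a Lipschitz constant of A on
    the sphere, where distances are at most 2, and the summand 1 permits raising powers of
    D.\<close>
  define D where "D = 1 + BV + BA + BG + CV + (BH + CA * 2)"
  have D: "D \<ge> 1" "BV \<le> D" "BA \<le> D" "BG \<le> D" "CV \<le> D" "BH + CA * 2 \<le> D"
    using BV BA BG BH CV CA by (auto simp: D_def)
  have LA: "\<bar>A \<xi> - A u\<bar> \<le> D * norm (\<xi> - u)" if xi: "norm \<xi> = 1" and u: "norm u = 1" for \<xi> u
  proof -
    define d where "d = norm (\<xi> - u)"
    have d2: "d \<le> 2" using norm_triangle_ineq4[of \<xi> u] xi u by (simp add: d_def)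
    have "\<bar>sph_grad A u \<bullet> (\<xi> - u)\<bar> \<le> norm (sph_grad A u) * d" unfolding d_def by (rule Cauchy_Schwarz_ineq2)
    also have "\<dots> \<le> BH * d" using BH u by (intro mult_right_mono) (auto simp: d_def)
    finally have "\<bar>A \<xi> - A u\<bar> \<le> BH * d + CA * d\<^sup>2"
      using CA(2)[OF xi u] unfolding d_def by linarith
    also have "CA * d\<^sup>2 \<le> CA * (2 * d)"
      unfolding power2_eq_square using d2 CA by (intro mult_left_mono mult_right_mono) (auto simp: d_def)
    also have "BH * d + CA * (2 * d) = (BH + CA * 2) * d" by (simp add: algebra_simps)
    also have "\<dots> \<le> D * d" using D by (intro mult_right_mono) (auto simp: d_def)
    finally show ?thesis by (simp add: d_def)
  qed
  have TV: "\<bar>V \<xi> - V u - sph_grad V u \<bullet> (\<xi> - u)\<bar> \<le> D * (norm (\<xi> - u))\<^sup>2"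
    if "norm \<xi> = 1" "norm u = 1" for \<xi> u
    using CV(2)[OF that] mult_right_mono[OF D(5), of "(norm (\<xi> - u))\<^sup>2"] by simp
  have gu: "sph_grad V u \<bullet> u = 0" if "norm u = 1" for u
    using V.inner_G_self[of u] that by (force simp: V.sph_grad_eq)
  obtain \<delta> where \<delta>: "\<delta> > 0" "\<And>t. \<bar>t\<bar> < \<delta> \<Longrightarrow> open (\<Omega> t)" "\<And>t. \<bar>t\<bar> < \<delta> \<Longrightarrow> bounded (\<Omega> t)"
      "\<And>t. \<bar>t\<bar> < \<delta> \<Longrightarrow> convex (\<Omega> t)" "\<And>t. \<bar>t\<bar> < \<delta> \<Longrightarrow> frontier (\<Omega> t) = {r \<xi> t *\<^sub>R \<xi> | \<xi>. norm \<xi> = 1}"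
    using fam by blast

  define tgt where "tgt t \<xi> = 1 + t * V \<xi> + t\<^sup>2 / 2 * (A \<xi> + \<gamma> \<xi>)" for t \<xi>
  have ctgt: "continuous_on (sphere 0 1) (tgt t)" for t
    unfolding tgt_def by (intro continuous_intros cV cA c\<gamma>)

  have target: "\<omega> + t / n * sph_integral V + t\<^sup>2 / (2 * n * (n - 1)) *
      sph_integral (\<lambda>\<xi>. (n - 1) * A \<xi> + 2 * (n - 3) * \<sigma> \<xi> - (n\<^sup>2 - 6 * n + 7) * \<gamma> \<xi>)
      = cone_integral (tgt t)" for t
  proof -
    have cm: "continuous_on (sphere 0 1) (\<lambda>\<xi>. c * \<phi> \<xi>)" if "continuous_on (sphere 0 1) \<phi>" for c :: real and \<phi> :: "'a \<Rightarrow> real"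
      using that by (intro continuous_intros)
    have bo: "2 * cone_integral \<sigma> = (n - 2) * cone_integral \<gamma>"
    proof -
      have "n * cone_integral (\<lambda>\<xi>. 2 * \<sigma> \<xi> - (n - 2) * \<gamma> \<xi>) = 0"
        using V.bochner_sphere unfolding sph_integral_eq by (simp add: n_def \<sigma>_def \<gamma>_def)
      then show ?thesis
        using n by (simp add: cone_integral_diff[OF cm cm] c\<sigma> c\<gamma> cone_integral_cmult)
    qed
    have "cone_integral (\<lambda>\<xi>. (n - 1) * A \<xi> + 2 * (n - 3) * \<sigma> \<xi> - (n\<^sup>2 - 6 * n + 7) * \<gamma> \<xi>) =
      (n - 1) * cone_integral A + 2 * (n - 3) * cone_integral \<sigma> - (n\<^sup>2 - 6 * n + 7) * cone_integral \<gamma>"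
    proof -
      have "cone_integral (\<lambda>\<xi>. (n - 1) * A \<xi> + 2 * (n - 3) * \<sigma> \<xi> - (n\<^sup>2 - 6 * n + 7) * \<gamma> \<xi>) =
        cone_integral (\<lambda>\<xi>. (n - 1) * A \<xi> + 2 * (n - 3) * \<sigma> \<xi>) - cone_integral (\<lambda>\<xi>. (n\<^sup>2 - 6 * n + 7) * \<gamma> \<xi>)"
        by (intro cone_integral_diff continuous_on_add cm cA c\<sigma> c\<gamma>)
      also have "cone_integral (\<lambda>\<xi>. (n - 1) * A \<xi> + 2 * (n - 3) * \<sigma> \<xi>) =
        cone_integral (\<lambda>\<xi>. (n - 1) * A \<xi>) + cone_integral (\<lambda>\<xi>. 2 * (n - 3) * \<sigma> \<xi>)"
        by (intro cone_integral_add cm cA c\<sigma>)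
      finally show ?thesis by (simp only: cone_integral_cmult)
    qed
    \<comment> \<open>After 2 S_2 is traded for (n - 2) times the squared gradient, the coefficient
      of the latter is (n - 3)(n - 2) - (n^2 - 6n + 7) = n - 1.\<close>
    also have "\<dots> = (n - 1) * (cone_integral A + cone_integral \<gamma>)"
    proof -
      have "2 * (n - 3) * cone_integral \<sigma> = (n - 3) * ((n - 2) * cone_integral \<gamma>)"
        unfolding bo[symmetric] by simp
      then show ?thesis by (simp add: algebra_simps power2_eq_square)
    qed
    finally have 1: "cone_integral (\<lambda>\<xi>. (n - 1) * A \<xi> + 2 * (n - 3) * \<sigma> \<xi> - (n\<^sup>2 - 6 * n + 7) * \<gamma> \<xi>) =
      (n - 1) * (cone_integral A + cone_integral \<gamma>)" .
    have "cone_integral (tgt t) = cone_integral (\<lambda>\<xi>. 1 + t * V \<xi>) + cone_integral (\<lambda>\<xi>. t\<^sup>2 / 2 * (A \<xi> + \<gamma> \<xi>))"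
      unfolding tgt_def by (intro cone_integral_add continuous_intros cV cA c\<gamma>)
    also have "cone_integral (\<lambda>\<xi>. 1 + t * V \<xi>) = \<omega> + t * cone_integral V"
      by (subst cone_integral_add) (auto intro!: continuous_intros cV simp: cone_integral_cmult cone_integral_const \<omega>_def)
    also have "cone_integral (\<lambda>\<xi>. t\<^sup>2 / 2 * (A \<xi> + \<gamma> \<xi>)) = t\<^sup>2 / 2 * (cone_integral A + cone_integral \<gamma>)"
      by (simp only: cone_integral_cmult cone_integral_add[OF cA c\<gamma>])
    finally show ?thesis
      unfolding sph_integral_eq n_def[symmetric] 1 using n by (simp add: field_simps)
  qed

  \<comment> \<open>One e t^2 comes from the remainder in the radial expansion. The other bounds the
    cubic error 6 D^4 |t|^3, by the condition 6 D^4 |t| at most e.\<close>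
  have bound: "\<bar>quermass (\<Omega> t) (DIM('a) - 1) - cone_integral (tgt t)\<bar> \<le> (2 * e * t\<^sup>2) * \<omega>"
    if t: "\<bar>t\<bar> < \<delta>" "16 * D * \<bar>t\<bar> \<le> 1" "6 * D ^ 4 * \<bar>t\<bar> \<le> e" and e: "0 < e" "e \<le> 1"
      and R: "\<And>\<xi>. norm \<xi> = 1 \<Longrightarrow> \<bar>r \<xi> t - (1 + t * V \<xi> + t\<^sup>2 / 2 * A \<xi>)\<bar> \<le> e * t\<^sup>2" for t e
  proof -
    note \<Omega> = \<delta>(2-5)[OF t(1)]
    define h where "h = support_fun (closure (\<Omega> t))"
    obtain u0 :: 'a where u0: "norm u0 = 1" using vector_choose_size[of 1] by auto
    have ne: "\<Omega> t \<noteq> {}"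
    proof
      assume "\<Omega> t = {}"
      then have "{r \<xi> t *\<^sub>R \<xi> | \<xi>. norm \<xi> = 1} = {}" using \<Omega>(4) by simp
      then show False using u0 by blast
    qed
    have K: "compact (closure (\<Omega> t))" "closure (\<Omega> t) \<noteq> {}" using \<Omega>(2) ne by (auto simp: compact_closure)
    obtain M where M: "\<And>x. x \<in> closure (\<Omega> t) \<Longrightarrow> norm x \<le> M"
      using compact_imp_bounded[OF K(1)] bounded_pos by blast
    have ch: "continuous_on (sphere 0 1) h" unfolding h_def by (rule continuous_on_support_fun[OF K M])
    have err: "6 * D ^ 4 * \<bar>t\<bar> ^ 3 \<le> e * t\<^sup>2"
    proof -
      have "6 * D ^ 4 * \<bar>t\<bar> ^ 3 = (6 * D ^ 4 * \<bar>t\<bar>) * t\<^sup>2"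
        by (simp add: power3_eq_cube power2_eq_square)
      also have "\<dots> \<le> e * t\<^sup>2" using t(3) by (rule mult_right_mono) simp
      finally show ?thesis .
    qed
    have pt: "\<bar>h u - tgt t u\<bar> \<le> 2 * e * t\<^sup>2" if u: "norm u = 1" for u
    proof -
      note sup = support_fun_radial[of "\<Omega> t" "\<lambda>\<xi>. r \<xi> t", OF \<Omega>(1,2,4) u, folded h_def]
      have bnd: "\<And>\<xi>. norm \<xi> = 1 \<Longrightarrow> \<bar>V \<xi>\<bar> \<le> D" "\<And>\<xi>. norm \<xi> = 1 \<Longrightarrow> \<bar>A \<xi>\<bar> \<le> D" "norm (sph_grad V u) \<le> D"
        using BV(2) BA(2) BG(2)[OF u] D by (auto intro: order.trans)
      obtain \<xi> where xi: "norm \<xi> = 1" "h u = r \<xi> t * (\<xi> \<bullet> u)" using sup(2) by blast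
      have "h u \<le> 1 + t * V u + t\<^sup>2 / 2 * (A u + (norm (sph_grad V u))\<^sup>2) + e * t\<^sup>2 + 6 * D ^ 4 * \<bar>t\<bar> ^ 3"
        unfolding xi(2)
        using support_expansion_upper[of \<xi> u D V A "sph_grad V u" "\<lambda>\<xi>. r \<xi> t" t e]
          xi(1) u D(1) bnd TV[OF xi(1) u] LA[OF xi(1) u] R[OF xi(1)] e t(2) by simp
      moreover obtain \<zeta> where z: "norm \<zeta> = 1"
        "1 + t * V u + t\<^sup>2 / 2 * (A u + (norm (sph_grad V u))\<^sup>2) - e * t\<^sup>2 - 6 * D ^ 4 * \<bar>t\<bar> ^ 3 \<le> r \<zeta> t * (\<zeta> \<bullet> u)"
        using support_expansion_lower[of u "sph_grad V u" D V A "\<lambda>\<xi>. r \<xi> t" t e]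
          u gu[OF u] D(1) bnd TV[OF _ u] LA[OF _ u] R e t(2) by auto
      moreover have "r \<zeta> t * (\<zeta> \<bullet> u) \<le> h u" using sup(1)[OF z(1)] .
      ultimately show ?thesis using err unfolding tgt_def \<gamma>_def abs_le_iff by linarith
    qed
    have "quermass (\<Omega> t) (DIM('a) - 1) = cone_integral h"
      using quermass_mean_width[OF \<Omega>(1-3) ne] by (simp add: h_def cone_integral_def)
    then have "\<bar>quermass (\<Omega> t) (DIM('a) - 1) - cone_integral (tgt t)\<bar> = \<bar>cone_integral (\<lambda>\<xi>. h \<xi> - tgt t \<xi>)\<bar>"
      by (simp add: cone_integral_diff[OF ch ctgt])
    also have "\<dots> \<le> (2 * e * t\<^sup>2) * \<omega>"
      unfolding \<omega>_def using pt e by (intro abs_cone_integral_le continuous_on_diff ch ctgt) auto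
    finally show ?thesis .
  qed

  have "(\<lambda>t. quermass (\<Omega> t) (DIM('a) - 1) - cone_integral (tgt t)) \<in> o[at 0](\<lambda>t. t\<^sup>2)"
  proof (rule landau_o.smallI)
    fix c :: real assume c: "c > 0"
    \<comment> \<open>Chosen so that 2 e \<omega> is at most c; the 1 added to \<omega> makes the
      denominator visibly positive.\<close>
    define e where "e = min 1 (c / (2 * (\<omega> + 1)))"
    have e: "0 < e" "e \<le> 1" using c w0 by (auto simp: e_def)
    have ec: "2 * e * \<omega> \<le> c"
    proof -
      have "e \<le> c / (2 * (\<omega> + 1))" by (simp add: e_def)
      then have "2 * e * (\<omega> + 1) \<le> c" using w0 by (simp add: field_simps)
      then show ?thesis using e by (simp add: algebra_simps)
    qed
    obtain \<eta> where \<eta>: "\<eta> > 0" "\<And>t \<xi>. \<bar>t\<bar> < \<eta> \<Longrightarrow> norm \<xi> = 1 \<Longrightarrow>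
        \<bar>r \<xi> t - (1 + t * V \<xi> + t\<^sup>2 / 2 * A \<xi>)\<bar> \<le> e * t\<^sup>2"
      using expand e(1) by blast
    \<comment> \<open>The four bounds secure in turn the hypotheses on the family, the radial
      expansion with error e, the smallness used in the support bounds, and the cubic error.\<close>
    define \<tau> where "\<tau> = min (min \<delta> \<eta>) (min (1 / (16 * D)) (e / (6 * D ^ 4)))"
    have \<tau>: "\<tau> > 0" using \<delta>(1) \<eta>(1) D(1) e by (simp add: \<tau>_def)
    have "norm (quermass (\<Omega> t) (DIM('a) - 1) - cone_integral (tgt t)) \<le> c * norm (t\<^sup>2)" if t: "\<bar>t\<bar> < \<tau>" for t
    proof -
      have "\<bar>t\<bar> < \<delta>" "\<bar>t\<bar> < \<eta>" "\<bar>t\<bar> \<le> 1 / (16 * D)" "\<bar>t\<bar> \<le> e / (6 * D ^ 4)"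
        using t by (auto simp: \<tau>_def)
      moreover from this have "16 * D * \<bar>t\<bar> \<le> 1" "6 * D ^ 4 * \<bar>t\<bar> \<le> e"
        using D(1) by (simp_all add: pos_le_divide_eq mult.commute)
      ultimately have "\<bar>quermass (\<Omega> t) (DIM('a) - 1) - cone_integral (tgt t)\<bar> \<le> (2 * e * t\<^sup>2) * \<omega>"
        using \<eta>(2) e by (intro bound) auto
      also have "\<dots> = (2 * e * \<omega>) * t\<^sup>2" by simp
      also have "\<dots> \<le> c * t\<^sup>2" using ec by (rule mult_right_mono) simp
      finally show ?thesis by simp
    qed
    then show "\<forall>\<^sub>F t in at 0. norm (quermass (\<Omega> t) (DIM('a) - 1) - cone_integral (tgt t)) \<le> c * norm (t\<^sup>2)"
      using \<tau> by (auto simp: eventually_at dist_norm)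
  qed
  then show ?thesis
    unfolding target[symmetric] by (simp only: n_def \<omega>_def \<sigma>_def \<gamma>_def)
qed

end
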